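(* Let $v_1,\ldots,v_m\in\mathbb{R}^d$ and let $k\ge d$ be an integer. Let $x\in\mathbb{R}^m_{\ge 0}$ be an optimal solution of the A-design convex relaxation \[ \text{minimize } \operatorname{tr}\Big(\Big(\sum_{i=1}^m x(i)\,v_iv_i^\top\Big)^{-1}\Big)\quad\text{subject to}\quad \sum_{i=1}^m x(i)\le k,\ x(i)\ge 0\ (i\in[m]), \] normalized so that $\sum_{i=1}^m x(i)=k$, and let $X=\sum_{i=1}^m x(i)v_iv_i^\top$. There is a deterministic rounding algorithm (based on the method of interlacing polynomials) that, given $v_1,\ldots,v_m$, $k$ and $x$, outputs $(s_1,\ldots,s_k)\in[m]^k$ (a multiset of $k$ of the vectors, repetitions allowed) with \[ \operatorname{tr}\Big(\Big(\sum_{j=1}^k v_{s_j}v_{s_j}^\top\Big)^{-1}\Big)\ \le\ \frac{k}{k-d+1}\,\operatorname{tr}(X^{-1}). \] In particular this is a $k/(k-d+1)$-approximation algorithm for A-design (choosing a multiset $S$ of $k$ of the vectors minimizing $\operatorname{tr}((\sum_{i\in S}v_iv_i^\top)^{-1})$). The rounding algorithm runs in $O(kmd^{\omega+1})$ time, where $\omega$ is the matrix-multiplication exponent.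
   Context: Solutions are multisets (selection with repetitions allowed). The trace of the inverse of a singular positive semidefinite matrix is taken to be $+\infty$. *)

theory Defs
  imports
    "HOL-Library.Extended_Real"
    "HOL-Library.Multiset"
    "Jordan_Normal_Form.Gauss_Jordan_Elimination"
begin

section \<open>A-optimal design\<close>

definition mat_trace :: "real mat \<Rightarrow> real" where
  "mat_trace A = (\<Sum>i<dim_row A. A $$ (i, i))"

definition trace_inverse :: "real mat \<Rightarrow> ereal" where
  "trace_inverse A = (case mat_inverse A of None \<Rightarrow> \<infinity> | Some B \<Rightarrow> ereal (mat_trace B))"

definition fractional_matrix :: "nat \<Rightarrow> nat \<Rightarrow> (nat \<Rightarrow> real vec) \<Rightarrow> (nat \<Rightarrow> real) \<Rightarrow> real mat" where
  "fractional_matrix d m v x = mat d d (\<lambda>(a, b). \<Sum>i<m. x i * (v i $ a * v i $ b))"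

definition design_matrix :: "nat \<Rightarrow> (nat \<Rightarrow> real vec) \<Rightarrow> nat multiset \<Rightarrow> real mat" where
  "design_matrix d v S = mat d d (\<lambda>(a, b). \<Sum>i\<in>#S. v i $ a * v i $ b)"

definition relaxation_feasible :: "nat \<Rightarrow> nat \<Rightarrow> (nat \<Rightarrow> real) \<Rightarrow> bool" where
  "relaxation_feasible m k x \<longleftrightarrow> (\<forall>i<m. 0 \<le> x i) \<and> (\<Sum>i<m. x i) \<le> real k"

definition relaxation_optimal ::
    "nat \<Rightarrow> nat \<Rightarrow> nat \<Rightarrow> (nat \<Rightarrow> real vec) \<Rightarrow> (nat \<Rightarrow> real) \<Rightarrow> bool" where
  "relaxation_optimal d m k v x \<longleftrightarrow> relaxation_feasible m k x \<and>
     (\<forall>y. relaxation_feasible m k y \<longrightarrow>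
        trace_inverse (fractional_matrix d m v x) \<le> trace_inverse (fractional_matrix d m v y))"

definition A_design_opt :: "nat \<Rightarrow> nat \<Rightarrow> nat \<Rightarrow> (nat \<Rightarrow> real vec) \<Rightarrow> ereal" where
  "A_design_opt d m k v =
     (INF S\<in>{S. size S = k \<and> set_mset S \<subseteq> {..<m}}. trace_inverse (design_matrix d v S))"


section \<open>A real RAM\<close>

text \<open>
  Programs of a while language over named arrays: one-dimensional arrays of natural numbers
  (for control and addressing) and two-dimensional arrays of reals. A scalar is an array cell
  with index 0. There is no multiplication of natural numbers, no rounding of reals, and the only
  real constants are images of natural numbers, so unit cost per operation gives no power
  beyond the usual real RAM. Division by zero returns 0 (as in HOL); a program can test for it.
\<close>

datatype nexp =
    NConst nat
  | NGet string nexp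
  | NAdd nexp nexp
  | NSub nexp nexp

datatype rexp =
    RNat nexp
  | RGet string nexp nexp
  | RAdd rexp rexp
  | RSub rexp rexp
  | RMul rexp rexp
  | RDiv rexp rexp

datatype bexp =
    NLess nexp nexp
  | RLess rexp rexp
  | BNot bexp
  | BAnd bexp bexp

datatype com =
    Skip
  | NSet string nexp nexp
  | RSet string nexp nexp rexp
  | Seq com com
  | If bexp com com
  | While bexp com

type_synonym state = "(string \<Rightarrow> nat \<Rightarrow> nat) \<times> (string \<Rightarrow> nat \<Rightarrow> nat \<Rightarrow> real)"

primrec nval :: "nexp \<Rightarrow> state \<Rightarrow> nat" where
  "nval (NConst c) s = c"
| "nval (NGet a i) s = fst s a (nval i s)"
| "nval (NAdd e f) s = nval e s + nval f s"
| "nval (NSub e f) s = nval e s - nval f s"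

primrec rval :: "rexp \<Rightarrow> state \<Rightarrow> real" where
  "rval (RNat e) s = real (nval e s)"
| "rval (RGet a i j) s = snd s a (nval i s) (nval j s)"
| "rval (RAdd e f) s = rval e s + rval f s"
| "rval (RSub e f) s = rval e s - rval f s"
| "rval (RMul e f) s = rval e s * rval f s"
| "rval (RDiv e f) s = rval e s / rval f s"

primrec bval :: "bexp \<Rightarrow> state \<Rightarrow> bool" where
  "bval (NLess e f) s = (nval e s < nval f s)"
| "bval (RLess e f) s = (rval e s < rval f s)"
| "bval (BNot b) s = (\<not> bval b s)"
| "bval (BAnd b c) s = (bval b s \<and> bval c s)"

primrec ncost :: "nexp \<Rightarrow> nat" where
  "ncost (NConst c) = 1"
| "ncost (NGet a i) = 1 + ncost i"
| "ncost (NAdd e f) = 1 + ncost e + ncost f"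
| "ncost (NSub e f) = 1 + ncost e + ncost f"

primrec rcost :: "rexp \<Rightarrow> nat" where
  "rcost (RNat e) = 1 + ncost e"
| "rcost (RGet a i j) = 1 + ncost i + ncost j"
| "rcost (RAdd e f) = 1 + rcost e + rcost f"
| "rcost (RSub e f) = 1 + rcost e + rcost f"
| "rcost (RMul e f) = 1 + rcost e + rcost f"
| "rcost (RDiv e f) = 1 + rcost e + rcost f"

primrec bcost :: "bexp \<Rightarrow> nat" where
  "bcost (NLess e f) = 1 + ncost e + ncost f"
| "bcost (RLess e f) = 1 + rcost e + rcost f"
| "bcost (BNot b) = 1 + bcost b"
| "bcost (BAnd b c) = 1 + bcost b + bcost c"

definition nupdate :: "state \<Rightarrow> string \<Rightarrow> nat \<Rightarrow> nat \<Rightarrow> state" where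
  "nupdate s a i y = ((fst s)(a := (fst s a)(i := y)), snd s)"

definition rupdate :: "state \<Rightarrow> string \<Rightarrow> nat \<Rightarrow> nat \<Rightarrow> real \<Rightarrow> state" where
  "rupdate s a i j y = (fst s, (snd s)(a := (snd s a)(i := (snd s a i)(j := y))))"

text \<open>\<open>exec c s t s'\<close>: started in \<open>s\<close>, the program \<open>c\<close> halts in \<open>s'\<close> after exactly \<open>t\<close> steps.\<close>

inductive exec :: "com \<Rightarrow> state \<Rightarrow> nat \<Rightarrow> state \<Rightarrow> bool" where
  Skip: "exec Skip s 1 s"
| NSet: "exec (NSet a i e) s (1 + ncost i + ncost e) (nupdate s a (nval i s) (nval e s))"
| RSet: "exec (RSet a i j e) s (1 + ncost i + ncost j + rcost e)
           (rupdate s a (nval i s) (nval j s) (rval e s))"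
| Seq: "exec c s t s' \<Longrightarrow> exec c' s' t' s'' \<Longrightarrow> exec (Seq c c') s (t + t') s''"
| IfTrue: "bval b s \<Longrightarrow> exec c s t s' \<Longrightarrow> exec (If b c c') s (1 + bcost b + t) s'"
| IfFalse: "\<not> bval b s \<Longrightarrow> exec c' s t s' \<Longrightarrow> exec (If b c c') s (1 + bcost b + t) s'"
| WhileFalse: "\<not> bval b s \<Longrightarrow> exec (While b c) s (1 + bcost b) s"
| WhileTrue: "bval b s \<Longrightarrow> exec c s t s' \<Longrightarrow> exec (While b c) s' t' s'' \<Longrightarrow>
     exec (While b c) s (1 + bcost b + t + t') s''"

inductive_cases exec_SkipE: "exec Skip s t s'"
inductive_cases exec_NSetE: "exec (NSet a i e) s t s'"
inductive_cases exec_RSetE: "exec (RSet a i j e) s t s'"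
inductive_cases exec_SeqE: "exec (Seq c c') s t s'"
inductive_cases exec_IfE: "exec (If b c c') s t s'"
inductive_cases exec_WhileE: "exec (While b c) s t s'"

lemma exec_deterministic:
  "exec c s t s' \<Longrightarrow> exec c s u s'' \<Longrightarrow> u = t \<and> s'' = s'"
proof (induction arbitrary: u s'' rule: exec.induct)
  case Skip
  then show ?case by (auto elim: exec_SkipE)
next
  case NSet
  then show ?case by (auto elim: exec_NSetE)
next
  case RSet
  then show ?case by (auto elim: exec_RSetE)
next
  case (Seq c s t s' c' t' s2)
  from Seq.prems show ?case
    by (rule exec_SeqE) (metis Seq.IH)
next
  case (IfTrue b s c t s' c')
  from IfTrue.prems show ?case
    by (rule exec_IfE) (use IfTrue.hyps in \<open>auto dest: IfTrue.IH\<close>)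
next
  case (IfFalse b s c' t s' c)
  from IfFalse.prems show ?case
    by (rule exec_IfE) (use IfFalse.hyps in \<open>auto dest: IfFalse.IH\<close>)
next
  case (WhileFalse b s c)
  from WhileFalse.prems show ?case
    by (rule exec_WhileE) (use WhileFalse.hyps in simp_all)
next
  case (WhileTrue b s c t s' t' s2)
  from WhileTrue.prems show ?case
    by (rule exec_WhileE) (use WhileTrue.hyps in simp, metis One_nat_def plus_1_eq_Suc add_Suc WhileTrue.IH)
qed


section \<open>The matrix multiplication exponent\<close>

definition matmul_input :: "nat \<Rightarrow> real mat \<Rightarrow> real mat \<Rightarrow> state" where
  "matmul_input n A B =
     ((\<lambda>a i. if a = ''n'' \<and> i = 0 then n else 0),
      (\<lambda>a i j. if i < n \<and> j < n then
                 if a = ''A'' then A $$ (i, j) else if a = ''B'' then B $$ (i, j) else 0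
               else 0))"

definition matmul_output :: "nat \<Rightarrow> state \<Rightarrow> real mat" where
  "matmul_output n s = mat n n (\<lambda>(i, j). snd s ''C'' i j)"

text \<open>
  Exponents are taken over the same machine model in which the rounding algorithm is timed. The output
  array \<open>C\<close> is initially zero.
\<close>

definition matmul_exponents :: "real set" where
  "matmul_exponents = {w. \<exists>P C. \<forall>n\<ge>1. \<forall>A\<in>carrier_mat n n. \<forall>B\<in>carrier_mat n n.
     \<exists>t s. exec P (matmul_input n A B) t s \<and> matmul_output n s = A * B \<and>
           real t \<le> C * real n powr w}"

definition matmul_exponent :: real where
  "matmul_exponent = Inf matmul_exponents"


section \<open>Input and output of a rounding algorithm\<close>

definition rounding_input ::
    "nat \<Rightarrow> nat \<Rightarrow> nat \<Rightarrow> (nat \<Rightarrow> real vec) \<Rightarrow> (nat \<Rightarrow> real) \<Rightarrow> state" where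
  "rounding_input d m k v x =
     ((\<lambda>a i. if i = 0 then
               if a = ''d'' then d else if a = ''m'' then m else if a = ''k'' then k else 0
             else 0),
      (\<lambda>a i j. if a = ''v'' \<and> i < m \<and> j < d then v i $ j
               else if a = ''x'' \<and> i < m \<and> j = 0 then x i else 0))"

definition rounding_output :: "nat \<Rightarrow> state \<Rightarrow> nat list" where
  "rounding_output k s = map (fst s ''s'') [0..<k]"

end

theory Submission
  imports Defs "Jordan_Normal_Form.Determinant"
begin

text \<open>
  Draw \<open>s\<^sub>1, \<dots>, s\<^sub>k\<close> independently with probabilities \<open>x i / k\<close> and let \<open>A\<close> be the resulting design matrix.
  With \<open>B = X / k\<close>, the expectation of \<open>det A\<close> is \<open>k (k - 1) \<dots> (k - d + 1) det B\<close> and that of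
  \<open>tr (adj A)\<close> is \<open>k (k - 1) \<dots> (k - d + 2) tr (adj B)\<close>, so their ratio is \<open>k / (k - d + 1) tr (X\<^sup>-\<^sup>1)\<close>.
  Fixing the indices one at a time so that the ratio of the conditional expectations is minimal
  never increases it, and at the end the ratio is \<open>tr (A\<^sup>-\<^sup>1)\<close>.

  Conditional on a partial design \<open>A\<close> with \<open>l\<close> draws left, the expected determinant is the linear
  functional \<open>y\<^sup>i \<mapsto> l (l - 1) \<dots> (l - i + 1)\<close> applied to the polynomial \<open>det (A + y B)\<close>. Its degree is at
  most \<open>d\<close>, so it is evaluated by interpolation at \<open>d + 1\<close> points, where the inverse of \<open>A + y B\<close> is
  computed by rank-one updates and yields the value for each candidate vector in \<open>O(d\<^sup>2)\<close> time.
  The total time is \<open>O(k m d\<^sup>3)\<close>, which suffices since the matrix multiplication exponent is at least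
  \<open>2\<close>: a program that multiplies matrices has to write every entry of the product.
\<close>

section \<open>Rank-one updates\<close>

text \<open>The falling factorials come from one fact: \<open>det (P + c u u^T)\<close> is affine in
  \<open>c\<close>. With q(y) = det (A + y B), averaging det (A + y B + v v^T) over one draw v
  therefore gives q + q', so l draws give (1 + D)^l q, and evaluation at 0 sends y^i to its falling
  factorial. The obstacle is singularity. A partial design A may have no inverse, but A + y B is
  positive definite for y > 0, hence the positive interpolation points 1, ..., d + 1. Nor can A + y
  B be built up from 0 through invertible matrices, so the updates start at the identity, which is
  removed at the end by d further updates. Their cost d^3 fits into m d^2 only if d \<le> m; for m <
  d the matrix X is singular, the bound is infinite, and a trivial branch of the program suffices.
  Monotonicity of the mean values needs no spectral theory: the determinant is affine along rank-one
  updates and has no zero on positive definite matrices, and semidefinite ones are limits of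
  these.\<close>

definition rank1_update :: "nat \<Rightarrow> real mat \<Rightarrow> real \<Rightarrow> (nat \<Rightarrow> real) \<Rightarrow> real mat" where
  "rank1_update d P c u = mat d d (\<lambda>(a, b). P $$ (a, b) + c * (u a * u b))"

lemma rank1_update_carrier [simp]: "rank1_update d P c u \<in> carrier_mat d d"
  by (simp add: rank1_update_def)

lemma rank1_update_index [simp]:
  "a < d \<Longrightarrow> b < d \<Longrightarrow> rank1_update d P c u $$ (a, b) = P $$ (a, b) + c * (u a * u b)"
  "dim_row (rank1_update d P c u) = d" "dim_col (rank1_update d P c u) = d"
  by (simp_all add: rank1_update_def)

text \<open>The block matrix [1, -c u^T; z, P], whose Schur complement at the corner 1 is P + c z
  u^T. All occurrences of \<open>c\<close> are in its first row.\<close>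

definition bordered :: "nat \<Rightarrow> real mat \<Rightarrow> real \<Rightarrow> (nat \<Rightarrow> real) \<Rightarrow> (nat \<Rightarrow> real) \<Rightarrow> real mat" where
  "bordered d P c z u = four_block_mat (1\<^sub>m 1) (mat 1 d (\<lambda>(_, b). - c * u b)) (mat d 1 (\<lambda>(a, _). z a)) P"

lemma det_bordered:
  assumes P: "P \<in> carrier_mat d d"
  shows "det (bordered d P c z u) = det (mat d d (\<lambda>(a, b). P $$ (a, b) + c * (z a * u b)))"
proof -
  let ?R = "four_block_mat (1\<^sub>m 1) (mat 1 d (\<lambda>(_, b). c * u b)) (0\<^sub>m d 1) (1\<^sub>m d)"
  let ?S = "mat d d (\<lambda>(a, b). P $$ (a, b) + c * (z a * u b))"
  \<comment> \<open>Right multiplication by \<open>?R\<close> adds c u_b times the first column to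
    column b, which clears the first row.\<close>
  have "bordered d P c z u * ?R = four_block_mat (1\<^sub>m 1) (0\<^sub>m 1 d) (mat d 1 (\<lambda>(a, _). z a)) ?S"
    unfolding bordered_def
    apply (subst mult_four_block_mat[of _ 1 1 _ d _ d _ _ 1 _ d])
    using P apply (auto intro!: cong_four_block_mat eq_matI simp: scalar_prod_def)
    done
  moreover have "det ?R = 1"
    by (subst det_four_block_mat_lower_left_zero[of _ 1 _ d]) auto
  moreover have "det (four_block_mat (1\<^sub>m 1) (0\<^sub>m 1 d) (mat d 1 (\<lambda>(a, _). z a)) ?S) = det ?S"
    by (subst det_four_block_mat_upper_right_zero[of _ 1 _ d]) auto
  moreover have "bordered d P c z u \<in> carrier_mat (1 + d) (1 + d)" "?R \<in> carrier_mat (1 + d) (1 + d)"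
    unfolding bordered_def using P by auto
  ultimately show ?thesis using det_mult[of "bordered d P c z u" "1 + d" ?R] by simp
qed

text \<open>If the large block is the identity, it can be eliminated instead of the corner;
  comparing the two eliminations gives the value.\<close>

lemma det_one_plus_rank1:
  fixes c :: real
  shows "det (mat d d (\<lambda>(a, b). 1\<^sub>m d $$ (a, b) + c * (z a * u b))) = 1 + c * (\<Sum>a<d. u a * z a)"
proof -
  let ?L = "four_block_mat (mat 1 1 (\<lambda>_. 1 + c * (\<Sum>a<d. u a * z a))) (mat 1 d (\<lambda>(_, b). - c * u b)) (0\<^sub>m d 1) (1\<^sub>m d)"
  let ?R = "four_block_mat (1\<^sub>m 1) (0\<^sub>m 1 d) (mat d 1 (\<lambda>(a, _). z a)) (1\<^sub>m d)"
  have "bordered d (1\<^sub>m d) c z u = ?L * ?R"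
    unfolding bordered_def
    apply (subst mult_four_block_mat[of _ 1 1 _ d _ d _ _ 1 _ d])
    apply (auto intro!: cong_four_block_mat eq_matI simp: scalar_prod_def)
    apply (simp add: sum_negf sum_distrib_left atLeast0LessThan mult_ac)
    done
  moreover have "det ?L = 1 + c * (\<Sum>a<d. u a * z a)"
    by (subst det_four_block_mat_lower_left_zero[of _ 1 _ d]) (auto simp: det_single)
  moreover have "det ?R = 1"
    by (subst det_four_block_mat_upper_right_zero[of _ 1 _ d]) auto
  moreover have "?L \<in> carrier_mat (1 + d) (1 + d)" "?R \<in> carrier_mat (1 + d) (1 + d)" by auto
  ultimately have "det (bordered d (1\<^sub>m d) c z u) = 1 + c * (\<Sum>a<d. u a * z a)"
    using det_mult[of ?L "1 + d" ?R] by simp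
  then show ?thesis by (simp add: det_bordered)
qed

text \<open>\<open>P\<close> may be singular, so no formula through its inverse applies. In the
  Laplace expansion along the first row of \<open>bordered\<close> the cofactors do not see
  \<open>c\<close>.\<close>

lemma det_rank1_update_affine:
  assumes P: "P \<in> carrier_mat d d"
  obtains K where "\<And>c. det (rank1_update d P c u) = det P + c * K"
proof -
  let ?M = "\<lambda>c. bordered d P c u u"
  have M: "?M c \<in> carrier_mat (Suc d) (Suc d)" for c
    unfolding bordered_def using P by auto
  have cof: "cofactor (?M c) 0 j = cofactor (?M 0) 0 j" if "j < Suc d" for c j
  proof -
    have "mat_delete (?M c) 0 j = mat_delete (?M 0) 0 j"
      using P that by (intro eq_matI) (auto simp: mat_delete_def bordered_def)
    then show ?thesis by (simp add: cofactor_def)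
  qed
  define K where "K = (\<Sum>j<d. - u j * cofactor (?M 0) 0 (Suc j))"
  have e: "det (rank1_update d P c u) = cofactor (?M 0) 0 0 + c * K" for c
  proof -
    have "det (rank1_update d P c u) = det (?M c)"
      by (simp add: det_bordered[OF P] rank1_update_def)
    also have "\<dots> = (\<Sum>j<Suc d. ?M c $$ (0, j) * cofactor (?M c) 0 j)"
      by (rule laplace_expansion_row[OF M]) simp
    also have "\<dots> = (\<Sum>j<Suc d. ?M c $$ (0, j) * cofactor (?M 0) 0 j)"
      by (intro sum.cong refl arg_cong2[where f = "(*)"] cof) simp
    also have "\<dots> = cofactor (?M 0) 0 0 + (\<Sum>j<d. - c * u j * cofactor (?M 0) 0 (Suc j))"
      unfolding sum.lessThan_Suc_shift using P by (auto simp: bordered_def)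
    finally show ?thesis by (simp add: K_def sum_distrib_left mult_ac sum_negf)
  qed
  have "rank1_update d P 0 u = P" using P by (intro eq_matI) auto
  then have "det P = cofactor (?M 0) 0 0" using e[of 0] by simp
  then show ?thesis using e by (intro that[of K]) simp
qed

lemma det_rank1_update_eq:
  assumes "P \<in> carrier_mat d d"
  shows "det (rank1_update d P c u) = det P + c * (det (rank1_update d P 1 u) - det P)"
proof -
  obtain K where "\<And>c. det (rank1_update d P c u) = det P + c * K"
    using det_rank1_update_affine[OF assms] by blast
  then show ?thesis by simp
qed

text \<open>With z = Q u the updated matrix factors as P (1 + c z u^T), which leaves
  \<open>det_one_plus_rank1\<close>.\<close>

lemma det_rank1_update:
  assumes P: "P \<in> carrier_mat d d" and Q: "Q \<in> carrier_mat d d" and PQ: "P * Q = 1\<^sub>m d"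
  shows "det (rank1_update d P c u) = det P * (1 + c * (\<Sum>a<d. u a * (\<Sum>b<d. Q $$ (a, b) * u b)))"
proof -
  define z where "z a = (\<Sum>b<d. Q $$ (a, b) * u b)" for a
  let ?S = "mat d d (\<lambda>(a, b). 1\<^sub>m d $$ (a, b) + c * (z a * u b))"
  have Pz: "(\<Sum>e<d. P $$ (a, e) * z e) = u a" if a: "a < d" for a
  proof -
    have "(\<Sum>e<d. P $$ (a, e) * z e) = (\<Sum>b<d. (\<Sum>e<d. P $$ (a, e) * Q $$ (e, b)) * u b)"
      unfolding z_def sum_distrib_left sum_distrib_right by (subst sum.swap) (simp add: mult_ac)
    also have "\<dots> = (\<Sum>b<d. (P * Q) $$ (a, b) * u b)"
      using P Q a by (intro sum.cong) (auto simp: scalar_prod_def atLeast0LessThan)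
    also have "\<dots> = (\<Sum>b<d. if b = a then u a else 0)"
      unfolding PQ using a by (intro sum.cong) auto
    finally show ?thesis using a by simp
  qed
  have "rank1_update d P c u = P * ?S"
  proof (rule eq_matI)
    fix a b assume "a < dim_row (P * ?S)" "b < dim_col (P * ?S)"
    then have ab: "a < d" "b < d" using P by auto
    have "(P * ?S) $$ (a, b) = (\<Sum>e<d. P $$ (a, e) * (1\<^sub>m d $$ (e, b) + c * (z e * u b)))"
      using P ab by (auto simp: scalar_prod_def atLeast0LessThan)
    also have "\<dots> = (\<Sum>e<d. if e = b then P $$ (a, b) else 0) + c * u b * (\<Sum>e<d. P $$ (a, e) * z e)"
      unfolding sum_distrib_left sum.distrib[symmetric] using ab
      by (intro sum.cong) (auto simp: algebra_simps)
    also have "\<dots> = rank1_update d P c u $$ (a, b)" using ab unfolding Pz[OF ab(1)] by simp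
    finally show "rank1_update d P c u $$ (a, b) = (P * ?S) $$ (a, b)" by simp
  qed (use P in auto)
  then have "det (rank1_update d P c u) = det P * det ?S"
    by (simp add: det_mult[OF P])
  then show ?thesis unfolding det_one_plus_rank1 z_def .
qed

text \<open>Symmetry of \<open>Q\<close> makes u^T Q the transpose of z = Q u, so one matrix-vector
  product determines the new inverse.\<close>

lemma sherman_morrison:
  assumes P: "P \<in> carrier_mat d d" and Q: "Q \<in> carrier_mat d d" and PQ: "P * Q = 1\<^sub>m d"
    and sym: "\<And>a b. a < d \<Longrightarrow> b < d \<Longrightarrow> Q $$ (a, b) = Q $$ (b, a)"
    and z: "\<And>a. a < d \<Longrightarrow> z a = (\<Sum>b<d. Q $$ (a, b) * u b)"
    and g: "g = 1 + c * (\<Sum>a<d. u a * z a)" and g0: "g \<noteq> 0"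
  shows "rank1_update d P c u * rank1_update d Q (- c / g) z = 1\<^sub>m d"
proof (rule eq_matI)
  fix a b assume "a < dim_row (1\<^sub>m d :: real mat)" "b < dim_col (1\<^sub>m d :: real mat)"
  then have ab: "a < d" "b < d" by auto
  have PQ': "(\<Sum>e<d. P $$ (a, e) * Q $$ (e, b)) = 1\<^sub>m d $$ (a, b)" if "a < d" "b < d" for a b
    using P Q that unfolding PQ[symmetric] by (auto simp: scalar_prod_def atLeast0LessThan)
  have Pz: "(\<Sum>e<d. P $$ (a, e) * z e) = u a"
  proof -
    have "(\<Sum>e<d. P $$ (a, e) * z e) = (\<Sum>e<d. \<Sum>b<d. P $$ (a, e) * Q $$ (e, b) * u b)"
      by (auto simp: z sum_distrib_left mult_ac intro!: sum.cong)
    also have "\<dots> = (\<Sum>b<d. (\<Sum>e<d. P $$ (a, e) * Q $$ (e, b)) * u b)"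
      unfolding sum_distrib_right by (rule sum.swap)
    also have "\<dots> = (\<Sum>b<d. if b = a then u a else 0)"
      using ab by (intro sum.cong) (auto simp: PQ')
    finally show ?thesis using ab by simp
  qed
  have uQ: "(\<Sum>e<d. u e * Q $$ (e, b)) = z b"
    using ab by (auto simp: z sym[of _ b] mult_ac intro!: sum.cong)
  have "(rank1_update d P c u * rank1_update d Q (- c / g) z) $$ (a, b)
     = (\<Sum>e<d. (P $$ (a, e) + c * (u a * u e)) * (Q $$ (e, b) + (- c / g) * (z e * z b)))"
    using ab by (simp add: scalar_prod_def atLeast0LessThan)
  also have "\<dots> = (\<Sum>e<d. P $$ (a, e) * Q $$ (e, b)) + c * u a * (\<Sum>e<d. u e * Q $$ (e, b))
      + (- c / g) * z b * (\<Sum>e<d. P $$ (a, e) * z e) + (- c / g) * z b * u a * (c * (\<Sum>e<d. u e * z e))"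
    unfolding sum_distrib_left sum.distrib[symmetric] by (intro sum.cong) (auto simp: algebra_simps)
  \<comment> \<open>The two terms with the factor - c / g add up to a multiple of 1 + c u^T z =
    g.\<close>
  also have "\<dots> = 1\<^sub>m d $$ (a, b) + (c * u a * z b + (- c / g) * z b * u a * g)"
    unfolding PQ'[OF ab] uQ Pz by (subst (2) g) (simp only: distrib_left mult_1_right add.assoc)
  also have "\<dots> = 1\<^sub>m d $$ (a, b)" using g0 by simp
  finally show "(rank1_update d P c u * rank1_update d Q (- c / g) z) $$ (a, b) = 1\<^sub>m d $$ (a, b)" .
qed auto

definition pos_def :: "nat \<Rightarrow> real mat \<Rightarrow> bool" where
  "pos_def d P \<longleftrightarrow> P \<in> carrier_mat d d \<and>
     (\<forall>w. (\<exists>a<d. w a \<noteq> 0) \<longrightarrow> 0 < (\<Sum>a<d. \<Sum>b<d. w a * P $$ (a, b) * w b))"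

lemma pos_def_det_nonzero:
  assumes "pos_def d P" shows "det P \<noteq> 0"
proof
  have P: "P \<in> carrier_mat d d" using assms by (simp add: pos_def_def)
  assume "det P = 0"
  then obtain w where w: "w \<in> carrier_vec d" "w \<noteq> 0\<^sub>v d" "P *\<^sub>v w = 0\<^sub>v d"
    using det_0_iff_vec_prod_zero_field[OF P] by auto
  have Pw: "(\<Sum>b<d. P $$ (a, b) * w $ b) = 0" if "a < d" for a
    using arg_cong[OF w(3), of "\<lambda>x. x $ a"] that P w(1)
    by (simp add: scalar_prod_def atLeast0LessThan)
  have "\<exists>a<d. w $ a \<noteq> 0" using w(1,2) by auto
  then have "0 < (\<Sum>a<d. \<Sum>b<d. w $ a * P $$ (a, b) * w $ b)"
    using assms by (auto simp: pos_def_def)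
  also have "\<dots> = (\<Sum>a<d. w $ a * (\<Sum>b<d. P $$ (a, b) * w $ b))"
    by (simp add: sum_distrib_left mult_ac)
  finally show False by (simp add: Pw)
qed

lemma rank1_update_quadratic_form:
  "(\<Sum>a<d. \<Sum>b<d. w a * rank1_update d P c u $$ (a, b) * w b)
     = (\<Sum>a<d. \<Sum>b<d. w a * P $$ (a, b) * w b) + c * (\<Sum>a<d. w a * u a)\<^sup>2"
proof -
  have "(\<Sum>a<d. \<Sum>b<d. w a * rank1_update d P c u $$ (a, b) * w b)
      = (\<Sum>a<d. \<Sum>b<d. w a * P $$ (a, b) * w b + c * ((w a * u a) * (w b * u b)))"
    by (intro sum.cong refl) (auto simp: distrib_left distrib_right)
  also have "\<dots> = (\<Sum>a<d. \<Sum>b<d. w a * P $$ (a, b) * w b) + c * (\<Sum>a<d. \<Sum>b<d. (w a * u a) * (w b * u b))"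
    by (simp only: sum.distrib sum_distrib_left)
  finally show ?thesis
    by (simp only: power2_eq_square sum_product)
qed

lemma pos_def_rank1_update:
  assumes "pos_def d P" "0 \<le> c"
  shows "pos_def d (rank1_update d P c u)"
  unfolding pos_def_def rank1_update_quadratic_form
proof (intro conjI allI impI add_pos_nonneg)
  fix w :: "nat \<Rightarrow> real" assume "\<exists>a<d. w a \<noteq> 0"
  then show "0 < (\<Sum>a<d. \<Sum>b<d. w a * P $$ (a, b) * w b)"
    using assms(1) by (simp add: pos_def_def)
qed (use assms(2) in auto)

text \<open>The determinant is affine along \<open>c \<mapsto> P + c u u\<^sup>T\<close> and has no zero for \<open>c \<ge> 0\<close>.\<close>

lemma det_rank1_update_mono:
  assumes "pos_def d P" "0 < det P" "0 \<le> c"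
  shows "det P \<le> det (rank1_update d P c u)"
proof -
  have P: "P \<in> carrier_mat d d" using assms by (simp add: pos_def_def)
  obtain K where K: "\<And>c. det (rank1_update d P c u) = det P + c * K"
    using det_rank1_update_affine[OF P] by blast
  have "0 \<le> K"
  proof (rule ccontr)
    assume "\<not> 0 \<le> K"
    then have "det (rank1_update d P (- det P / K) u) = 0" and "0 \<le> - det P / K"
      using assms(2) by (simp_all add: K divide_nonneg_neg)
    then show False using pos_def_det_nonzero pos_def_rank1_update[OF assms(1)] by blast
  qed
  then show ?thesis using assms(3) by (simp add: K)
qed

section \<open>Determinants of linear pencils\<close>

definition pencil :: "nat \<Rightarrow> real mat \<Rightarrow> real \<Rightarrow> real mat \<Rightarrow> real mat" where
  "pencil d A y B = mat d d (\<lambda>(a, b). A $$ (a, b) + y * B $$ (a, b))"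

lemma pencil_carrier [simp]: "pencil d A y B \<in> carrier_mat d d"
  by (simp add: pencil_def)

lemma pencil_index [simp]:
  "a < d \<Longrightarrow> b < d \<Longrightarrow> pencil d A y B $$ (a, b) = A $$ (a, b) + y * B $$ (a, b)"
  "dim_row (pencil d A y B) = d" "dim_col (pencil d A y B) = d"
  by (simp_all add: pencil_def)

lemma pencil_rank1_update:
  "pencil d (rank1_update d A c u) y B = rank1_update d (pencil d A y B) c u"
  by (intro eq_matI) auto

lemma rank1_update_commute:
  "rank1_update d (rank1_update d A c u) c' u' = rank1_update d (rank1_update d A c' u') c u"
  by (intro eq_matI) auto

text \<open>Formed over the polynomial ring because \<open>umbral\<close> acts on polynomials, not
  on functions of y.\<close>

definition det_pencil :: "nat \<Rightarrow> real mat \<Rightarrow> real mat \<Rightarrow> real poly" where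
  "det_pencil d A B = det (mat d d (\<lambda>(a, b). [:A $$ (a, b), B $$ (a, b):]))"

lemma poly_det_pencil: "poly (det_pencil d A B) y = det (pencil d A y B)"
proof -
  have sg: "poly (signof p) y = signof p" for p :: "nat \<Rightarrow> nat"
    by (simp add: sign_def)
  show ?thesis
    by (auto simp: det_pencil_def det_def pencil_def poly_sum poly_prod sg permutes_in_image
        intro!: sum.cong prod.cong)
qed

lemma degree_det_pencil: "degree (det_pencil d A B) \<le> d"
proof -
  have "degree (signof p * (\<Prod>i = 0..<d. mat d d (\<lambda>(a, b). [:A $$ (a, b), B $$ (a, b):]) $$ (i, p i))) \<le> d"
    if "p permutes {0..<d}" for p
  proof -
    have "degree (\<Prod>i = 0..<d. mat d d (\<lambda>(a, b). [:A $$ (a, b), B $$ (a, b):]) $$ (i, p i))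
      \<le> sum (degree \<circ> (\<lambda>i. mat d d (\<lambda>(a, b). [:A $$ (a, b), B $$ (a, b):]) $$ (i, p i))) {0..<d}"
      by (rule degree_prod_sum_le) simp
    also have "\<dots> \<le> sum (\<lambda>_. 1) {0..<d}"
      using permutes_in_image[OF that] by (intro sum_mono) (auto simp: degree_pCons_le)
    finally show ?thesis by (auto simp: sign_def)
  qed
  then show ?thesis
    unfolding det_pencil_def det_def by (auto intro!: degree_sum_le finite_permutations)
qed

text \<open>Lets polynomial identities be checked where y is invertible, as
  \<open>mean_adj_trace_start\<close> requires.\<close>

lemma poly_eq_if_eq_pos:
  fixes p q :: "real poly"
  assumes "\<And>y. 0 < y \<Longrightarrow> poly p y = poly q y"
  shows "p = q"
proof (rule ccontr)
  assume "p \<noteq> q"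
  then have "finite {y. poly (p - q) y = 0}" by (intro poly_roots_finite) simp
  moreover have "{0<..} \<subseteq> {y. poly (p - q) y = 0}" using assms by auto
  ultimately show False using infinite_Ioi finite_subset by blast
qed

text \<open>Carries inequalities from the positive definite A + y I to the semidefinite A.\<close>

lemma poly_nonneg_at_0:
  fixes p :: "real poly"
  assumes "\<And>y. 0 < y \<Longrightarrow> 0 \<le> poly p y"
  shows "0 \<le> poly p 0"
proof (rule tendsto_lowerbound[where F = "at_right 0"])
  show "(poly p \<longlongrightarrow> poly p 0) (at_right 0)"
    using poly_isCont[of 0 p] by (simp add: isCont_def filterlim_at_split)
  show "\<forall>\<^sub>F y in at_right 0. 0 \<le> poly p y"
    using assms by (auto simp: eventually_at_filter)
qed simp

section \<open>The falling factorial functional\<close>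

text \<open>\<open>umbral l\<close> sends \<open>y\<^sup>i\<close> to the falling factorial \<open>l (l - 1) \<dots> (l - i + 1)\<close>.\<close>

primrec umbral :: "nat \<Rightarrow> real poly \<Rightarrow> real" where
  "umbral 0 p = poly p 0"
| "umbral (Suc l) p = umbral l (p + pderiv p)"

lemma umbral_add: "umbral l (p + q) = umbral l p + umbral l q"
proof (induction l arbitrary: p q)
  case (Suc l)
  have "p + q + pderiv (p + q) = (p + pderiv p) + (q + pderiv q)" by (simp add: pderiv_add)
  then show ?case using Suc by simp
qed simp

lemma umbral_smult: "umbral l (smult c p) = c * umbral l p"
proof (induction l arbitrary: p)
  case (Suc l)
  have "smult c p + pderiv (smult c p) = smult c (p + pderiv p)"
    by (simp add: pderiv_smult smult_add_right)
  then show ?case using Suc by simp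
qed simp

lemma umbral_0 [simp]: "umbral l 0 = 0"
  using umbral_smult[of l 0 0] by simp

lemma umbral_sum: "umbral l (\<Sum>i\<in>I. f i) = (\<Sum>i\<in>I. umbral l (f i))"
  by (induction I rule: infinite_finite_induct) (auto simp: umbral_add)

lemma umbral_1: "umbral l 1 = 1"
  by (induction l) auto

text \<open>\<open>umbral l p\<close> is (1 + D)^l p at 0, and (1 + D)^l y = y (1 + D)^l + l (1 +
  D)^(l - 1), where the first term vanishes at 0. For \<open>l = 0\<close> the truncated
  \<open>l - 1\<close> is harmless because of the factor l.\<close>

lemma umbral_pCons_0: "umbral l (pCons 0 p) = real l * umbral (l - 1) p"
proof (induction l arbitrary: p)
  case (Suc l)
  have "pCons 0 p + pderiv (pCons 0 p) = pCons 0 (p + pderiv p) + p"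
    by (simp add: pderiv_pCons)
  then have "umbral (Suc l) (pCons 0 p) = real l * umbral (l - 1) (p + pderiv p) + umbral l p"
    using Suc by (simp add: umbral_add)
  also have "real l * umbral (l - 1) (p + pderiv p) = real l * umbral l p"
    by (cases l) auto
  finally show ?case by (simp add: algebra_simps)
qed simp

lemma umbral_linear_factor:
  "umbral l ([:- c, 1:] * p) = real l * umbral (l - 1) p - c * umbral l p"
proof -
  have "[:- c, 1:] * p = pCons 0 p + smult (- c) p" by simp
  then show ?thesis by (simp only: umbral_add umbral_smult umbral_pCons_0)
qed

text \<open>\<open>umbral_pCons_0\<close> splits off the first factor k of the falling factorial,
  this lemma the last one, k - e. That factor becomes k - d + 1 in the final ratio.\<close>

lemma umbral_monom_Suc:
  "e \<le> k \<Longrightarrow> umbral k (monom 1 (Suc e)) = (real k - real e) * umbral k (monom 1 e)"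
proof (induction e arbitrary: k)
  case 0
  then show ?case by (simp add: monom_Suc umbral_pCons_0 umbral_1 monom_0 flip: one_pCons)
next
  case (Suc e)
  have "umbral k (monom 1 (Suc (Suc e))) = real k * umbral (k - 1) (monom 1 (Suc e))"
    by (subst monom_Suc) (rule umbral_pCons_0)
  also have "\<dots> = real k * ((real (k - 1) - real e) * umbral (k - 1) (monom 1 e))"
    using Suc by simp
  also have "real k * umbral (k - 1) (monom 1 e) = umbral k (monom 1 (Suc e))"
    by (simp add: monom_Suc umbral_pCons_0)
  then have "real k * ((real (k - 1) - real e) * umbral (k - 1) (monom 1 e))
      = (real (k - 1) - real e) * umbral k (monom 1 (Suc e))" by simp
  finally show ?case using Suc.prems by (simp add: of_nat_diff)
qed

text \<open>With \<open>e = d\<close> this is where \<open>d \<le> k\<close> makes the initial mean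
  determinant positive.\<close>

lemma umbral_monom_pos: "e \<le> k \<Longrightarrow> 0 < umbral k (monom 1 e)"
proof (induction e)
  case 0
  then show ?case by (simp add: monom_0 umbral_1 flip: one_pCons)
next
  case (Suc e)
  then show ?case by (simp add: umbral_monom_Suc)
qed

text \<open>The Lagrange basis for the nodes 1, ..., n. Node 0 is avoided: there the pencil is A
  itself, which may be singular. The product form lets a node be appended by one linear
  factor.\<close>

definition lagrange :: "nat \<Rightarrow> nat \<Rightarrow> real poly" where
  "lagrange n j = (\<Prod>i\<in>{..<n} - {j}. smult (1 / (real j - real i)) [:- (real i + 1), 1:])"

lemma lagrange_Suc:
  "lagrange (Suc n) j = (if n = j then lagrange n j
     else smult (1 / (real j - real n)) ([:- (real n + 1), 1:] * lagrange n j))"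
proof -
  have "{..<Suc n} - {j} = (if n = j then {..<n} - {j} else insert n ({..<n} - {j}))" by auto
  then show ?thesis unfolding lagrange_def
    by (cases "n = j") (simp_all only: if_True if_False mult_smult_left prod.insert finite_Diff
        finite_lessThan Diff_iff lessThan_iff less_irrefl simp_thms)
qed

lemma poly_lagrange:
  assumes "i < n" "j < n"
  shows "poly (lagrange n j) (real i + 1) = (if i = j then 1 else 0)"
proof (cases "i = j")
  case True
  have "poly (smult (1 / (real j - real a)) [:- (real a + 1), 1:]) (real j + 1) = 1" if "a \<noteq> j" for a
    using that by simp (simp add: divide_simps)
  then show ?thesis using True by (simp only: lagrange_def poly_prod) simp
next
  case False
  have "poly (smult (1 / (real j - real i)) [:- (real i + 1), 1:]) (real i + 1) = 0"
    unfolding poly_smult by simp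
  then show ?thesis using False assms
    unfolding lagrange_def poly_prod by (intro prod_zero[THEN trans]) auto
qed

lemma degree_lagrange: "j \<le> d \<Longrightarrow> degree (lagrange (Suc d) j) \<le> d"
proof -
  assume "j \<le> d"
  have "degree (lagrange (Suc d) j)
    \<le> sum (degree \<circ> (\<lambda>i. smult (1 / (real j - real i)) [:- (real i + 1), 1:])) ({..<Suc d} - {j})"
    unfolding lagrange_def by (rule degree_prod_sum_le) simp
  also have "\<dots> \<le> sum (\<lambda>_. 1) ({..<Suc d} - {j})"
    by (intro sum_mono) (auto simp: degree_smult_le)
  also have "\<dots> = d" using \<open>j \<le> d\<close> by simp
  finally show ?thesis .
qed

lemma lagrange_interpolation:
  assumes "degree p \<le> d"
  shows "p = (\<Sum>j<Suc d. smult (poly p (real j + 1)) (lagrange (Suc d) j))"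
proof (rule poly_eqI_degree[where A = "(\<lambda>i. real i + 1) ` {..<Suc d}"])
  have card: "card ((\<lambda>i. real i + 1) ` {..<Suc d}) = Suc d"
    by (subst card_image) (auto simp: inj_on_def)
  then show "degree p < card ((\<lambda>i. real i + 1) ` {..<Suc d})" using assms by simp
  have "degree (\<Sum>j<Suc d. smult (poly p (real j + 1)) (lagrange (Suc d) j)) \<le> d"
    by (intro degree_sum_le) (auto intro!: order.trans[OF degree_smult_le] degree_lagrange)
  then show "degree (\<Sum>j<Suc d. smult (poly p (real j + 1)) (lagrange (Suc d) j))
      < card ((\<lambda>i. real i + 1) ` {..<Suc d})" using card by simp
  fix x assume "x \<in> (\<lambda>i. real i + 1) ` {..<Suc d}"
  then obtain i where i: "i < Suc d" "x = real i + 1" by auto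
  have "poly (\<Sum>j<Suc d. smult (poly p (real j + 1)) (lagrange (Suc d) j)) x
      = (\<Sum>j<Suc d. if j = i then poly p x else 0)"
    unfolding poly_sum using i by (intro sum.cong) (auto simp: poly_lagrange)
  then show "poly p x = poly (\<Sum>j<Suc d. smult (poly p (real j + 1)) (lagrange (Suc d) j)) x"
    using i by (simp del: sum.lessThan_Suc)
qed

text \<open>The weights do not depend on \<open>p\<close>, so the program can tabulate them once for
  all candidates and steps.\<close>

lemma umbral_interpolation:
  assumes "degree p \<le> d"
  shows "umbral l p = (\<Sum>j<Suc d. umbral l (lagrange (Suc d) j) * poly p (real j + 1))"
proof -
  have "umbral l p = umbral l (\<Sum>j<Suc d. smult (poly p (real j + 1)) (lagrange (Suc d) j))"
    using lagrange_interpolation[OF assms] by (rule arg_cong)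
  also have "\<dots> = (\<Sum>j<Suc d. umbral l (lagrange (Suc d) j) * poly p (real j + 1))"
    unfolding umbral_sum umbral_smult by (intro sum.cong refl mult.commute)
  finally show ?thesis .
qed

section \<open>Mean determinants\<close>

lemma fractional_matrix_carrier [simp]: "fractional_matrix d m v x \<in> carrier_mat d d"
  by (simp add: fractional_matrix_def)

lemma fractional_matrix_index [simp]:
  "a < d \<Longrightarrow> b < d \<Longrightarrow> fractional_matrix d m v x $$ (a, b) = (\<Sum>i<m. x i * (v i $ a * v i $ b))"
  "dim_row (fractional_matrix d m v x) = d" "dim_col (fractional_matrix d m v x) = d"
  by (simp_all add: fractional_matrix_def)

text \<open>Jacobi's formula with differences of determinants in place of the adjugate, valid for
  singular \<open>P\<close>. The induction peels off one vector at a time and runs over all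
  \<open>P\<close>, since both \<open>P\<close> and its update by that vector occur.\<close>

lemma det_pencil_derivative_0:
  assumes "P \<in> carrier_mat d d"
  shows "((\<lambda>h. det (pencil d P h (fractional_matrix d m v p))) has_real_derivative
     (\<Sum>i<m. p i * (det (rank1_update d P 1 (($) (v i))) - det P))) (at 0)"
  using assms
proof (induction m arbitrary: P)
  case 0
  have "pencil d P h (fractional_matrix d 0 v p) = P" for h
    using 0 by (intro eq_matI) auto
  then show ?case by simp
next
  case (Suc m)
  let ?F = "fractional_matrix d m v p" and ?u = "($) (v m)"
  \<comment> \<open>The last vector enters as a rank-one update with coefficient h p_m, in which the
    determinant is affine.\<close>
  have eq: "det (pencil d P h (fractional_matrix d (Suc m) v p))
     = det (pencil d P h ?F) + h * p m * (det (pencil d (rank1_update d P 1 ?u) h ?F) - det (pencil d P h ?F))" for h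
  proof -
    have "pencil d P h (fractional_matrix d (Suc m) v p) = rank1_update d (pencil d P h ?F) (h * p m) ?u"
      by (intro eq_matI) (auto simp: algebra_simps)
    then show ?thesis by (simp add: det_rank1_update_eq[of _ d "h * p m"] pencil_rank1_update)
  qed
  have z: "pencil d R 0 ?F = R" if "R \<in> carrier_mat d d" for R
    using that by (intro eq_matI) auto
  show ?case unfolding eq
    by (rule derivative_eq_intros Suc.IH[OF Suc.prems] Suc.IH[OF rank1_update_carrier] refl)+
      (simp add: z Suc.prems)
qed

text \<open>Taking A + y B as the base matrix moves the derivative at y to one at 0.\<close>

lemma pderiv_det_pencil:
  fixes d m :: nat and v :: "nat \<Rightarrow> real vec" and p :: "nat \<Rightarrow> real"
  defines "B \<equiv> fractional_matrix d m v p"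
  shows "poly (pderiv (det_pencil d A B)) y
    = (\<Sum>i<m. p i * (det (rank1_update d (pencil d A y B) 1 (($) (v i))) - det (pencil d A y B)))"
proof -
  have "pencil d A (h + y) B = pencil d (pencil d A y B) h B" for h
    by (intro eq_matI) (auto simp: algebra_simps)
  then have "((\<lambda>h. poly (det_pencil d A B) (h + y)) has_real_derivative
    (\<Sum>i<m. p i * (det (rank1_update d (pencil d A y B) 1 (($) (v i))) - det (pencil d A y B)))) (at 0)"
    unfolding poly_det_pencil using det_pencil_derivative_0[of "pencil d A y B" d m v p]
    by (simp add: B_def)
  then have "(poly (det_pencil d A B) has_real_derivative
    (\<Sum>i<m. p i * (det (rank1_update d (pencil d A y B) 1 (($) (v i))) - det (pencil d A y B)))) (at y)"
    using DERIV_shift[of "poly (det_pencil d A B)" _ 0 y] by simp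
  then show ?thesis using poly_DERIV DERIV_unique by blast
qed

text \<open>Because the weights sum to 1, averaging over a draw is the operator 1 + D. This is the
  identity that the recursion of \<open>umbral\<close> is modelled on.\<close>

lemma det_pencil_average:
  fixes d m :: nat and v :: "nat \<Rightarrow> real vec" and p :: "nat \<Rightarrow> real"
  assumes "(\<Sum>i<m. p i) = 1"
  defines "B \<equiv> fractional_matrix d m v p"
  shows "det_pencil d A B + pderiv (det_pencil d A B)
    = (\<Sum>i<m. smult (p i) (det_pencil d (rank1_update d A 1 (($) (v i))) B))"
proof (rule poly_eq_if_eq_pos)
  fix y :: real
  show "poly (det_pencil d A B + pderiv (det_pencil d A B)) y
    = poly (\<Sum>i<m. smult (p i) (det_pencil d (rank1_update d A 1 (($) (v i))) B)) y"
    using assms(1) unfolding B_def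
    by (simp add: poly_sum poly_det_pencil pderiv_det_pencil pencil_rank1_update right_diff_distrib
        sum_subtractf flip: sum_distrib_right)
qed

text \<open>
  If \<open>B\<close> is the second moment of a random vector \<open>V\<close>, then \<open>mean_det d l A B\<close> is the expectation
  of \<open>det (A + \<Sum>\<^sub>j V\<^sub>j V\<^sub>j\<^sup>T)\<close> over \<open>l\<close> independent copies of \<open>V\<close>.  Since
  \<open>tr (adj P) = \<Sum>\<^sub>a (det (P + e\<^sub>a e\<^sub>a\<^sup>T) - det P)\<close>, \<open>mean_adj_trace\<close> is the corresponding expectation
  of the trace of the adjugate.
\<close>

definition mean_det :: "nat \<Rightarrow> nat \<Rightarrow> real mat \<Rightarrow> real mat \<Rightarrow> real" where
  "mean_det d l A B = umbral l (det_pencil d A B)"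

definition unit_fun :: "nat \<Rightarrow> nat \<Rightarrow> real" where
  "unit_fun a = (\<lambda>b. if b = a then 1 else 0)"

definition adj_trace :: "nat \<Rightarrow> real mat \<Rightarrow> real" where
  "adj_trace d P = (\<Sum>a<d. det (rank1_update d P 1 (unit_fun a)) - det P)"

definition mean_adj_trace :: "nat \<Rightarrow> nat \<Rightarrow> real mat \<Rightarrow> real mat \<Rightarrow> real" where
  "mean_adj_trace d l A B = (\<Sum>a<d. mean_det d l (rank1_update d A 1 (unit_fun a)) B - mean_det d l A B)"

lemma mean_det_average:
  assumes "(\<Sum>i<m. p i) = 1"
  shows "(\<Sum>i<m. p i * mean_det d l (rank1_update d A 1 (($) (v i))) (fractional_matrix d m v p))
    = mean_det d (Suc l) A (fractional_matrix d m v p)"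
  using det_pencil_average[OF assms, of d A v]
  by (simp add: mean_det_def umbral_sum umbral_smult)

text \<open>The unit update commutes with the draw, so both determinants in the definition average
  by \<open>mean_det_average\<close>.\<close>

lemma mean_adj_trace_average:
  assumes "(\<Sum>i<m. p i) = 1"
  shows "(\<Sum>i<m. p i * mean_adj_trace d l (rank1_update d A 1 (($) (v i))) (fractional_matrix d m v p))
    = mean_adj_trace d (Suc l) A (fractional_matrix d m v p)"
proof -
  let ?B = "fractional_matrix d m v p"
  have "(\<Sum>i<m. p i * mean_adj_trace d l (rank1_update d A 1 (($) (v i))) ?B)
    = (\<Sum>a<d. \<Sum>i<m. p i * (mean_det d l (rank1_update d (rank1_update d A 1 (($) (v i))) 1 (unit_fun a)) ?B
        - mean_det d l (rank1_update d A 1 (($) (v i))) ?B))"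
    unfolding mean_adj_trace_def sum_distrib_left by (rule sum.swap)
  also have "\<dots> = (\<Sum>a<d. (\<Sum>i<m. p i * mean_det d l (rank1_update d (rank1_update d A 1 (unit_fun a)) 1 (($) (v i))) ?B)
        - (\<Sum>i<m. p i * mean_det d l (rank1_update d A 1 (($) (v i))) ?B))"
    unfolding right_diff_distrib sum_subtractf
    by (subst rank1_update_commute[of d A 1 _ 1 "unit_fun _"]) (rule refl)
  finally show ?thesis unfolding mean_det_average[OF assms] mean_adj_trace_def .
qed

lemma mean_det_0: "A \<in> carrier_mat d d \<Longrightarrow> mean_det d 0 A B = det A"
  by (auto simp: mean_det_def poly_det_pencil intro!: arg_cong[where f = det] eq_matI)

lemma mean_det_interpolation:
  "mean_det d l A B
    = (\<Sum>j<Suc d. umbral l (lagrange (Suc d) j) * det (pencil d A (real j + 1) B))"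
  unfolding mean_det_def poly_det_pencil[symmetric]
  by (rule umbral_interpolation) (rule degree_det_pencil)

text \<open>Since the trace of the adjugate is written through determinants, it is interpolated with
  the same nodes and weights.\<close>

lemma mean_adj_trace_interpolation:
  "mean_adj_trace d l A B
    = (\<Sum>j<Suc d. umbral l (lagrange (Suc d) j) * adj_trace d (pencil d A (real j + 1) B))"
  unfolding mean_adj_trace_def mean_det_interpolation adj_trace_def pencil_rank1_update
    sum_distrib_left right_diff_distrib sum_subtractf
  by (intro arg_cong2[where f = "(-)"] sum.swap)

section \<open>Nonnegativity and monotonicity of the mean values\<close>

lemma fractional_matrix_Suc:
  "fractional_matrix d (Suc m) v x = rank1_update d (fractional_matrix d m v x) (x m) (($) (v m))"
  by (intro eq_matI) auto

text \<open>Adding the vectors one by one to y I preserves both properties. They are proved together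
  because \<open>det_rank1_update_mono\<close> asks for a positive determinant as well.\<close>

lemma pencil_one_pos_def:
  assumes "\<And>i. i < m \<Longrightarrow> 0 \<le> n i" "0 < y"
  shows "pos_def d (pencil d (fractional_matrix d m v n) y (1\<^sub>m d))
    \<and> 0 < det (pencil d (fractional_matrix d m v n) y (1\<^sub>m d))"
  using assms(1)
proof (induction m)
  case 0
  have e: "pencil d (fractional_matrix d 0 v n) y (1\<^sub>m d) = y \<cdot>\<^sub>m 1\<^sub>m d"
    by (intro eq_matI) auto
  have "0 < (\<Sum>a<d. \<Sum>b<d. w a * (y \<cdot>\<^sub>m 1\<^sub>m d) $$ (a, b) * w b)" if "\<exists>a<d. w a \<noteq> 0" for w
  proof -
    have "(\<Sum>a<d. \<Sum>b<d. w a * (y \<cdot>\<^sub>m 1\<^sub>m d) $$ (a, b) * w b) = (\<Sum>a<d. \<Sum>b<d. if b = a then y * (w a)\<^sup>2 else 0)"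
      by (intro sum.cong refl) (auto simp: power2_eq_square)
    also have "\<dots> = (\<Sum>a<d. y * (w a)\<^sup>2)" by simp
    also have "\<dots> > 0"
      using that assms(2) by (auto intro!: sum_pos2)
    finally show ?thesis .
  qed
  then show ?case unfolding e using assms(2) by (auto simp: pos_def_def det_smult)
next
  case (Suc m)
  let ?P = "pencil d (fractional_matrix d m v n) y (1\<^sub>m d)"
  have P: "pos_def d ?P" "0 < det ?P" using Suc by auto
  have e: "pencil d (fractional_matrix d (Suc m) v n) y (1\<^sub>m d) = rank1_update d ?P (n m) (($) (v m))"
    by (simp add: fractional_matrix_Suc pencil_rank1_update)
  show ?case unfolding e
    using pos_def_rank1_update[OF P(1)] det_rank1_update_mono[OF P, of "n m" "($) (v m)"] P(2) Suc.prems[of m]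
    by auto
qed

text \<open>The matrix may be singular, so the inequalities are shown for its sum with y I and then
  y tends to 0.\<close>

lemma det_fractional_matrix_mono:
  assumes "\<And>i. i < m \<Longrightarrow> 0 \<le> n i"
  shows "0 \<le> det (fractional_matrix d m v n)"
    "det (fractional_matrix d m v n) \<le> det (rank1_update d (fractional_matrix d m v n) 1 u)"
proof -
  let ?A = "fractional_matrix d m v n"
  note P = pencil_one_pos_def[of m n _ d v, OF assms]
  have z: "pencil d R 0 (1\<^sub>m d) = R" if "R \<in> carrier_mat d d" for R
    using that by (intro eq_matI) auto
  have "0 \<le> poly (det_pencil d ?A (1\<^sub>m d)) 0"
    using P by (intro poly_nonneg_at_0) (auto simp: poly_det_pencil less_imp_le)
  then show "0 \<le> det ?A" by (simp add: poly_det_pencil z)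
  have "0 \<le> poly (det_pencil d (rank1_update d ?A 1 u) (1\<^sub>m d) - det_pencil d ?A (1\<^sub>m d)) 0"
    using P by (intro poly_nonneg_at_0)
      (auto simp: poly_det_pencil pencil_rank1_update intro!: det_rank1_update_mono)
  then show "det ?A \<le> det (rank1_update d ?A 1 u)" by (simp add: poly_det_pencil z)
qed

lemma fractional_matrix_fun_upd:
  "i < m \<Longrightarrow> rank1_update d (fractional_matrix d m v n) 1 (($) (v i)) = fractional_matrix d m v (n(i := n i + 1))"
proof (intro eq_matI)
  fix a b assume i: "i < m" and "a < dim_row (fractional_matrix d m v (n(i := n i + 1)))"
    "b < dim_col (fractional_matrix d m v (n(i := n i + 1)))"
  then have ab: "a < d" "b < d" by auto
  have "(\<Sum>j<m. (n(i := n i + 1)) j * (v j $ a * v j $ b))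
     = (\<Sum>j<m. n j * (v j $ a * v j $ b) + (if j = i then v i $ a * v i $ b else 0))"
    by (intro sum.cong) (auto simp: algebra_simps)
  then show "rank1_update d (fractional_matrix d m v n) 1 (($) (v i)) $$ (a, b)
      = fractional_matrix d m v (n(i := n i + 1)) $$ (a, b)"
    using ab i by (simp add: sum.distrib)
qed auto

text \<open>With one more draw the mean is an average over designs in which one weight
  \<open>n i\<close> is raised by 1, and averaging preserves both inequalities. The update by
  \<open>u\<close> commutes with the draw, so the induction hypothesis applies to it.\<close>

lemma mean_det_mono:
  fixes d m :: nat and v :: "nat \<Rightarrow> real vec" and p n :: "nat \<Rightarrow> real"
  assumes "\<And>i. i < m \<Longrightarrow> 0 \<le> p i" "(\<Sum>i<m. p i) = 1" "\<And>i. i < m \<Longrightarrow> 0 \<le> n i"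
  defines "B \<equiv> fractional_matrix d m v p"
  shows "0 \<le> mean_det d l (fractional_matrix d m v n) B"
    "mean_det d l (fractional_matrix d m v n) B \<le> mean_det d l (rank1_update d (fractional_matrix d m v n) 1 u) B"
proof -
  have "0 \<le> mean_det d l (fractional_matrix d m v n) B \<and>
    mean_det d l (fractional_matrix d m v n) B \<le> mean_det d l (rank1_update d (fractional_matrix d m v n) 1 u) B"
    using assms(3)
  proof (induction l arbitrary: n)
    case 0
    then show ?case using det_fractional_matrix_mono[of m n d v] by (simp add: mean_det_0)
  next
    case (Suc l)
    have n: "0 \<le> (n(i := n i + 1)) j" if "j < m" for i j using Suc.prems that by (auto simp: add_nonneg_nonneg)
    have IH: "0 \<le> mean_det d l (fractional_matrix d m v (n(i := n i + 1))) B"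
      "mean_det d l (fractional_matrix d m v (n(i := n i + 1))) B
        \<le> mean_det d l (rank1_update d (fractional_matrix d m v (n(i := n i + 1))) 1 u) B" for i
      using Suc.IH[of "n(i := n i + 1)"] n by blast+
    have "mean_det d (Suc l) A B = (\<Sum>i<m. p i * mean_det d l (rank1_update d A 1 (($) (v i))) B)" for A
      using mean_det_average[OF assms(2), of d l A v] by (simp add: B_def)
    moreover have "rank1_update d (rank1_update d (fractional_matrix d m v n) 1 u) 1 (($) (v i))
       = rank1_update d (fractional_matrix d m v (n(i := n i + 1))) 1 u" if "i < m" for i
      using that by (simp add: rank1_update_commute[of d _ 1 u] fractional_matrix_fun_upd)
    ultimately show ?case
      using IH assms(1) by (auto simp: fractional_matrix_fun_upd intro!: sum_nonneg sum_mono mult_left_mono mult_nonneg_nonneg)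
  qed
  then show "0 \<le> mean_det d l (fractional_matrix d m v n) B"
    "mean_det d l (fractional_matrix d m v n) B \<le> mean_det d l (rank1_update d (fractional_matrix d m v n) 1 u) B"
    by auto
qed

lemma mean_adj_trace_nonneg:
  assumes "\<And>i. i < m \<Longrightarrow> 0 \<le> p i" "(\<Sum>i<m. p i) = 1" "\<And>i. i < m \<Longrightarrow> 0 \<le> n i"
  shows "0 \<le> mean_adj_trace d l (fractional_matrix d m v n) (fractional_matrix d m v p)"
  unfolding mean_adj_trace_def using mean_det_mono(2)[of m p n d l v, OF assms] by (auto intro!: sum_nonneg)

text \<open>For a unit vector \<open>det_rank1_update\<close> reads off a diagonal entry of
  \<open>Q\<close>.\<close>

lemma adj_trace_eq:
  assumes "P \<in> carrier_mat d d" "Q \<in> carrier_mat d d" "P * Q = 1\<^sub>m d"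
  shows "adj_trace d P = det P * (\<Sum>a<d. Q $$ (a, a))"
proof -
  have "det (rank1_update d P 1 (unit_fun a)) - det P = det P * Q $$ (a, a)" if "a < d" for a
  proof -
    have "(\<Sum>a'<d. unit_fun a a' * (\<Sum>b<d. Q $$ (a', b) * unit_fun a b)) = Q $$ (a, a)"
      using that by (simp add: unit_fun_def if_distrib if_distribR sum.If_cases cong: if_cong)
    then show ?thesis by (simp add: det_rank1_update[OF assms] algebra_simps)
  qed
  then show ?thesis by (simp add: adj_trace_def sum_distrib_left)
qed

text \<open>The second formula is the Sherman-Morrison trace multiplied by g, so that scoring a
  candidate takes no division.\<close>

lemma adj_trace_rank1_update:
  assumes P: "P \<in> carrier_mat d d" and Q: "Q \<in> carrier_mat d d" and PQ: "P * Q = 1\<^sub>m d"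
    and sym: "\<And>a b. a < d \<Longrightarrow> b < d \<Longrightarrow> Q $$ (a, b) = Q $$ (b, a)"
    and z: "\<And>a. a < d \<Longrightarrow> z a = (\<Sum>b<d. Q $$ (a, b) * u b)"
    and g: "g = 1 + c * (\<Sum>a<d. u a * z a)" and g0: "g \<noteq> 0"
  shows "det (rank1_update d P c u) = det P * g"
    "adj_trace d (rank1_update d P c u) = det P * (g * (\<Sum>a<d. Q $$ (a, a)) - c * (\<Sum>a<d. z a * z a))"
proof -
  show *: "det (rank1_update d P c u) = det P * g"
    by (simp add: det_rank1_update[OF P Q PQ] g z)
  have "(\<Sum>a<d. rank1_update d Q (- c / g) z $$ (a, a)) = (\<Sum>a<d. Q $$ (a, a)) - c / g * (\<Sum>a<d. z a * z a)"
    by (simp add: sum_subtractf sum_distrib_left)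
  then show "adj_trace d (rank1_update d P c u) = det P * (g * (\<Sum>a<d. Q $$ (a, a)) - c * (\<Sum>a<d. z a * z a))"
    using adj_trace_eq[OF _ _ sherman_morrison[OF P Q PQ sym z g g0]] g0
    by (simp add: * right_diff_distrib)
qed

section \<open>The mean values after the last and before the first draw\<close>

lemma mean_adj_trace_0: "A \<in> carrier_mat d d \<Longrightarrow> mean_adj_trace d 0 A B = adj_trace d A"
  by (simp add: mean_adj_trace_def adj_trace_def mean_det_0)

lemma mean_det_start:
  assumes "B \<in> carrier_mat d d"
  shows "mean_det d k (0\<^sub>m d d) B = det B * umbral k (monom 1 d)"
proof -
  have "pencil d (0\<^sub>m d d) y B = y \<cdot>\<^sub>m B" for y
    using assms by (intro eq_matI) auto
  then have "det_pencil d (0\<^sub>m d d) B = smult (det B) (monom 1 d)"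
    using assms by (intro poly_eq_if_eq_pos) (simp add: poly_det_pencil det_smult poly_monom)
  then show ?thesis by (simp add: mean_det_def umbral_smult)
qed

text \<open>Here det (y B + e_a e_a^T) = det B (y^d + R_aa y^(d-1)), so subtracting det (y B) leaves
  the lower monomial.\<close>

lemma mean_adj_trace_start:
  assumes B: "B \<in> carrier_mat d d" and R: "R \<in> carrier_mat d d" and BR: "B * R = 1\<^sub>m d" and d: "1 \<le> d"
  shows "mean_adj_trace d k (0\<^sub>m d d) B = det B * (\<Sum>a<d. R $$ (a, a)) * umbral k (monom 1 (d - 1))"
proof -
  have p: "pencil d (0\<^sub>m d d) y B = y \<cdot>\<^sub>m B" for y
    using assms by (intro eq_matI) auto
  have "det_pencil d (rank1_update d (0\<^sub>m d d) 1 (unit_fun a)) B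
      = smult (det B) (monom 1 d) + smult (det B * R $$ (a, a)) (monom 1 (d - 1))" if a: "a < d" for a
  proof (rule poly_eq_if_eq_pos)
    fix y :: real assume y: "0 < y"
    have inv: "(y \<cdot>\<^sub>m B) * ((1 / y) \<cdot>\<^sub>m R) = 1\<^sub>m d"
    proof -
      have "(y \<cdot>\<^sub>m B) * ((1 / y) \<cdot>\<^sub>m R) = (1 / y) \<cdot>\<^sub>m (y \<cdot>\<^sub>m 1\<^sub>m d)"
        using B R by (simp add: mult_smult_distrib[of _ d d] mult_smult_assoc_mat[of _ d d] BR)
      also have "\<dots> = 1\<^sub>m d" using y by (intro eq_matI) auto
      finally show ?thesis .
    qed
    have "(\<Sum>a'<d. unit_fun a a' * (\<Sum>b<d. ((1 / y) \<cdot>\<^sub>m R) $$ (a', b) * unit_fun a b)) = R $$ (a, a) / y"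
      using a R by (simp add: unit_fun_def if_distrib if_distribR sum.If_cases cong: if_cong)
    then have "det (rank1_update d (y \<cdot>\<^sub>m B) 1 (unit_fun a)) = det (y \<cdot>\<^sub>m B) * (1 + R $$ (a, a) / y)"
      using det_rank1_update[OF _ _ inv] B R by simp
    moreover have "y ^ d = y ^ (d - 1) * y" using d by (cases d) auto
    ultimately show "poly (det_pencil d (rank1_update d (0\<^sub>m d d) 1 (unit_fun a)) B) y
      = poly (smult (det B) (monom 1 d) + smult (det B * R $$ (a, a)) (monom 1 (d - 1))) y"
      using B y by (simp add: poly_det_pencil pencil_rank1_update p det_smult poly_monom distrib_left)
  qed
  then have "mean_det d k (rank1_update d (0\<^sub>m d d) 1 (unit_fun a)) B - mean_det d k (0\<^sub>m d d) B
      = det B * R $$ (a, a) * umbral k (monom 1 (d - 1))" if "a < d" for a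
    using that unfolding mean_det_start[OF B] by (simp add: mean_det_def umbral_add umbral_smult)
  then show ?thesis by (simp add: mean_adj_trace_def sum_distrib_left sum_distrib_right mult_ac)
qed

text \<open>1 / (k - d + 1) is the quotient of the falling factorials of k of lengths d - 1 and
  d.\<close>

lemma mean_ratio_start:
  assumes "B \<in> carrier_mat d d" "R \<in> carrier_mat d d" "B * R = 1\<^sub>m d" "1 \<le> d" "d \<le> k"
  shows "mean_adj_trace d k (0\<^sub>m d d) B
    = (\<Sum>a<d. R $$ (a, a)) / (real k - real d + 1) * mean_det d k (0\<^sub>m d d) B"
proof -
  have "real k - real (d - 1) = real k - real d + 1"
    using assms(4,5) by (simp add: of_nat_diff)
  then have "umbral k (monom 1 d) = (real k - real d + 1) * umbral k (monom 1 (d - 1))"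
    using umbral_monom_Suc[of "d - 1" k] assms(4,5) by simp
  then show ?thesis
    using assms(5) by (simp add: mean_det_start[OF assms(1)] mean_adj_trace_start[OF assms(1-4)])
qed

text \<open>A mediant argument: if every ratio with a positive denominator exceeded \<rho>, so would
  the weighted quotient. Indices with \<open>D i = 0\<close> can only enlarge the numerator, and an
  index with \<open>p i * D i > 0\<close> makes the inequality strict.\<close>

lemma min_ratio_le:
  fixes p N D :: "nat \<Rightarrow> real"
  assumes p: "\<And>i. i < m \<Longrightarrow> 0 \<le> p i" and D: "\<And>i. i < m \<Longrightarrow> 0 \<le> D i" and N: "\<And>i. i < m \<Longrightarrow> 0 \<le> N i"
    and pos: "0 < (\<Sum>i<m. p i * D i)" and le: "(\<Sum>i<m. p i * N i) \<le> \<rho> * (\<Sum>i<m. p i * D i)"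
  obtains i where "i < m" "0 < D i" "N i \<le> \<rho> * D i"
proof -
  have "\<exists>i<m. 0 < D i \<and> N i \<le> \<rho> * D i"
  proof (rule ccontr)
    assume neg: "\<not> (\<exists>i<m. 0 < D i \<and> N i \<le> \<rho> * D i)"
    have ge: "\<rho> * (p i * D i) \<le> p i * N i" if "i < m" for i
    proof (cases "D i = 0")
      case True
      then show ?thesis using that p N by simp
    next
      case False
      then have "\<rho> * D i \<le> N i" using neg that D[of i] by force
      then have "p i * (\<rho> * D i) \<le> p i * N i" using p[OF that] by (rule mult_left_mono)
      then show ?thesis by (simp add: mult.left_commute)
    qed
    obtain i where i: "i < m" "p i * D i \<noteq> 0"
      using pos sum.not_neutral_contains_not_neutral[of "\<lambda>i. p i * D i" "{..<m}"] by auto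
    then have "0 < p i" "0 < D i" using p[of i] D[of i] by (auto simp: less_le)
    then have "\<rho> * (p i * D i) < p i * N i"
      using neg i mult_strict_left_mono[of "\<rho> * D i" "N i" "p i"] by (simp add: mult.left_commute not_le)
    then have "(\<Sum>i<m. \<rho> * (p i * D i)) < (\<Sum>i<m. p i * N i)"
      using ge i by (intro sum_strict_mono_ex1) auto
    then show False using le by (simp add: sum_distrib_left)
  qed
  then show ?thesis using that by blast
qed

section \<open>Trace of the inverse\<close>

lemma det_nonzero_imp_inverse:
  assumes P: "P \<in> carrier_mat d d" and "det P \<noteq> (0 :: real)"
  obtains Q where "mat_inverse P = Some Q" "Q \<in> carrier_mat d d" "P * Q = 1\<^sub>m d"
proof (cases "mat_inverse P")
  case None
  then have "P \<notin> Units (ring_mat TYPE(real) d ())" by (rule mat_inverse(1)[OF P])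
  moreover have "P \<in> Units (ring_mat TYPE(real) d ())" by (rule det_non_zero_imp_unit[OF P assms(2)])
  ultimately show ?thesis by blast
next
  case (Some Q)
  then show ?thesis using mat_inverse(2)[OF P Some] that by blast
qed

lemma mat_inverse_det_nonzero:
  assumes P: "P \<in> carrier_mat d d" and "mat_inverse P = Some Q"
  shows "Q \<in> carrier_mat d d" "P * Q = 1\<^sub>m d" "det P \<noteq> (0 :: real)"
proof -
  show *: "Q \<in> carrier_mat d d" "P * Q = 1\<^sub>m d" using mat_inverse(2)[OF assms] by auto
  show "det P \<noteq> 0" using det_mult[OF P *(1)] *(2) by auto
qed

lemma trace_inverse_eq:
  assumes P: "P \<in> carrier_mat d d" and "det P \<noteq> 0"
  shows "trace_inverse P = ereal (adj_trace d P / det P)"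
proof -
  obtain Q where Q: "mat_inverse P = Some Q" "Q \<in> carrier_mat d d" "P * Q = 1\<^sub>m d"
    using det_nonzero_imp_inverse[OF assms] .
  then show ?thesis using adj_trace_eq[OF P Q(2,3)] assms(2)
    by (simp add: trace_inverse_def mat_trace_def)
qed

lemma trace_inverse_singular:
  assumes P: "P \<in> carrier_mat d d" and "det P = 0"
  shows "trace_inverse P = \<infinity>"
  using mat_inverse_det_nonzero(3)[OF P] assms(2)
  by (cases "mat_inverse P") (auto simp: trace_inverse_def)

section \<open>Positive definite design matrices\<close>

lemma fractional_matrix_quadratic_form:
  "(\<Sum>a<d. \<Sum>b<d. w a * fractional_matrix d m v c $$ (a, b) * w b) = (\<Sum>i<m. c i * (\<Sum>a<d. w a * v i $ a)\<^sup>2)"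
proof (induction m)
  case (Suc m)
  then show ?case unfolding fractional_matrix_Suc rank1_update_quadratic_form by simp
qed simp

lemma fractional_matrix_mult_vec:
  assumes "a < d"
  shows "(\<Sum>b<d. fractional_matrix d m v c $$ (a, b) * w b) = (\<Sum>i<m. c i * v i $ a * (\<Sum>b<d. w b * v i $ b))"
proof -
  have "(\<Sum>b<d. fractional_matrix d m v c $$ (a, b) * w b) = (\<Sum>b<d. \<Sum>i<m. c i * v i $ a * (w b * v i $ b))"
    using assms by (intro sum.cong refl) (auto simp: sum_distrib_left sum_distrib_right mult_ac)
  also have "\<dots> = (\<Sum>i<m. \<Sum>b<d. c i * v i $ a * (w b * v i $ b))" by (rule sum.swap)
  finally show ?thesis by (simp add: sum_distrib_left)
qed

text \<open>F w is the sum of the vectors c_i (w^T v_i) v_i, so \<open>w\<close> lies in the kernel.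
  The factor \<open>c i\<close> in the hypothesis exempts vectors of weight 0.\<close>

lemma det_eq_0_if_orthogonal:
  assumes "a < d" "w a \<noteq> 0" and orth: "\<And>i. i < m \<Longrightarrow> c i * (\<Sum>b<d. w b * v i $ b) = 0"
  shows "det (fractional_matrix d m v c) = 0"
proof -
  let ?w = "vec d w"
  have "?w \<noteq> 0\<^sub>v d"
    using assms(1,2) by (metis index_vec index_zero_vec(1))
  moreover have "fractional_matrix d m v c *\<^sub>v ?w = 0\<^sub>v d"
  proof (rule eq_vecI)
    fix a assume "a < dim_vec (0\<^sub>v d :: real vec)"
    then have a: "a < d" by simp
    have "(fractional_matrix d m v c *\<^sub>v ?w) $ a = (\<Sum>b<d. fractional_matrix d m v c $$ (a, b) * w b)"
      using a by (simp add: scalar_prod_def atLeast0LessThan)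
    also have "\<dots> = (\<Sum>i<m. v i $ a * (c i * (\<Sum>b<d. w b * v i $ b)))"
      unfolding fractional_matrix_mult_vec[OF a] by (intro sum.cong refl) (simp only: mult_ac)
    also have "\<dots> = 0" by (simp add: orth)
    finally show "(fractional_matrix d m v c *\<^sub>v ?w) $ a = 0\<^sub>v d $ a" using a by simp
  qed simp
  ultimately show ?thesis
    using det_0_iff_vec_prod_zero_field[OF fractional_matrix_carrier] vec_carrier[of d w] by blast
qed

text \<open>The support of \<open>c\<close> contains that of \<open>x\<close>. A zero w of the
  quadratic form of \<open>c\<close> therefore satisfies x_i (w^T v_i) = 0 for all i, and X would be
  singular.\<close>

lemma fractional_matrix_pos_def:
  assumes "det (fractional_matrix d m v x) \<noteq> 0"
    and c: "\<And>i. i < m \<Longrightarrow> 0 \<le> c i" "\<And>i. i < m \<Longrightarrow> c i = 0 \<Longrightarrow> x i = 0"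
  shows "pos_def d (fractional_matrix d m v c)"
  unfolding pos_def_def fractional_matrix_quadratic_form
proof (intro conjI allI impI)
  fix w :: "nat \<Rightarrow> real" assume "\<exists>a<d. w a \<noteq> 0"
  then obtain a where a: "a < d" "w a \<noteq> 0" by blast
  have nn: "0 \<le> c i * (\<Sum>a<d. w a * v i $ a)\<^sup>2" if "i < m" for i using c(1)[OF that] by simp
  show "0 < (\<Sum>i<m. c i * (\<Sum>a<d. w a * v i $ a)\<^sup>2)"
  proof (rule ccontr)
    assume "\<not> ?thesis"
    then have "(\<Sum>i<m. c i * (\<Sum>a<d. w a * v i $ a)\<^sup>2) = 0"
      using sum_nonneg[of "{..<m}" "\<lambda>i. c i * (\<Sum>a<d. w a * v i $ a)\<^sup>2"] nn by auto
    then have "\<forall>i<m. c i * (\<Sum>a<d. w a * v i $ a)\<^sup>2 = 0"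
      using nn by (subst (asm) sum_nonneg_eq_0_iff) auto
    then have "x i * (\<Sum>b<d. w b * v i $ b) = 0" if "i < m" for i using c(2) that by fastforce
    then show False using det_eq_0_if_orthogonal[of a d w m x v] a assms(1) by blast
  qed
qed simp

lemma det_fractional_matrix_few_vectors:
  assumes "m < d"
  shows "det (fractional_matrix d m v x) = 0"
proof -
  \<comment> \<open>The vectors padded by zero rows; as m < d, row m is zero, and a kernel vector of
    \<open>M\<close> is orthogonal to every v_i.\<close>
  define M where "M = mat d d (\<lambda>(i, b). if i < m then v i $ b else 0)"
  have M: "M \<in> carrier_mat d d" by (simp add: M_def)
  have "det M = 0" using assms by (subst laplace_expansion_row[OF M assms]) (simp add: M_def)
  then obtain w where w: "w \<in> carrier_vec d" "w \<noteq> 0\<^sub>v d" "M *\<^sub>v w = 0\<^sub>v d"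
    using det_0_iff_vec_prod_zero_field[OF M] by blast
  obtain a where a: "a < d" "w $ a \<noteq> 0" using w(1,2) by (metis carrier_vecD eq_vecI index_zero_vec)
  have "(\<Sum>b<d. w $ b * v i $ b) = 0" if "i < m" for i
    using arg_cong[OF w(3), of "\<lambda>u. u $ i"] that assms w(1)
    by (simp add: M_def scalar_prod_def atLeast0LessThan mult.commute)
  then show ?thesis using det_eq_0_if_orthogonal[of a d "($) w" m x v] a by simp
qed

text \<open>
  Interpolates between \<open>F + I\<close> (\<open>b = 0\<close>) and \<open>F\<close> (\<open>b = d\<close>) through positive definite matrices, so that
  \<open>F\<close> can be inverted by rank-one updates starting from the identity.
\<close>

definition partial_shift :: "nat \<Rightarrow> nat \<Rightarrow> real mat \<Rightarrow> real mat" where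
  "partial_shift d b F = mat d d (\<lambda>(a, a'). F $$ (a, a') + (if a = a' \<and> b \<le> a then 1 else 0))"

lemma partial_shift_carrier [simp]: "partial_shift d b F \<in> carrier_mat d d"
  by (simp add: partial_shift_def)

lemma partial_shift_quadratic_form:
  "(\<Sum>a<d. \<Sum>a'<d. w a * partial_shift d b F $$ (a, a') * w a')
    = (\<Sum>a<d. \<Sum>a'<d. w a * F $$ (a, a') * w a') + (\<Sum>a<d. if b \<le> a then (w a)\<^sup>2 else 0)"
proof -
  have "(\<Sum>a<d. \<Sum>a'<d. w a * partial_shift d b F $$ (a, a') * w a')
    = (\<Sum>a<d. \<Sum>a'<d. w a * F $$ (a, a') * w a' + (if a' = a then if b \<le> a then (w a)\<^sup>2 else 0 else 0))"
    by (intro sum.cong refl) (auto simp: partial_shift_def power2_eq_square algebra_simps)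
  then show ?thesis by (simp add: sum.distrib)
qed

lemma partial_shift_pos_def:
  assumes "F \<in> carrier_mat d d" "pos_def d F"
  shows "pos_def d (partial_shift d b F)"
  unfolding pos_def_def partial_shift_quadratic_form
  using assms by (auto simp: pos_def_def intro!: add_pos_nonneg sum_nonneg)

text \<open>Unlike \<open>partial_shift_pos_def\<close> this covers sums over the first few vectors,
  which may be singular.\<close>

lemma partial_shift_0_pos_def:
  assumes "\<And>i. i < m \<Longrightarrow> 0 \<le> c i"
  shows "pos_def d (partial_shift d 0 (fractional_matrix d m v c))"
  unfolding pos_def_def partial_shift_quadratic_form fractional_matrix_quadratic_form
  using assms by (auto intro!: add_nonneg_pos sum_nonneg sum_pos2)

lemma partial_shift_fractional_matrix_Suc:
  "partial_shift d 0 (fractional_matrix d (Suc i) v c)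
    = rank1_update d (partial_shift d 0 (fractional_matrix d i v c)) (c i) (($) (v i))"
  by (intro eq_matI) (auto simp: partial_shift_def)

lemma partial_shift_Suc:
  "partial_shift d (Suc b) F = rank1_update d (partial_shift d b F) (- 1) (unit_fun b)"
  by (intro eq_matI) (auto simp: partial_shift_def unit_fun_def)

lemma partial_shift_start: "partial_shift d 0 (fractional_matrix d 0 v c) = 1\<^sub>m d"
  by (intro eq_matI) (auto simp: partial_shift_def)

lemma partial_shift_end: "F \<in> carrier_mat d d \<Longrightarrow> partial_shift d d F = F"
  by (intro eq_matI) (auto simp: partial_shift_def)

text \<open>The invariant of the program array \<open>Q\<close> and the scalar \<open>p\<close>;
  hence \<open>q\<close> is a bare function. Symmetry is carried along for
  \<open>sherman_morrison\<close>.\<close>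

definition inverse_pair :: "nat \<Rightarrow> real mat \<Rightarrow> (nat \<Rightarrow> nat \<Rightarrow> real) \<Rightarrow> real \<Rightarrow> bool" where
  "inverse_pair d P q \<delta> \<longleftrightarrow> P \<in> carrier_mat d d \<and> P * mat d d (\<lambda>(a, b). q a b) = 1\<^sub>m d \<and>
     (\<forall>a<d. \<forall>b<d. q a b = q b a) \<and> \<delta> = det P"

lemma inverse_pair_one: "(\<And>a b. a < d \<Longrightarrow> b < d \<Longrightarrow> q a b = (if a = b then 1 else 0)) \<Longrightarrow> inverse_pair d (1\<^sub>m d) q 1"
proof -
  assume q: "\<And>a b. a < d \<Longrightarrow> b < d \<Longrightarrow> q a b = (if a = b then 1 else 0)"
  have "mat d d (\<lambda>(a, b). q a b) = 1\<^sub>m d" by (intro eq_matI) (auto simp: q)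
  then show ?thesis by (auto simp: inverse_pair_def q)
qed

lemma inverse_pair_rank1_update:
  assumes pair: "inverse_pair d P q \<delta>"
    and z: "\<And>a. a < d \<Longrightarrow> z a = (\<Sum>b<d. q a b * u b)"
    and g: "g = 1 + c * (\<Sum>a<d. u a * z a)"
    and nz: "det (rank1_update d P c u) \<noteq> 0"
    and q': "\<And>a b. a < d \<Longrightarrow> b < d \<Longrightarrow> q' a b = q a b + (- c / g) * (z a * z b)"
  shows "inverse_pair d (rank1_update d P c u) q' (\<delta> * g)"
    and "adj_trace d (rank1_update d P c u) = \<delta> * (g * (\<Sum>a<d. q a a) - c * (\<Sum>a<d. z a * z a))"
proof -
  let ?Q = "mat d d (\<lambda>(a, b). q a b)"
  have P: "P \<in> carrier_mat d d" and Q: "?Q \<in> carrier_mat d d" and PQ: "P * ?Q = 1\<^sub>m d" and \<delta>: "\<delta> = det P"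
    and sym: "\<And>a b. a < d \<Longrightarrow> b < d \<Longrightarrow> ?Q $$ (a, b) = ?Q $$ (b, a)"
    using pair by (auto simp: inverse_pair_def)
  have z': "z a = (\<Sum>b<d. ?Q $$ (a, b) * u b)" if "a < d" for a using that z by simp
  have det: "det (rank1_update d P c u) = det P * g"
    by (simp add: det_rank1_update[OF P Q PQ] g z)
  \<comment> \<open>g is the quotient of the new and the old determinant, so the program never
    divides by zero here.\<close>
  then have g0: "g \<noteq> 0" using nz by auto
  have Q': "mat d d (\<lambda>(a, b). q' a b) = rank1_update d ?Q (- c / g) z"
    by (intro eq_matI) (auto simp: q')
  show "inverse_pair d (rank1_update d P c u) q' (\<delta> * g)"
    using sherman_morrison[OF P Q PQ sym z' g g0] pair
    by (auto simp: inverse_pair_def Q' det \<delta> q' mult.commute)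
  show "adj_trace d (rank1_update d P c u) = \<delta> * (g * (\<Sum>a<d. q a a) - c * (\<Sum>a<d. z a * z a))"
    using adj_trace_rank1_update(2)[OF P Q PQ sym z' g g0] by (simp add: \<delta>)
qed

text \<open>\<open>best\<close> is what a selection by cross-multiplied comparison guarantees:
  \<open>b\<close> has a ratio no larger than that of the index found by
  \<open>min_ratio_le\<close>.\<close>

lemma mean_ratio_step:
  fixes d m l :: nat and v :: "nat \<Rightarrow> real vec" and p n :: "nat \<Rightarrow> real"
  defines "B \<equiv> fractional_matrix d m v p" and "A \<equiv> fractional_matrix d m v n"
  defines "D \<equiv> \<lambda>i. mean_det d l (rank1_update d A 1 (($) (v i))) B"
    and "N \<equiv> \<lambda>i. mean_adj_trace d l (rank1_update d A 1 (($) (v i))) B"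
  assumes p: "\<And>i. i < m \<Longrightarrow> 0 \<le> p i" "(\<Sum>i<m. p i) = 1" and n: "\<And>i. i < m \<Longrightarrow> 0 \<le> n i"
    and pos: "0 < mean_det d (Suc l) A B"
    and le: "mean_adj_trace d (Suc l) A B \<le> \<rho> * mean_det d (Suc l) A B"
    and best: "\<And>i. i < m \<Longrightarrow> 0 < D i \<Longrightarrow> 0 < D b \<and> N b * D i \<le> N i * D b"
  shows "0 < D b" "N b \<le> \<rho> * D b"
proof -
  have n': "0 \<le> (n(i := n i + 1)) j" if "j < m" for i j using n[OF that] by auto
  have A': "rank1_update d A 1 (($) (v i)) = fractional_matrix d m v (n(i := n i + 1))" if "i < m" for i
    using that by (simp add: A_def fractional_matrix_fun_upd)
  have "0 \<le> D i" "0 \<le> N i" if "i < m" for i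
    unfolding D_def N_def A'[OF that] B_def
    by (rule mean_det_mono(1)[OF p n'] mean_adj_trace_nonneg[OF p n'], assumption+)+
  moreover have "(\<Sum>i<m. p i * D i) = mean_det d (Suc l) A B" "(\<Sum>i<m. p i * N i) = mean_adj_trace d (Suc l) A B"
    unfolding D_def N_def B_def by (rule mean_det_average[OF p(2)] mean_adj_trace_average[OF p(2)])+
  ultimately obtain i where i: "i < m" "0 < D i" "N i \<le> \<rho> * D i"
    using min_ratio_le[of m p D N \<rho>] p(1) pos le by auto
  then show Db: "0 < D b" using best by blast
  have "N b * D i \<le> N i * D b" using best i by blast
  also have "\<dots> \<le> \<rho> * D i * D b" using i Db by (intro mult_right_mono) auto
  finally have "N b * D i \<le> (\<rho> * D b) * D i" by (simp add: mult_ac)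
  then show "N b \<le> \<rho> * D b" using i(2) by simp
qed

section \<open>Programs with bounded loops\<close>

text \<open>A fragment of \<open>com\<close> in which loops are counted, so that it has a functional
  semantics and a cost bound by recursion on the syntax.\<close>

datatype prog =
    PSkip
  | PN string nexp nexp
  | PR string nexp nexp rexp
  | PSeq prog prog (infixr \<open>;;\<close> 60)
  | PIf bexp prog prog
  | PFor string nexp prog

abbreviation nvar :: "string \<Rightarrow> nexp" where
  "nvar x \<equiv> NGet x (NConst 0)"

abbreviation rvar :: "string \<Rightarrow> rexp" where
  "rvar x \<equiv> RGet x (NConst 0) (NConst 0)"

primrec compile :: "prog \<Rightarrow> com" where
  "compile PSkip = Skip"
| "compile (PN a i e) = NSet a i e"
| "compile (PR a i j e) = RSet a i j e"
| "compile (p ;; q) = Seq (compile p) (compile q)"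
| "compile (PIf b p q) = If b (compile p) (compile q)"
| "compile (PFor x n p) = Seq (NSet x (NConst 0) (NConst 0))
     (While (NLess (nvar x) n) (Seq (compile p) (NSet x (NConst 0) (NAdd (nvar x) (NConst 1)))))"

text \<open>The state in which the loop guard is evaluated after \<open>j\<close> rounds, counter
  included. Loop invariants become inductions on \<open>j\<close>.\<close>

primrec for_loop :: "string \<Rightarrow> (state \<Rightarrow> state) \<Rightarrow> nat \<Rightarrow> state \<Rightarrow> state" where
  "for_loop x f 0 s = nupdate s x 0 0"
| "for_loop x f (Suc j) s = nupdate (f (for_loop x f j s)) x 0 (Suc j)"

text \<open>Keeps the simplifier from unfolding \<open>run\<close> inside loop bodies.\<close>

lemma for_loop_weak_cong [cong]: "n = n' \<Longrightarrow> s = s' \<Longrightarrow> for_loop x f n s = for_loop x f n' s'"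
  by simp

primrec run :: "prog \<Rightarrow> state \<Rightarrow> state" where
  "run PSkip s = s"
| "run (PN a i e) s = nupdate s a (nval i s) (nval e s)"
| "run (PR a i j e) s = rupdate s a (nval i s) (nval j s) (rval e s)"
| "run (p ;; q) s = run q (run p s)"
| "run (PIf b p q) s = (if bval b s then run p s else run q s)"
| "run (PFor x n p) s = for_loop x (run p) (nval n s) s"

primrec nreads :: "nexp \<Rightarrow> string set" where
  "nreads (NConst c) = {}"
| "nreads (NGet a i) = insert a (nreads i)"
| "nreads (NAdd e f) = nreads e \<union> nreads f"
| "nreads (NSub e f) = nreads e \<union> nreads f"

primrec nwrites :: "prog \<Rightarrow> string set" where
  "nwrites PSkip = {}"
| "nwrites (PN a i e) = {a}"
| "nwrites (PR a i j e) = {}"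
| "nwrites (p ;; q) = nwrites p \<union> nwrites q"
| "nwrites (PIf b p q) = nwrites p \<union> nwrites q"
| "nwrites (PFor x n p) = insert x (nwrites p)"

primrec rwrites :: "prog \<Rightarrow> string set" where
  "rwrites PSkip = {}"
| "rwrites (PN a i e) = {}"
| "rwrites (PR a i j e) = {a}"
| "rwrites (p ;; q) = rwrites p \<union> rwrites q"
| "rwrites (PIf b p q) = rwrites p \<union> rwrites q"
| "rwrites (PFor x n p) = rwrites p"

text \<open>\<open>run\<close> evaluates a loop bound once, the compiled loop before every round,
  and the counter is incremented rather than set. The two agree if bounds read only arrays in
  \<open>K\<close>, which are never written, and bodies leave their counter alone.\<close>

primrec fixed_bounds :: "string set \<Rightarrow> prog \<Rightarrow> bool" where
  "fixed_bounds K PSkip = True"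
| "fixed_bounds K (PN a i e) = (a \<notin> K)"
| "fixed_bounds K (PR a i j e) = True"
| "fixed_bounds K (p ;; q) = (fixed_bounds K p \<and> fixed_bounds K q)"
| "fixed_bounds K (PIf b p q) = (fixed_bounds K p \<and> fixed_bounds K q)"
| "fixed_bounds K (PFor x n p) = (nreads n \<subseteq> K \<and> x \<notin> K \<and> x \<notin> nwrites p \<and> fixed_bounds K p)"

text \<open>For a loop, 7 is 3 for resetting the counter plus 4 for the failing test, and 10 is 4
  for a test plus 6 for the increment. Both branches of a conditional are charged.\<close>

primrec time_bound :: "prog \<Rightarrow> state \<Rightarrow> nat" where
  "time_bound PSkip s = 1"
| "time_bound (PN a i e) s = 1 + ncost i + ncost e"
| "time_bound (PR a i j e) s = 1 + ncost i + ncost j + rcost e"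
| "time_bound (p ;; q) s = time_bound p s + time_bound q s"
| "time_bound (PIf b p q) s = 1 + bcost b + time_bound p s + time_bound q s"
| "time_bound (PFor x n p) s = (7 + ncost n) + nval n s * (10 + ncost n + time_bound p s)"

section \<open>Frame rules and the simulation of \<open>run\<close> by compiled programs\<close>

lemma fst_nupdate [simp]: "fst (nupdate s a i y) = (fst s)(a := (fst s a)(i := y))"
  and snd_nupdate [simp]: "snd (nupdate s a i y) = snd s"
  and fst_rupdate [simp]: "fst (rupdate s a i j x) = fst s"
  and snd_rupdate [simp]: "snd (rupdate s a i j x) = (snd s)(a := (snd s a)(i := (snd s a i)(j := x)))"
  by (simp_all add: nupdate_def rupdate_def)

lemma nwrites_for_loop:
  assumes "\<And>s. fst (f s) a = fst s a" "a \<noteq> x"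
  shows "fst (for_loop x f j s) a = fst s a"
  using assms by (induction j) auto

lemma rwrites_for_loop:
  assumes "\<And>s. snd (f s) a = snd s a"
  shows "snd (for_loop x f j s) a = snd s a"
  using assms by (induction j) auto

lemma run_nframe [simp]: "a \<notin> nwrites p \<Longrightarrow> fst (run p s) a = fst s a"
  by (induction p arbitrary: s) (auto simp: nwrites_for_loop)

lemma run_rframe [simp]: "a \<notin> rwrites p \<Longrightarrow> snd (run p s) a = snd s a"
  by (induction p arbitrary: s) (auto simp: rwrites_for_loop)

lemma for_loop_nframe [simp]: "a \<notin> nwrites p \<Longrightarrow> a \<noteq> x \<Longrightarrow> fst (for_loop x (run p) j s) a = fst s a"
  by (simp add: nwrites_for_loop)

lemma for_loop_rframe [simp]: "a \<notin> rwrites p \<Longrightarrow> snd (for_loop x (run p) j s) a = snd s a"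
  by (simp add: rwrites_for_loop)

lemma for_loop_index [simp]: "fst (for_loop x f j s) x 0 = j"
  by (cases j) auto

lemma nval_cong: "(\<And>a. a \<in> nreads e \<Longrightarrow> fst s a = fst s' a) \<Longrightarrow> nval e s = nval e s'"
  by (induction e) auto

lemma fixed_bounds_disjoint: "fixed_bounds K p \<Longrightarrow> a \<in> K \<Longrightarrow> a \<notin> nwrites p"
  by (induction p) auto

text \<open>A derivation of \<open>exec\<close> for a loop grows from its last test backwards, hence
  the induction on the number of remaining rounds.\<close>

lemma exec_while_for_loop:
  assumes body: "\<And>j. j < n \<Longrightarrow> \<exists>t\<le>T. exec c (for_loop x f j s) t (f (for_loop x f j s))"
    and bound: "\<And>j. j \<le> n \<Longrightarrow> nval e (for_loop x f j s) = n"
    and index: "\<And>j. j < n \<Longrightarrow> fst (f (for_loop x f j s)) x 0 = j"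
    and "j \<le> n"
  shows "\<exists>t. exec (While (NLess (nvar x) e) (Seq c (NSet x (NConst 0) (NAdd (nvar x) (NConst 1)))))
      (for_loop x f j s) t (for_loop x f n s) \<and> t \<le> (4 + ncost e) + (n - j) * (10 + ncost e + T)"
  using \<open>j \<le> n\<close>
proof (induction "n - j" arbitrary: j)
  case 0
  then have "j = n" by simp
  then show ?case
    using bound[of n] exec.WhileFalse[of "NLess (nvar x) e" "for_loop x f n s"]
    by (intro exI[of _ "1 + bcost (NLess (nvar x) e)"]) auto
next
  case (Suc l)
  then have j: "j < n" "l = n - Suc j" "Suc j \<le> n" by auto
  obtain t where t: "t \<le> T" "exec c (for_loop x f j s) t (f (for_loop x f j s))"
    using body[OF j(1)] by blast
  obtain t' where t': "exec (While (NLess (nvar x) e) (Seq c (NSet x (NConst 0) (NAdd (nvar x) (NConst 1)))))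
      (for_loop x f (Suc j) s) t' (for_loop x f n s)" "t' \<le> (4 + ncost e) + (n - Suc j) * (10 + ncost e + T)"
    using Suc.hyps(1)[OF j(2,3)] by blast
  have "exec (NSet x (NConst 0) (NAdd (nvar x) (NConst 1))) (f (for_loop x f j s)) 6 (for_loop x f (Suc j) s)"
    using exec.NSet[of x "NConst 0" "NAdd (nvar x) (NConst 1)" "f (for_loop x f j s)"] index[OF j(1)]
    by (simp add: eval_nat_numeral)
  then have "exec (Seq c (NSet x (NConst 0) (NAdd (nvar x) (NConst 1)))) (for_loop x f j s) (t + 6) (for_loop x f (Suc j) s)"
    using t(2) by (intro exec.Seq)
  moreover have "bval (NLess (nvar x) e) (for_loop x f j s)"
    using bound[of j] j by simp
  ultimately have "exec (While (NLess (nvar x) e) (Seq c (NSet x (NConst 0) (NAdd (nvar x) (NConst 1)))))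
      (for_loop x f j s) (1 + bcost (NLess (nvar x) e) + (t + 6) + t') (for_loop x f n s)"
    using t'(1) by (intro exec.WhileTrue)
  moreover have "n - j = Suc (n - Suc j)" using j by simp
  then have "1 + bcost (NLess (nvar x) e) + (t + 6) + t' \<le> (4 + ncost e) + (n - j) * (10 + ncost e + T)"
    using t(1) t'(2) by simp
  ultimately show ?case by blast
qed

text \<open>Subprograms start in modified states \<open>s\<close>, but time is measured at the
  initial state \<open>s\<^sub>0\<close>. Agreement on \<open>K\<close> suffices, since it fixes
  every loop bound.\<close>

theorem exec_compile:
  assumes "fixed_bounds K p" "\<And>a. a \<in> K \<Longrightarrow> fst s a = fst s\<^sub>0 a"
  shows "\<exists>t. exec (compile p) s t (run p s) \<and> t \<le> time_bound p s\<^sub>0"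
  using assms
proof (induction p arbitrary: s)
  case PSkip
  show ?case by (auto intro: exec.Skip)
next
  case (PN a i e)
  show ?case unfolding compile.simps run.simps time_bound.simps using exec.NSet by blast
next
  case (PR a i j e)
  show ?case unfolding compile.simps run.simps time_bound.simps using exec.RSet by blast
next
  case (PSeq p q)
  have "fst (run p s) a = fst s\<^sub>0 a" if "a \<in> K" for a
    using PSeq.prems fixed_bounds_disjoint[of K p] that by simp
  then obtain t t' where "exec (compile p) s t (run p s)" "t \<le> time_bound p s\<^sub>0"
    "exec (compile q) (run p s) t' (run q (run p s))" "t' \<le> time_bound q s\<^sub>0"
    using PSeq.IH(1)[of s] PSeq.IH(2)[of "run p s"] PSeq.prems by auto
  then show ?case by (auto intro!: exI[of _ "t + t'"] exec.Seq)
next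
  case (PIf b p q)
  then obtain t t' where "exec (compile p) s t (run p s)" "t \<le> time_bound p s\<^sub>0"
    "exec (compile q) s t' (run q s)" "t' \<le> time_bound q s\<^sub>0"
    by (metis fixed_bounds.simps(5))
  then show ?case
    using exec.IfTrue[of b s "compile p" t _ "compile q"] exec.IfFalse[of b s "compile q" t' _ "compile p"]
    by (cases "bval b s") fastforce+
next
  case (PFor x e p)
  let ?n = "nval e s" and ?f = "run p"
  have fb: "fixed_bounds K p" and nr: "nreads e \<subseteq> K" and x: "x \<notin> K" "x \<notin> nwrites p"
    using PFor.prems(1) by auto
  have agree: "fst (for_loop x ?f j s) a = fst s\<^sub>0 a" if "a \<in> K" for a j
    using that fixed_bounds_disjoint[OF fb that] x PFor.prems(2) by (subst for_loop_nframe) auto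
  have n0: "?n = nval e s\<^sub>0" using nr PFor.prems(2) by (intro nval_cong) auto
  have "\<exists>t. exec (While (NLess (nvar x) e) (Seq (compile p) (NSet x (NConst 0) (NAdd (nvar x) (NConst 1)))))
      (for_loop x ?f 0 s) t (for_loop x ?f ?n s) \<and> t \<le> (4 + ncost e) + (?n - 0) * (10 + ncost e + time_bound p s\<^sub>0)"
  proof (rule exec_while_for_loop)
    fix j
    show "\<exists>t\<le>time_bound p s\<^sub>0. exec (compile p) (for_loop x ?f j s) t (?f (for_loop x ?f j s))"
      using PFor.IH[OF fb, of "for_loop x ?f j s"] agree by blast
    show "nval e (for_loop x ?f j s) = ?n"
      unfolding n0 using nr agree by (intro nval_cong) auto
    show "fst (?f (for_loop x ?f j s)) x 0 = j" using x by simp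
  qed simp
  then obtain t where t: "exec (While (NLess (nvar x) e) (Seq (compile p) (NSet x (NConst 0) (NAdd (nvar x) (NConst 1)))))
      (nupdate s x 0 0) t (for_loop x ?f ?n s)" "t \<le> (4 + ncost e) + ?n * (10 + ncost e + time_bound p s\<^sub>0)"
    by auto
  have "exec (NSet x (NConst 0) (NConst 0)) s 3 (nupdate s x 0 0)"
    using exec.NSet[of x "NConst 0" "NConst 0" s] by (simp add: eval_nat_numeral)
  from exec.Seq[OF this t(1)] show ?case using t(2) n0
    by (intro exI[of _ "3 + t"]) simp
qed

section \<open>Rules for asymptotic running times\<close>

definition time_O :: "(state \<Rightarrow> bool) \<Rightarrow> prog \<Rightarrow> (state \<Rightarrow> nat) \<Rightarrow> bool" where
  "time_O ok p g \<longleftrightarrow> (\<exists>C. \<forall>s. ok s \<longrightarrow> time_bound p s \<le> C * g s)"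

lemma time_O_I: "(\<And>s. ok s \<Longrightarrow> time_bound p s \<le> C * g s) \<Longrightarrow> time_O ok p g"
  by (auto simp: time_O_def)

lemma le_mult_ge_1: "1 \<le> b \<Longrightarrow> a \<le> a * b" for a b :: nat
  by simp

text \<open>The condition \<open>1 \<le> g s\<close>, here and in the rules below, absorbs additive
  constants.\<close>

lemma time_O_atomic:
  assumes "\<And>s. ok s \<Longrightarrow> 1 \<le> g s"
  shows "time_O ok (PN a i e) g" "time_O ok (PR a i j r) g" "time_O ok PSkip g"
proof -
  have *: "c \<le> c * g s" if "ok s" for c s by (rule le_mult_ge_1[OF assms[OF that]])
  show "time_O ok (PN a i e) g" "time_O ok (PR a i j r) g" "time_O ok PSkip g"
    unfolding time_O_def time_bound.simps using * by blast+
qed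

lemma time_O_Seq: "time_O ok p g \<Longrightarrow> time_O ok q g \<Longrightarrow> time_O ok (p ;; q) g"
  unfolding time_O_def
proof (elim exE)
  fix C C' assume "\<forall>s. ok s \<longrightarrow> time_bound p s \<le> C * g s" "\<forall>s. ok s \<longrightarrow> time_bound q s \<le> C' * g s"
  then show "\<exists>C. \<forall>s. ok s \<longrightarrow> time_bound (p ;; q) s \<le> C * g s"
    by (intro exI[of _ "C + C'"]) (auto simp: distrib_right add_mono)
qed

lemma time_O_If:
  assumes "time_O ok p g" "time_O ok q g" "\<And>s. ok s \<Longrightarrow> 1 \<le> g s"
  shows "time_O ok (PIf b p q) g"
proof -
  obtain C C' where "\<And>s. ok s \<Longrightarrow> time_bound p s \<le> C * g s" "\<And>s. ok s \<Longrightarrow> time_bound q s \<le> C' * g s"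
    using assms unfolding time_O_def by auto
  then have "time_bound (PIf b p q) s \<le> (1 + bcost b + C + C') * g s" if "ok s" for s
  proof -
    have "1 + bcost b \<le> (1 + bcost b) * g s" by (rule le_mult_ge_1[OF assms(3)[OF that]])
    then show ?thesis using \<open>\<And>s. ok s \<Longrightarrow> time_bound p s \<le> C * g s\<close>[OF that]
      \<open>\<And>s. ok s \<Longrightarrow> time_bound q s \<le> C' * g s\<close>[OF that] by (simp add: distrib_right)
  qed
  then show ?thesis by (rule time_O_I)
qed

lemma time_O_For:
  assumes "time_O ok p g" "\<And>s. ok s \<Longrightarrow> 1 \<le> g s" "\<And>s. ok s \<Longrightarrow> 1 \<le> nval n s"
  shows "time_O ok (PFor x n p) (\<lambda>s. nval n s * g s)"
proof -
  obtain C where C: "\<And>s. ok s \<Longrightarrow> time_bound p s \<le> C * g s"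
    using assms unfolding time_O_def by auto
  have "time_bound (PFor x n p) s \<le> (17 + 2 * ncost n + C) * (nval n s * g s)" if s: "ok s" for s
  proof -
    have "1 \<le> nval n s * g s" using assms(2,3)[OF s] by simp
    then have "7 + ncost n \<le> (7 + ncost n) * (nval n s * g s)"
      by (rule le_mult_ge_1)
    moreover have "10 + ncost n \<le> (10 + ncost n) * g s"
      by (rule le_mult_ge_1[OF assms(2)[OF s]])
    then have "nval n s * (10 + ncost n + time_bound p s) \<le> nval n s * ((10 + ncost n) * g s + C * g s)"
      using C[OF s] by (intro mult_left_mono add_mono) auto
    ultimately show ?thesis by (simp add: algebra_simps)
  qed
  then show ?thesis by (rule time_O_I)
qed

lemma time_O_mono:
  assumes "time_O ok p g" "\<And>s. ok s \<Longrightarrow> g s \<le> c * h s"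
  shows "time_O ok p h"
proof -
  obtain C where "\<And>s. ok s \<Longrightarrow> time_bound p s \<le> C * g s"
    using assms unfolding time_O_def by auto
  then have "time_bound p s \<le> (C * c) * h s" if "ok s" for s
    using that assms(2)[OF that] by (metis mult.assoc mult_le_mono2 order_trans)
  then show ?thesis by (rule time_O_I)
qed

section \<open>The rounding program\<close>

text \<open>\<open>NConst 1\<close> must not become \<open>NConst (Suc 0)\<close>, or loop bodies no longer match syntactically.\<close>

declare One_nat_def [simp del]

text \<open>
  For the current step \<open>r\<close> and interpolation point \<open>j\<close>, the array \<open>Q\<close> and the scalar \<open>p\<close> hold the inverse and
  the determinant of \<open>\<Sum>\<^sub>i (n\<^sub>i + (j + 1) x\<^sub>i / k) v\<^sub>i v\<^sub>i\<^sup>T\<close>, where \<open>n\<close> counts how often each vector has been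
  chosen; \<open>D\<close> and \<open>N\<close> accumulate the mean determinant and the mean adjugate trace after choosing
  each candidate; \<open>W\<close> holds the interpolation weights for every number of remaining steps.
\<close>

definition load_vec :: prog where
  "load_vec = PFor ''a'' (nvar ''d'')
     (PR ''u'' (NConst 0) (nvar ''a'') (RGet ''v'' (nvar ''i'') (nvar ''a'')))"

definition load_unit :: prog where
  "load_unit = PFor ''a'' (nvar ''d'') (PR ''u'' (NConst 0) (nvar ''a'') (RNat (NConst 0))) ;;
     PR ''u'' (NConst 0) (nvar ''i'') (RNat (NConst 1))"

definition mat_vec :: prog where
  "mat_vec = PFor ''a'' (nvar ''d'')
     (PR ''z'' (NConst 0) (nvar ''a'') (RNat (NConst 0)) ;;
      PFor ''b'' (nvar ''d'')
        (PR ''z'' (NConst 0) (nvar ''a'')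
          (RAdd (RGet ''z'' (NConst 0) (nvar ''a''))
            (RMul (RGet ''Q'' (nvar ''a'') (nvar ''b'')) (RGet ''u'' (NConst 0) (nvar ''b''))))))"

definition update_inverse :: prog where
  "update_inverse =
     PR ''g'' (NConst 0) (NConst 0) (RNat (NConst 1)) ;;
     PFor ''a'' (nvar ''d'')
       (PR ''g'' (NConst 0) (NConst 0) (RAdd (rvar ''g'') (RMul (rvar ''c'')
         (RMul (RGet ''u'' (NConst 0) (nvar ''a'')) (RGet ''z'' (NConst 0) (nvar ''a'')))))) ;;
     PFor ''a'' (nvar ''d'') (PFor ''b'' (nvar ''d'')
       (PR ''Q'' (nvar ''a'') (nvar ''b'') (RAdd (RGet ''Q'' (nvar ''a'') (nvar ''b''))
         (RMul (RDiv (RSub (RNat (NConst 0)) (rvar ''c'')) (rvar ''g''))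
           (RMul (RGet ''z'' (NConst 0) (nvar ''a'')) (RGet ''z'' (NConst 0) (nvar ''b''))))))) ;;
     PR ''p'' (NConst 0) (NConst 0) (RMul (rvar ''p'') (rvar ''g''))"

definition init_inverse :: prog where
  "init_inverse =
     PFor ''a'' (nvar ''d'')
       (PFor ''b'' (nvar ''d'') (PR ''Q'' (nvar ''a'') (nvar ''b'') (RNat (NConst 0))) ;;
        PR ''Q'' (nvar ''a'') (nvar ''a'') (RNat (NConst 1))) ;;
     PR ''p'' (NConst 0) (NConst 0) (RNat (NConst 1))"

definition add_design :: prog where
  "add_design = PFor ''i'' (nvar ''m'')
     (load_vec ;;
      PR ''c'' (NConst 0) (NConst 0)
        (RAdd (RNat (NGet ''n'' (nvar ''i'')))
          (RMul (RNat (NAdd (nvar ''j'') (NConst 1)))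
            (RDiv (RGet ''x'' (nvar ''i'') (NConst 0)) (RNat (nvar ''k''))))) ;;
      mat_vec ;; update_inverse)"

definition remove_units :: prog where
  "remove_units = PFor ''i'' (nvar ''d'')
     (load_unit ;;
      PR ''c'' (NConst 0) (NConst 0) (RSub (RNat (NConst 0)) (RNat (NConst 1))) ;;
      mat_vec ;; update_inverse)"

definition inner_products :: prog where
  "inner_products =
     PR ''g'' (NConst 0) (NConst 0) (RNat (NConst 1)) ;;
     PR ''h'' (NConst 0) (NConst 0) (RNat (NConst 0)) ;;
     PFor ''a'' (nvar ''d'')
       (PR ''g'' (NConst 0) (NConst 0) (RAdd (rvar ''g'')
          (RMul (RGet ''u'' (NConst 0) (nvar ''a'')) (RGet ''z'' (NConst 0) (nvar ''a'')))) ;;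
        PR ''h'' (NConst 0) (NConst 0) (RAdd (rvar ''h'')
          (RMul (RGet ''z'' (NConst 0) (nvar ''a'')) (RGet ''z'' (NConst 0) (nvar ''a'')))))"

text \<open>The column of \<open>W\<close> is the number of draws left after the choice of step
  \<open>r\<close>. The determinant \<open>p\<close> is folded into the weight because every score
  carries it as a factor.\<close>

definition trace_and_weight :: prog where
  "trace_and_weight =
     PR ''T'' (NConst 0) (NConst 0) (RNat (NConst 0)) ;;
     PFor ''a'' (nvar ''d'')
       (PR ''T'' (NConst 0) (NConst 0) (RAdd (rvar ''T'') (RGet ''Q'' (nvar ''a'') (nvar ''a'')))) ;;
     PR ''w'' (NConst 0) (NConst 0)
       (RMul (RGet ''W'' (nvar ''j'') (NSub (NSub (nvar ''k'') (NConst 1)) (nvar ''r''))) (rvar ''p''))"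

definition add_scores :: prog where
  "add_scores = PFor ''i'' (nvar ''m'')
     (load_vec ;; mat_vec ;; inner_products ;;
      PR ''D'' (NConst 0) (nvar ''i'')
        (RAdd (RGet ''D'' (NConst 0) (nvar ''i'')) (RMul (rvar ''w'') (rvar ''g''))) ;;
      PR ''N'' (NConst 0) (nvar ''i'')
        (RAdd (RGet ''N'' (NConst 0) (nvar ''i''))
          (RMul (rvar ''w'') (RSub (RMul (rvar ''g'') (rvar ''T'')) (rvar ''h'')))))"

definition clear_scores :: prog where
  "clear_scores = PFor ''i'' (nvar ''m'')
     (PR ''D'' (NConst 0) (nvar ''i'') (RNat (NConst 0)) ;;
      PR ''N'' (NConst 0) (nvar ''i'') (RNat (NConst 0)))"

definition compute_scores :: prog where
  "compute_scores = clear_scores ;;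
     PFor ''j'' (NAdd (nvar ''d'') (NConst 1))
       (init_inverse ;; add_design ;; remove_units ;; trace_and_weight ;; add_scores)"

text \<open>The first incumbent 0 may have denominator 0. An index with a positive denominator
  replaces the incumbent unless that one has a positive denominator and a ratio at most as large;
  cross-multiplication avoids division.\<close>

definition select_best :: prog where
  "select_best =
     PN ''t'' (NConst 0) (NConst 0) ;;
     PFor ''i'' (nvar ''m'')
       (PIf (BAnd (RLess (RNat (NConst 0)) (RGet ''D'' (NConst 0) (nvar ''i'')))
              (BNot (BAnd (RLess (RNat (NConst 0)) (RGet ''D'' (NConst 0) (nvar ''t'')))
                (BNot (RLess
                  (RMul (RGet ''N'' (NConst 0) (nvar ''i'')) (RGet ''D'' (NConst 0) (nvar ''t'')))
                  (RMul (RGet ''N'' (NConst 0) (nvar ''t'')) (RGet ''D'' (NConst 0) (nvar ''i''))))))))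
         (PN ''t'' (NConst 0) (nvar ''i'')) PSkip)"

definition rounding_step :: prog where
  "rounding_step = compute_scores ;; select_best ;;
     PN ''s'' (nvar ''r'') (nvar ''t'') ;;
     PN ''n'' (nvar ''t'') (NAdd (NGet ''n'' (nvar ''t'')) (NConst 1))"

text \<open>The row is updated in place, and the new entry l needs the old entries l and l - 1; so l
  runs downwards from k - 1.\<close>

definition weight_factor :: prog where
  "weight_factor = PFor ''q'' (nvar ''k'')
     (let l = NSub (NSub (nvar ''k'') (NConst 1)) (nvar ''q'') in
      PR ''W'' (nvar ''j'') l
        (RDiv (RSub (RMul (RNat l) (RGet ''W'' (nvar ''j'') (NSub l (NConst 1))))
                (RMul (RNat (NAdd (nvar ''i'') (NConst 1))) (RGet ''W'' (nvar ''j'') l)))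
          (RSub (RNat (nvar ''j'')) (RNat (nvar ''i'')))))"

text \<open>Row j starts as the image of the empty product, which is 1 for every l, and takes up one
  linear factor of the Lagrange polynomial for each i other than j.\<close>

definition interpolation_weights :: prog where
  "interpolation_weights = PFor ''j'' (NAdd (nvar ''d'') (NConst 1))
     (PFor ''l'' (nvar ''k'') (PR ''W'' (nvar ''j'') (nvar ''l'') (RNat (NConst 1))) ;;
      PFor ''i'' (NAdd (nvar ''d'') (NConst 1))
        (PIf (BAnd (BNot (NLess (nvar ''i'') (nvar ''j''))) (BNot (NLess (nvar ''j'') (nvar ''i''))))
          PSkip weight_factor))"

definition rounding_main :: prog where
  "rounding_main = interpolation_weights ;; PFor ''r'' (nvar ''k'') rounding_step"

section \<open>Write sets of the program parts, for the frame rules\<close>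

lemma nwrites_parts [simp]:
  "nwrites load_vec = {''a''}" "nwrites load_unit = {''a''}" "nwrites mat_vec = {''a'', ''b''}"
  "nwrites update_inverse = {''a'', ''b''}" "nwrites init_inverse = {''a'', ''b''}"
  "nwrites add_design = {''i'', ''a'', ''b''}" "nwrites remove_units = {''i'', ''a'', ''b''}"
  "nwrites inner_products = {''a''}" "nwrites trace_and_weight = {''a''}"
  "nwrites add_scores = {''i'', ''a'', ''b''}" "nwrites clear_scores = {''i''}"
  "nwrites compute_scores = {''i'', ''j'', ''a'', ''b''}"
  "nwrites select_best = {''t'', ''i''}"
  "nwrites rounding_step = {''i'', ''j'', ''a'', ''b'', ''t'', ''s'', ''n''}"
  "nwrites weight_factor = {''q''}" "nwrites interpolation_weights = {''j'', ''l'', ''i'', ''q''}"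
  by (auto simp: load_vec_def load_unit_def mat_vec_def update_inverse_def init_inverse_def add_design_def
      remove_units_def inner_products_def trace_and_weight_def add_scores_def clear_scores_def
      compute_scores_def select_best_def rounding_step_def weight_factor_def interpolation_weights_def Let_def)

lemma rwrites_parts [simp]:
  "rwrites load_vec = {''u''}" "rwrites load_unit = {''u''}" "rwrites mat_vec = {''z''}"
  "rwrites update_inverse = {''g'', ''Q'', ''p''}" "rwrites init_inverse = {''Q'', ''p''}"
  "rwrites add_design = {''u'', ''c'', ''z'', ''g'', ''Q'', ''p''}"
  "rwrites remove_units = {''u'', ''c'', ''z'', ''g'', ''Q'', ''p''}"
  "rwrites inner_products = {''g'', ''h''}" "rwrites trace_and_weight = {''T'', ''w''}"
  "rwrites add_scores = {''u'', ''z'', ''g'', ''h'', ''D'', ''N''}" "rwrites clear_scores = {''D'', ''N''}"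
  "rwrites compute_scores = {''D'', ''N'', ''Q'', ''p'', ''u'', ''c'', ''z'', ''g'', ''T'', ''w'', ''h''}"
  "rwrites select_best = {}"
  "rwrites rounding_step = {''D'', ''N'', ''Q'', ''p'', ''u'', ''c'', ''z'', ''g'', ''T'', ''w'', ''h''}"
  "rwrites weight_factor = {''W''}" "rwrites interpolation_weights = {''W''}"
  by (auto simp: load_vec_def load_unit_def mat_vec_def update_inverse_def init_inverse_def add_design_def
      remove_units_def inner_products_def trace_and_weight_def add_scores_def clear_scores_def
      compute_scores_def select_best_def rounding_step_def weight_factor_def interpolation_weights_def Let_def)

section \<open>What the program parts compute\<close>

lemma run_load_vec:
  assumes "b < fst s ''d'' 0"
  shows "snd (run load_vec s) ''u'' 0 b = snd s ''v'' (fst s ''i'' 0) b"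
proof -
  let ?p = "PR ''u'' (NConst 0) (nvar ''a'') (RGet ''v'' (nvar ''i'') (nvar ''a''))"
  have "snd (for_loop ''a'' (run ?p) j s) ''u'' 0 b
      = (if b < j then snd s ''v'' (fst s ''i'' 0) b else snd s ''u'' 0 b)" for j
    by (induction j) (auto simp: less_Suc_eq)
  then show ?thesis using assms by (simp add: load_vec_def)
qed

lemma run_load_unit:
  assumes "b < fst s ''d'' 0"
  shows "snd (run load_unit s) ''u'' 0 b = unit_fun (fst s ''i'' 0) b"
proof -
  let ?p = "PR ''u'' (NConst 0) (nvar ''a'') (RNat (NConst 0))"
  have "snd (for_loop ''a'' (run ?p) j s) ''u'' 0 b = (if b < j then 0 else snd s ''u'' 0 b)" for j
    by (induction j) (auto simp: less_Suc_eq)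
  then show ?thesis using assms by (simp add: load_unit_def unit_fun_def)
qed

lemma run_mat_vec:
  assumes "a < fst s ''d'' 0"
  shows "snd (run mat_vec s) ''z'' 0 a = (\<Sum>b<fst s ''d'' 0. snd s ''Q'' a b * snd s ''u'' 0 b)"
proof -
  let ?q = "PR ''z'' (NConst 0) (nvar ''a'')
          (RAdd (RGet ''z'' (NConst 0) (nvar ''a''))
            (RMul (RGet ''Q'' (nvar ''a'') (nvar ''b'')) (RGet ''u'' (NConst 0) (nvar ''b''))))"
  let ?p = "PR ''z'' (NConst 0) (nvar ''a'') (RNat (NConst 0)) ;; PFor ''b'' (nvar ''d'') ?q"
  have inner: "snd (for_loop ''b'' (run ?q) j t) ''z'' 0 a
      = snd t ''z'' 0 a + (if a = fst t ''a'' 0 then \<Sum>b<j. snd t ''Q'' a b * snd t ''u'' 0 b else 0)" for j t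
    by (induction j) auto
  have "snd (for_loop ''a'' (run ?p) j s) ''z'' 0 a
      = (if a < j then \<Sum>b<fst s ''d'' 0. snd s ''Q'' a b * snd s ''u'' 0 b else snd s ''z'' 0 a)" for j
    by (induction j) (auto simp: less_Suc_eq inner)
  then show ?thesis using assms by (simp add: mat_vec_def)
qed

lemma run_update_inverse:
  fixes s :: state
  defines "d \<equiv> fst s ''d'' 0"
  defines "g \<equiv> 1 + snd s ''c'' 0 0 * (\<Sum>a<d. snd s ''u'' 0 a * snd s ''z'' 0 a)"
  shows "a < d \<Longrightarrow> b < d \<Longrightarrow> snd (run update_inverse s) ''Q'' a b
      = snd s ''Q'' a b + (- snd s ''c'' 0 0 / g) * (snd s ''z'' 0 a * snd s ''z'' 0 b)"
    and "snd (run update_inverse s) ''p'' 0 0 = snd s ''p'' 0 0 * g"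
proof -
  let ?p = "PR ''g'' (NConst 0) (NConst 0) (RAdd (rvar ''g'') (RMul (rvar ''c'')
         (RMul (RGet ''u'' (NConst 0) (nvar ''a'')) (RGet ''z'' (NConst 0) (nvar ''a'')))))"
  let ?q = "PR ''Q'' (nvar ''a'') (nvar ''b'') (RAdd (RGet ''Q'' (nvar ''a'') (nvar ''b''))
         (RMul (RDiv (RSub (RNat (NConst 0)) (rvar ''c'')) (rvar ''g''))
           (RMul (RGet ''z'' (NConst 0) (nvar ''a'')) (RGet ''z'' (NConst 0) (nvar ''b'')))))"
  let ?q' = "PFor ''b'' (nvar ''d'') ?q"
  have g: "snd (for_loop ''a'' (run ?p) j t) ''g'' 0 0
      = snd t ''g'' 0 0 + snd t ''c'' 0 0 * (\<Sum>a<j. snd t ''u'' 0 a * snd t ''z'' 0 a)" for j t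
    by (induction j) (auto simp: algebra_simps)
  have inner: "snd (for_loop ''b'' (run ?q) j t) ''Q'' a b = snd t ''Q'' a b + (if a = fst t ''a'' 0 \<and> b < j
      then (- snd t ''c'' 0 0 / snd t ''g'' 0 0) * (snd t ''z'' 0 a * snd t ''z'' 0 b) else 0)" for j t a b
    by (induction j) (auto simp: less_Suc_eq)
  have outer: "snd (for_loop ''a'' (run ?q') j t) ''Q'' a b = snd t ''Q'' a b + (if a < j \<and> b < fst t ''d'' 0
      then (- snd t ''c'' 0 0 / snd t ''g'' 0 0) * (snd t ''z'' 0 a * snd t ''z'' 0 b) else 0)" for j t a b
    by (induction j) (auto simp: less_Suc_eq inner)
  show "a < d \<Longrightarrow> b < d \<Longrightarrow> snd (run update_inverse s) ''Q'' a b
      = snd s ''Q'' a b + (- snd s ''c'' 0 0 / g) * (snd s ''z'' 0 a * snd s ''z'' 0 b)"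
    by (simp add: update_inverse_def outer g g_def d_def)
  show "snd (run update_inverse s) ''p'' 0 0 = snd s ''p'' 0 0 * g"
    by (simp add: update_inverse_def g g_def d_def)
qed

lemma run_init_inverse:
  assumes "a < fst s ''d'' 0" "b < fst s ''d'' 0"
  shows "snd (run init_inverse s) ''Q'' a b = (if a = b then 1 else 0)"
    and "snd (run init_inverse s) ''p'' 0 0 = 1"
proof -
  let ?q = "PR ''Q'' (nvar ''a'') (nvar ''b'') (RNat (NConst 0))"
  let ?p = "PFor ''b'' (nvar ''d'') ?q ;; PR ''Q'' (nvar ''a'') (nvar ''a'') (RNat (NConst 1))"
  have inner: "snd (for_loop ''b'' (run ?q) j t) ''Q'' a b
      = (if a = fst t ''a'' 0 \<and> b < j then 0 else snd t ''Q'' a b)" for j t a b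
    by (induction j) (auto simp: less_Suc_eq)
  have "snd (for_loop ''a'' (run ?p) j s) ''Q'' a b
      = (if a < j then if a = b then 1 else 0 else snd s ''Q'' a b)" for j
    using assms by (induction j) (auto simp: less_Suc_eq inner)
  then show "snd (run init_inverse s) ''Q'' a b = (if a = b then 1 else 0)"
    using assms by (simp add: init_inverse_def)
  show "snd (run init_inverse s) ''p'' 0 0 = 1"
    by (simp add: init_inverse_def)
qed

lemma run_inner_products:
  "snd (run inner_products s) ''g'' 0 0 = 1 + (\<Sum>a<fst s ''d'' 0. snd s ''u'' 0 a * snd s ''z'' 0 a)"
  "snd (run inner_products s) ''h'' 0 0 = (\<Sum>a<fst s ''d'' 0. snd s ''z'' 0 a * snd s ''z'' 0 a)"
proof -
  let ?p = "PR ''g'' (NConst 0) (NConst 0) (RAdd (rvar ''g'')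
          (RMul (RGet ''u'' (NConst 0) (nvar ''a'')) (RGet ''z'' (NConst 0) (nvar ''a'')))) ;;
        PR ''h'' (NConst 0) (NConst 0) (RAdd (rvar ''h'')
          (RMul (RGet ''z'' (NConst 0) (nvar ''a'')) (RGet ''z'' (NConst 0) (nvar ''a''))))"
  have "snd (for_loop ''a'' (run ?p) j t) ''g'' 0 0 = snd t ''g'' 0 0 + (\<Sum>a<j. snd t ''u'' 0 a * snd t ''z'' 0 a)"
    "snd (for_loop ''a'' (run ?p) j t) ''h'' 0 0 = snd t ''h'' 0 0 + (\<Sum>a<j. snd t ''z'' 0 a * snd t ''z'' 0 a)" for j t
    by (induction j) auto
  then show "snd (run inner_products s) ''g'' 0 0 = 1 + (\<Sum>a<fst s ''d'' 0. snd s ''u'' 0 a * snd s ''z'' 0 a)"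
    "snd (run inner_products s) ''h'' 0 0 = (\<Sum>a<fst s ''d'' 0. snd s ''z'' 0 a * snd s ''z'' 0 a)"
    by (simp_all add: inner_products_def)
qed

lemma run_trace_and_weight:
  "snd (run trace_and_weight s) ''T'' 0 0 = (\<Sum>a<fst s ''d'' 0. snd s ''Q'' a a)"
  "snd (run trace_and_weight s) ''w'' 0 0
     = snd s ''W'' (fst s ''j'' 0) (fst s ''k'' 0 - 1 - fst s ''r'' 0) * snd s ''p'' 0 0"
proof -
  let ?p = "PR ''T'' (NConst 0) (NConst 0) (RAdd (rvar ''T'') (RGet ''Q'' (nvar ''a'') (nvar ''a'')))"
  have "snd (for_loop ''a'' (run ?p) j t) ''T'' 0 0 = snd t ''T'' 0 0 + (\<Sum>a<j. snd t ''Q'' a a)" for j t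
    by (induction j) auto
  then show "snd (run trace_and_weight s) ''T'' 0 0 = (\<Sum>a<fst s ''d'' 0. snd s ''Q'' a a)"
    by (simp add: trace_and_weight_def)
  show "snd (run trace_and_weight s) ''w'' 0 0
     = snd s ''W'' (fst s ''j'' 0) (fst s ''k'' 0 - 1 - fst s ''r'' 0) * snd s ''p'' 0 0"
    by (simp add: trace_and_weight_def)
qed

lemma run_clear_scores:
  assumes "i < fst s ''m'' 0"
  shows "snd (run clear_scores s) ''D'' 0 i = 0" "snd (run clear_scores s) ''N'' 0 i = 0"
proof -
  let ?p = "PR ''D'' (NConst 0) (nvar ''i'') (RNat (NConst 0)) ;; PR ''N'' (NConst 0) (nvar ''i'') (RNat (NConst 0))"
  have "snd (for_loop ''i'' (run ?p) j s) ''D'' 0 i = (if i < j then 0 else snd s ''D'' 0 i) \<and>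
      snd (for_loop ''i'' (run ?p) j s) ''N'' 0 i = (if i < j then 0 else snd s ''N'' 0 i)" for j
    by (induction j) (auto simp: less_Suc_eq)
  then show "snd (run clear_scores s) ''D'' 0 i = 0" "snd (run clear_scores s) ''N'' 0 i = 0"
    using assms by (simp_all add: clear_scores_def)
qed

lemma run_select_best:
  fixes s :: state
  defines "D \<equiv> snd s ''D'' 0" and "N \<equiv> snd s ''N'' 0" and "m \<equiv> fst s ''m'' 0"
  assumes m: "0 < m"
  defines "t \<equiv> fst (run select_best s) ''t'' 0"
  shows "t < m" "i < m \<Longrightarrow> 0 < D i \<Longrightarrow> 0 < D t \<and> N t * D i \<le> N i * D t"
proof -
  let ?p = "PIf (BAnd (RLess (RNat (NConst 0)) (RGet ''D'' (NConst 0) (nvar ''i'')))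
              (BNot (BAnd (RLess (RNat (NConst 0)) (RGet ''D'' (NConst 0) (nvar ''t'')))
                (BNot (RLess
                  (RMul (RGet ''N'' (NConst 0) (nvar ''i'')) (RGet ''D'' (NConst 0) (nvar ''t'')))
                  (RMul (RGet ''N'' (NConst 0) (nvar ''t'')) (RGet ''D'' (NConst 0) (nvar ''i''))))))))
         (PN ''t'' (NConst 0) (nvar ''i'')) PSkip"
  define s0 where "s0 = nupdate s ''t'' 0 0"
  define S where "S j = for_loop ''i'' (run ?p) j s0" for j
  define best where "best j = fst (S j) ''t'' 0" for j
  have best_0: "best 0 = 0" by (simp add: best_def S_def s0_def)
  have best_Suc: "best (Suc j) = (if 0 < D j \<and> \<not> (0 < D (best j) \<and> N (best j) * D j \<le> N j * D (best j))
      then j else best j)" for j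
  proof -
    have [simp]: "snd (S j) = snd s" "fst (S j) ''i'' 0 = j"
      by (auto simp: S_def s0_def fun_eq_iff)
    have "S (Suc j) = nupdate (run ?p (S j)) ''i'' 0 (Suc j)" by (simp add: S_def)
    then show ?thesis by (simp add: best_def D_def N_def not_less)
  qed
  have "best j < m" if "j \<le> m" for j
    using that m by (induction j) (auto simp: best_0 best_Suc)
  moreover have t: "t = best m"
    by (simp add: t_def select_best_def best_def S_def s0_def m_def)
  ultimately show "t < m" by simp
  have "\<forall>i<j. 0 < D i \<longrightarrow> 0 < D (best j) \<and> N (best j) * D i \<le> N i * D (best j)" for j
  proof (induction j)
    case (Suc j)
    show ?case
    proof (intro allI impI)
      fix i assume i: "i < Suc j" "0 < D i"
      show "0 < D (best (Suc j)) \<and> N (best (Suc j)) * D i \<le> N i * D (best (Suc j))"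
      proof (cases "0 < D j \<and> \<not> (0 < D (best j) \<and> N (best j) * D j \<le> N j * D (best j))")
        case True
        show ?thesis
        proof (cases "i = j")
          case False
          then have h: "0 < D (best j)" "N (best j) * D i \<le> N i * D (best j)"
            using Suc i by (auto simp: less_Suc_eq)
          \<comment> \<open>Transitivity of the comparison: j improves on the old incumbent, which
            is at least as good as i. Multiply by D i and by D j, then cancel D (best j).\<close>
          then have "N j * D (best j) \<le> N (best j) * D j" using True by simp
          then have "N j * D (best j) * D i \<le> N (best j) * D j * D i"
            using i by (intro mult_right_mono) auto
          also have "\<dots> = (N (best j) * D i) * D j" by simp
          also have "\<dots> \<le> (N i * D (best j)) * D j" using h(2) True by (intro mult_right_mono) auto
          finally have "(N j * D i) * D (best j) \<le> (N i * D j) * D (best j)" by (simp add: mult_ac)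
          then show ?thesis using True h(1) by (simp add: best_Suc)
        qed (use True in \<open>simp add: best_Suc\<close>)
      next
        case False
        then show ?thesis using Suc i by (auto simp: best_Suc less_Suc_eq)
      qed
    qed
  qed simp
  then show "i < m \<Longrightarrow> 0 < D i \<Longrightarrow> 0 < D t \<and> N t * D i \<le> N i * D t"
    by (simp add: t)
qed

lemma run_weight_factor:
  fixes s :: state
  defines "j \<equiv> fst s ''j'' 0" and "i \<equiv> fst s ''i'' 0" and "k \<equiv> fst s ''k'' 0" and "W \<equiv> snd s ''W''"
  shows "l < k \<Longrightarrow> snd (run weight_factor s) ''W'' j l
      = (real l * W j (l - 1) - (real i + 1) * W j l) / (real j - real i)"
    and "j' \<noteq> j \<Longrightarrow> snd (run weight_factor s) ''W'' j' = W j'"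
proof -
  let ?l = "NSub (NSub (nvar ''k'') (NConst 1)) (nvar ''q'')"
  let ?p = "PR ''W'' (nvar ''j'') ?l
        (RDiv (RSub (RMul (RNat ?l) (RGet ''W'' (nvar ''j'') (NSub ?l (NConst 1))))
                (RMul (RNat (NAdd (nvar ''i'') (NConst 1))) (RGet ''W'' (nvar ''j'') ?l)))
          (RSub (RNat (nvar ''j'')) (RNat (nvar ''i''))))"
  \<comment> \<open>After n rounds exactly the entries l \<ge> k - n are new; the condition is
    stated additively because subtraction truncates.\<close>
  have "snd (for_loop ''q'' (run ?p) n s) ''W'' j l = (if k \<le> l + n
      then (real l * W j (l - 1) - (real i + 1) * W j l) / (real j - real i) else W j l)"
    if "n \<le> k" "l < k" for n l
    using that
  proof (induction n arbitrary: l)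
    case (Suc n)
    let ?S = "for_loop ''q'' (run ?p) n s"
    obtain l0 where l0: "k = Suc (l0 + n)" using Suc.prems(1) by (metis add.commute add_Suc less_eqE)
    have "snd ?S ''W'' j l0 = W j l0" using Suc.IH[of l0] l0 by simp
    \<comment> \<open>For l0 = 0 the index l0 - 1 is l0 itself, but the factor is 0.\<close>
    moreover have "real l0 * snd ?S ''W'' j (l0 - 1) = real l0 * W j (l0 - 1)"
      using Suc.IH[of "l0 - 1"] l0 by (cases l0) auto
    moreover have "fst s ''k'' 0 - 1 - n = l0" using l0 by (simp add: k_def)
    ultimately have "snd (run ?p ?S) ''W'' j l = (if l = l0
        then (real l0 * W j (l0 - 1) - (real i + 1) * W j l0) / (real j - real i) else snd ?S ''W'' j l)"
      by (simp add: j_def i_def diff_diff_left del: diff_diff_left)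
    moreover have "k \<le> l + Suc n \<longleftrightarrow> l = l0 \<or> k \<le> l + n" using l0 by auto
    moreover have "\<not> k \<le> l0 + n" using l0 by simp
    ultimately show ?case using Suc.IH[of l] Suc.prems by auto
  qed (simp add: W_def)
  from this[of k l] show "l < k \<Longrightarrow> snd (run weight_factor s) ''W'' j l
      = (real l * W j (l - 1) - (real i + 1) * W j l) / (real j - real i)"
    by (simp add: weight_factor_def Let_def k_def)
  have "snd (for_loop ''q'' (run ?p) n s) ''W'' j' = W j'" if "j' \<noteq> j" for n
    using that by (induction n) (auto simp: W_def j_def)
  then show "j' \<noteq> j \<Longrightarrow> snd (run weight_factor s) ''W'' j' = W j'"
    by (simp add: weight_factor_def Let_def)
qed

text \<open>The recurrence behind \<open>weight_factor\<close>: multiplying by y - (n + 1) mixes the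
  values at l and l - 1.\<close>

lemma umbral_lagrange_Suc:
  assumes "n \<noteq> j"
  shows "umbral l (lagrange (Suc n) j)
    = (real l * umbral (l - 1) (lagrange n j) - (real n + 1) * umbral l (lagrange n j)) / (real j - real n)"
  using assms by (simp only: lagrange_Suc if_False umbral_smult umbral_linear_factor) simp

lemma run_interpolation_weights:
  fixes s :: state
  defines "d \<equiv> fst s ''d'' 0" and "k \<equiv> fst s ''k'' 0"
  assumes "j < Suc d" "l < k"
  shows "snd (run interpolation_weights s) ''W'' j l = umbral l (lagrange (Suc d) j)"
proof -
  let ?fill = "PR ''W'' (nvar ''j'') (nvar ''l'') (RNat (NConst 1))"
  let ?mult = "PIf (BAnd (BNot (NLess (nvar ''i'') (nvar ''j''))) (BNot (NLess (nvar ''j'') (nvar ''i''))))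
          PSkip weight_factor"
  let ?p = "PFor ''l'' (nvar ''k'') ?fill ;; PFor ''i'' (NAdd (nvar ''d'') (NConst 1)) ?mult"
  have init: "snd (for_loop ''l'' (run ?fill) n t) ''W'' j l
      = (if j = fst t ''j'' 0 \<and> l < n then 1 else snd t ''W'' j l)" for n t j l
    by (induction n) (auto simp: less_Suc_eq)
  \<comment> \<open>After n factors the row holds the weights for n nodes. All l are treated at
    once, as the recurrence reads l - 1.\<close>
  have inner: "snd (for_loop ''i'' (run ?mult) n t) ''W'' j l
      = (if j = fst t ''j'' 0 then umbral l (lagrange n j) else snd t ''W'' j l)"
    if "\<And>l. l < k \<Longrightarrow> snd t ''W'' (fst t ''j'' 0) l = 1" "fst t ''k'' 0 = k" "l < k" for n t j l
    using that(3)
  proof (induction n arbitrary: l)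
    case 0
    then show ?case using that by (simp add: lagrange_def umbral_1)
  next
    case (Suc n)
    let ?S = "for_loop ''i'' (run ?mult) n t"
    show ?case
    proof (cases "n = fst t ''j'' 0 \<or> j \<noteq> fst t ''j'' 0")
      case True
      then show ?thesis using Suc by (auto simp: lagrange_Suc run_weight_factor(2))
    next
      case False
      then have j: "j = fst t ''j'' 0" "n \<noteq> j" by auto
      have "snd (for_loop ''i'' (run ?mult) (Suc n) t) ''W'' j l = snd (run weight_factor ?S) ''W'' j l"
        using j by auto
      also have "\<dots> = (real l * snd ?S ''W'' j (l - 1) - (real n + 1) * snd ?S ''W'' j l) / (real j - real n)"
        using run_weight_factor(1)[of l ?S] Suc.prems that(2) j by simp
      also have "\<dots> = umbral l (lagrange (Suc n) j)"
        using Suc.IH[of l] Suc.IH[of "l - 1"] Suc.prems j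
        by (simp add: umbral_lagrange_Suc)
      finally show ?thesis using j by simp
    qed
  qed
  have step: "snd (run ?p t) ''W'' j l
      = (if j = fst t ''j'' 0 then umbral l (lagrange (Suc d) j) else snd t ''W'' j l)"
    if "fst t ''k'' 0 = k" "fst t ''d'' 0 = d" "l < k" for t j l
    using inner[of "for_loop ''l'' (run ?fill) k t" l "d + 1" j] that by (simp add: init Suc_eq_plus1)
  have "snd (for_loop ''j'' (run ?p) n s) ''W'' j l
      = (if j < n then umbral l (lagrange (Suc d) j) else snd s ''W'' j l)" for n
  proof (induction n)
    case (Suc n)
    then show ?case
      using step[of "for_loop ''j'' (run ?p) n s" l j] assms by (auto simp: d_def k_def less_Suc_eq simp del: run.simps)
  qed simp
  then show ?thesis using assms by (simp add: interpolation_weights_def d_def Suc_eq_plus1)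
qed

section \<open>Correctness\<close>

lemma run_inverse_update:
  assumes pair: "inverse_pair d P (snd s ''Q'') (snd s ''p'' 0 0)" and d: "fst s ''d'' 0 = d"
    and u: "\<And>a. a < d \<Longrightarrow> snd s ''u'' 0 a = u a" and c: "snd s ''c'' 0 0 = c"
    and nz: "det (rank1_update d P c u) \<noteq> 0"
  defines "s' \<equiv> run update_inverse (run mat_vec s)"
  shows "inverse_pair d (rank1_update d P c u) (snd s' ''Q'') (snd s' ''p'' 0 0)"
proof -
  define g where "g = 1 + c * (\<Sum>a<d. u a * snd (run mat_vec s) ''z'' 0 a)"
  have z: "snd (run mat_vec s) ''z'' 0 a = (\<Sum>b<d. snd s ''Q'' a b * u b)" if "a < d" for a
    using that u by (simp add: run_mat_vec d)
  have g': "1 + snd (run mat_vec s) ''c'' 0 0 * (\<Sum>a<fst (run mat_vec s) ''d'' 0.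
      snd (run mat_vec s) ''u'' 0 a * snd (run mat_vec s) ''z'' 0 a) = g"
    by (simp add: g_def d c u)
  have q: "snd s' ''Q'' a b = snd s ''Q'' a b + (- c / g) *
      (snd (run mat_vec s) ''z'' 0 a * snd (run mat_vec s) ''z'' 0 b)" if "a < d" "b < d" for a b
    using run_update_inverse(1)[of a "run mat_vec s" b] that unfolding s'_def g' by (simp add: d c)
  have "snd s' ''p'' 0 0 = snd s ''p'' 0 0 * g"
    using run_update_inverse(2)[of "run mat_vec s"] unfolding s'_def g' by simp
  then show ?thesis using inverse_pair_rank1_update(1)[OF pair z g_def nz q] by simp
qed

text \<open>Shows the pencil as one weighted sum over the v_i, so each vector costs a single
  rank-one update and positivity is a question of the weights.\<close>

lemma fractional_matrix_pencil:
  "fractional_matrix d m v (\<lambda>i. n i + y * p i) = pencil d (fractional_matrix d m v n) y (fractional_matrix d m v p)"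
  by (intro eq_matI) (auto simp: sum.distrib sum_distrib_left algebra_simps)

lemma rounding_step_output:
  fixes s :: state
  defines "t \<equiv> fst (run select_best (run compute_scores s)) ''t'' 0"
  shows "fst (run rounding_step s) ''s'' = (fst s ''s'')(fst s ''r'' 0 := t)"
    and "fst (run rounding_step s) ''n'' = (fst s ''n'')(t := fst s ''n'' t + 1)"
  by (simp_all add: rounding_step_def t_def)

text \<open>Stated outside the locale below: the range of the output matters for singular X too.
  Counting with \<open>n\<close> identifies the output multiset with the design that the scores
  refer to.\<close>

lemma rounding_loop_output:
  fixes s :: state
  defines "S \<equiv> \<lambda>r. for_loop ''r'' (run rounding_step) r s"
  assumes "0 < fst s ''m'' 0" "\<And>i. fst s ''n'' i = 0"
  shows "set (map (fst (S r) ''s'') [0..<r]) \<subseteq> {..<fst s ''m'' 0}"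
    and "count (mset (map (fst (S r) ''s'') [0..<r])) i = fst (S r) ''n'' i"
proof -
  define out where "out r = map (fst (S r) ''s'') [0..<r]" for r
  have "set (out r) \<subseteq> {..<fst s ''m'' 0} \<and> (\<forall>i. count (mset (out r)) i = fst (S r) ''n'' i)"
  proof (induction r)
    case 0
    then show ?case using assms by (simp add: out_def)
  next
    case (Suc r)
    define t where "t = fst (run select_best (run compute_scores (S r))) ''t'' 0"
    have r: "fst (S r) ''r'' 0 = r" by (simp add: S_def)
    have t: "t < fst s ''m'' 0"
      using run_select_best(1)[of "run compute_scores (S r)"] assms(2) by (simp add: t_def S_def)
    have s': "fst (S (Suc r)) ''s'' = (fst (S r) ''s'')(r := t)"
      and n': "fst (S (Suc r)) ''n'' = (fst (S r) ''n'')(t := fst (S r) ''n'' t + 1)"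
      using rounding_step_output[of "S r"] r by (simp_all add: t_def S_def)
    have "out (Suc r) = out r @ [t]" by (simp add: out_def s')
    then show ?case using Suc t n' by auto
  qed
  then show "set (map (fst (S r) ''s'') [0..<r]) \<subseteq> {..<fst s ''m'' 0}"
    "count (mset (map (fst (S r) ''s'') [0..<r])) i = fst (S r) ''n'' i" unfolding out_def by blast+
qed

text \<open>The case of nonsingular X; otherwise the bound to be shown is infinite.\<close>

locale rounding_instance =
  fixes d m k :: nat and v :: "nat \<Rightarrow> real vec" and x :: "nat \<Rightarrow> real"
  assumes d: "1 \<le> d" and dk: "d \<le> k"
    and x_nonneg: "\<And>i. i < m \<Longrightarrow> 0 \<le> x i" and sum_x: "(\<Sum>i<m. x i) = real k"
    and nonsingular: "det (fractional_matrix d m v x) \<noteq> 0"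
begin

definition prob :: "nat \<Rightarrow> real" where "prob i = x i / real k"

abbreviation "B \<equiv> fractional_matrix d m v prob"

abbreviation "design n \<equiv> fractional_matrix d m v (\<lambda>i. real (n i))"

definition holds_input :: "state \<Rightarrow> bool" where
  "holds_input s \<longleftrightarrow> fst s ''d'' 0 = d \<and> fst s ''m'' 0 = m \<and> fst s ''k'' 0 = k \<and>
     (\<forall>i<m. \<forall>a<d. snd s ''v'' i a = v i $ a) \<and> (\<forall>i<m. snd s ''x'' i 0 = x i)"

lemma k_pos: "0 < k" using d dk by simp

lemma m_pos: "0 < m" using sum_x k_pos by (cases m) auto

lemma prob_nonneg: "i < m \<Longrightarrow> 0 \<le> prob i" using x_nonneg by (simp add: prob_def)

lemma sum_prob: "(\<Sum>i<m. prob i) = 1"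
  using k_pos sum_x by (simp add: prob_def flip: sum_divide_distrib)

lemma holds_input_cong:
  assumes "holds_input s" "\<And>a. a \<in> {''d'', ''m'', ''k''} \<Longrightarrow> fst s' a = fst s a"
    "\<And>a. a \<in> {''v'', ''x''} \<Longrightarrow> snd s' a = snd s a"
  shows "holds_input s'"
  using assms by (simp add: holds_input_def)

text \<open>For y > 0 the weight n_i + y x_i / k vanishes only if x_i does, so X nonsingular gives
  definiteness.\<close>

lemma pencil_pos_def:
  assumes "0 < y"
  shows "pos_def d (pencil d (design n) y B)"
  unfolding fractional_matrix_pencil[symmetric]
proof (rule fractional_matrix_pos_def[OF nonsingular])
  fix i assume i: "i < m"
  show "0 \<le> real (n i) + y * prob i" using prob_nonneg[OF i] assms by simp
  assume "real (n i) + y * prob i = 0"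
  then have "y * prob i = 0" using prob_nonneg[OF i] assms
    by (smt (verit) mult_nonneg_nonneg of_nat_0_le_iff)
  then show "x i = 0" using assms k_pos by (simp add: prob_def)
qed

text \<open>The arrays follow the chain I, F + I, F given by \<open>partial_shift\<close>. Adding
  vectors is safe because of the shift, removing the units because F is positive definite.\<close>

lemma run_inverse:
  assumes s: "holds_input s"
  defines "s' \<equiv> run remove_units (run add_design (run init_inverse s))"
  shows "inverse_pair d (pencil d (design (fst s ''n'')) (real (fst s ''j'' 0) + 1) B)
    (snd s' ''Q'') (snd s' ''p'' 0 0)"
proof -
  define c where "c i = real (fst s ''n'' i) + (real (fst s ''j'' 0) + 1) * prob i" for i
  let ?F = "\<lambda>i. fractional_matrix d i v c"
  have F: "?F m = pencil d (design (fst s ''n'')) (real (fst s ''j'' 0) + 1) B"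
    unfolding c_def by (rule fractional_matrix_pencil)
  have c0: "0 \<le> c i" if "i < m" for i using prob_nonneg[OF that] by (simp add: c_def)
  have dmk: "fst s ''d'' 0 = d" "fst s ''m'' 0 = m" "fst s ''k'' 0 = k" using s by (auto simp: holds_input_def)
  define s1 where "s1 = run init_inverse s"
  have 1: "inverse_pair d (1\<^sub>m d) (snd s1 ''Q'') (snd s1 ''p'' 0 0)"
    using inverse_pair_one[of d "snd s1 ''Q''"] run_init_inverse(1)[of _ s] run_init_inverse(2)[of 0 s 0] d
    by (simp add: s1_def dmk)
  let ?body = "load_vec ;; PR ''c'' (NConst 0) (NConst 0)
        (RAdd (RNat (NGet ''n'' (nvar ''i'')))
          (RMul (RNat (NAdd (nvar ''j'') (NConst 1)))
            (RDiv (RGet ''x'' (nvar ''i'') (NConst 0)) (RNat (nvar ''k''))))) ;;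
      mat_vec ;; update_inverse"
  define S where "S i = for_loop ''i'' (run ?body) i s1" for i
  have 2: "inverse_pair d (partial_shift d 0 (?F i)) (snd (S i) ''Q'') (snd (S i) ''p'' 0 0)" if "i \<le> m" for i
    using that
  proof (induction i)
    case 0
    then show ?case using 1 by (simp add: S_def partial_shift_start)
  next
    case (Suc i)
    have i: "i < m" using Suc.prems by simp
    define t where "t = rupdate (run load_vec (S i)) ''c'' 0 0 (c i)"
    have eq: "S (Suc i) = nupdate (run update_inverse (run mat_vec t)) ''i'' 0 (Suc i)"
      using s i by (simp add: S_def t_def c_def prob_def s1_def dmk holds_input_def add.commute)
    have "inverse_pair d (rank1_update d (partial_shift d 0 (?F i)) (c i) (($) (v i)))
      (snd (run update_inverse (run mat_vec t)) ''Q'') (snd (run update_inverse (run mat_vec t)) ''p'' 0 0)"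
    proof (rule run_inverse_update)
      show "inverse_pair d (partial_shift d 0 (?F i)) (snd t ''Q'') (snd t ''p'' 0 0)"
        using Suc i by (simp add: t_def)
      show "fst t ''d'' 0 = d" by (simp add: t_def S_def s1_def dmk)
      show "snd t ''u'' 0 a = v i $ a" if "a < d" for a
        using that s i by (simp add: t_def S_def s1_def run_load_vec dmk holds_input_def)
      show "snd t ''c'' 0 0 = c i" by (simp add: t_def)
      show "det (rank1_update d (partial_shift d 0 (?F i)) (c i) (($) (v i))) \<noteq> 0"
        unfolding partial_shift_fractional_matrix_Suc[symmetric]
        using c0 i by (intro pos_def_det_nonzero[of d] partial_shift_0_pos_def) auto
    qed
    then show ?case by (simp add: eq partial_shift_fractional_matrix_Suc)
  qed
  define s2 where "s2 = run add_design s1"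
  have s2: "s2 = S m" by (simp add: s2_def add_design_def S_def s1_def dmk)
  let ?body' = "load_unit ;;
      PR ''c'' (NConst 0) (NConst 0) (RSub (RNat (NConst 0)) (RNat (NConst 1))) ;;
      mat_vec ;; update_inverse"
  define S' where "S' i = for_loop ''i'' (run ?body') i s2" for i
  have 3: "inverse_pair d (partial_shift d i (?F m)) (snd (S' i) ''Q'') (snd (S' i) ''p'' 0 0)" if "i \<le> d" for i
    using that
  proof (induction i)
    case 0
    then show ?case using 2[of m] by (simp add: S'_def s2)
  next
    case (Suc i)
    define t where "t = rupdate (run load_unit (S' i)) ''c'' 0 0 (- 1)"
    have eq: "S' (Suc i) = nupdate (run update_inverse (run mat_vec t)) ''i'' 0 (Suc i)"
      by (simp add: S'_def t_def)
    have "inverse_pair d (rank1_update d (partial_shift d i (?F m)) (- 1) (unit_fun i))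
      (snd (run update_inverse (run mat_vec t)) ''Q'') (snd (run update_inverse (run mat_vec t)) ''p'' 0 0)"
    proof (rule run_inverse_update)
      show "inverse_pair d (partial_shift d i (?F m)) (snd t ''Q'') (snd t ''p'' 0 0)"
        using Suc by (simp add: t_def)
      show "fst t ''d'' 0 = d" by (simp add: t_def S'_def s2_def s1_def dmk)
      show "snd t ''u'' 0 a = unit_fun i a" if "a < d" for a
        using that by (simp add: t_def S'_def s2_def s1_def run_load_unit dmk)
      show "snd t ''c'' 0 0 = - 1" by (simp add: t_def)
      show "det (rank1_update d (partial_shift d i (?F m)) (- 1) (unit_fun i)) \<noteq> 0"
        unfolding partial_shift_Suc[symmetric] F
        by (intro pos_def_det_nonzero[of d] partial_shift_pos_def pencil_pos_def) auto
    qed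
    then show ?case by (simp add: eq partial_shift_Suc)
  qed
  have "s' = S' d" by (simp add: s'_def remove_units_def S'_def s2_def s1_def dmk)
  then show ?thesis using 3[of d] by (simp add: partial_shift_end F)
qed

text \<open>Candidates are only evaluated against the inverse of \<open>P\<close>, in O(d) after one
  matrix-vector product; \<open>Q\<close> stays fixed for all of them.\<close>

lemma run_add_scores:
  assumes s: "holds_input s" and pair: "inverse_pair d P (snd s ''Q'') \<delta>"
    and T: "snd s ''T'' 0 0 = (\<Sum>a<d. snd s ''Q'' a a)" and w: "snd s ''w'' 0 0 = \<omega> * \<delta>"
    and nz: "\<And>i. i < m \<Longrightarrow> det (rank1_update d P 1 (($) (v i))) \<noteq> 0" and i: "i < m"
  shows "snd (run add_scores s) ''D'' 0 i = snd s ''D'' 0 i + \<omega> * det (rank1_update d P 1 (($) (v i)))"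
    and "snd (run add_scores s) ''N'' 0 i = snd s ''N'' 0 i + \<omega> * adj_trace d (rank1_update d P 1 (($) (v i)))"
proof -
  let ?body = "load_vec ;; mat_vec ;; inner_products ;;
      PR ''D'' (NConst 0) (nvar ''i'')
        (RAdd (RGet ''D'' (NConst 0) (nvar ''i'')) (RMul (rvar ''w'') (rvar ''g''))) ;;
      PR ''N'' (NConst 0) (nvar ''i'')
        (RAdd (RGet ''N'' (NConst 0) (nvar ''i''))
          (RMul (rvar ''w'') (RSub (RMul (rvar ''g'') (rvar ''T'')) (rvar ''h''))))"
  define S where "S j = for_loop ''i'' (run ?body) j s" for j
  have dm: "fst s ''d'' 0 = d" "fst s ''m'' 0 = m" using s by (auto simp: holds_input_def)
  have step: "snd (S (Suc j)) ''D'' 0 i = snd (S j) ''D'' 0 i + (if i = j then \<omega> * det (rank1_update d P 1 (($) (v j))) else 0)"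
      "snd (S (Suc j)) ''N'' 0 i = snd (S j) ''N'' 0 i + (if i = j then \<omega> * adj_trace d (rank1_update d P 1 (($) (v j))) else 0)"
    if j: "j < m" for j
  proof -
    define t where "t = run mat_vec (run load_vec (S j))"
    have u: "snd t ''u'' 0 a = v j $ a" if "a < d" for a
      using that s j by (simp add: t_def S_def run_load_vec dm holds_input_def)
    have z: "snd t ''z'' 0 a = (\<Sum>b<d. snd s ''Q'' a b * (v j $ b))" if "a < d" for a
      using that s j by (simp add: t_def run_mat_vec dm S_def run_load_vec holds_input_def)
    have dt: "fst t ''d'' 0 = d" by (simp add: t_def S_def dm)
    define g where "g = 1 + 1 * (\<Sum>a<d. v j $ a * snd t ''z'' 0 a)"
    have g: "snd (run inner_products t) ''g'' 0 0 = g"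
      by (simp add: run_inner_products g_def dt u)
    have h: "snd (run inner_products t) ''h'' 0 0 = (\<Sum>a<d. snd t ''z'' 0 a * snd t ''z'' 0 a)"
      by (simp add: run_inner_products dt)
    \<comment> \<open>\<open>refl\<close> supplies the updated inverse as a mere term; the program
      never stores it.\<close>
    note r = inverse_pair_rank1_update[OF pair z g_def nz[OF j] refl]
    have det: "det (rank1_update d P 1 (($) (v j))) = \<delta> * g" using r(1) by (simp add: inverse_pair_def)
    have w': "snd t ''w'' 0 0 = \<omega> * \<delta>" "snd t ''T'' 0 0 = (\<Sum>a<d. snd s ''Q'' a a)"
      by (simp_all add: t_def S_def w T)
    have i': "fst t ''i'' 0 = j" "snd t ''D'' = snd (S j) ''D''" "snd t ''N'' = snd (S j) ''N''"
      by (simp_all add: t_def S_def)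
    have S: "S (Suc j) = nupdate (run (inner_products ;; PR ''D'' (NConst 0) (nvar ''i'')
        (RAdd (RGet ''D'' (NConst 0) (nvar ''i'')) (RMul (rvar ''w'') (rvar ''g''))) ;;
      PR ''N'' (NConst 0) (nvar ''i'')
        (RAdd (RGet ''N'' (NConst 0) (nvar ''i''))
          (RMul (rvar ''w'') (RSub (RMul (rvar ''g'') (rvar ''T'')) (rvar ''h''))))) t) ''i'' 0 (Suc j)"
      by (simp add: S_def t_def)
    show "snd (S (Suc j)) ''D'' 0 i = snd (S j) ''D'' 0 i + (if i = j then \<omega> * det (rank1_update d P 1 (($) (v j))) else 0)"
      unfolding S by (simp add: i' g w' det)
    show "snd (S (Suc j)) ''N'' 0 i = snd (S j) ''N'' 0 i + (if i = j then \<omega> * adj_trace d (rank1_update d P 1 (($) (v j))) else 0)"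
      unfolding S by (simp add: i' g h w' r(2))
  qed
  have "snd (S j) ''D'' 0 i = snd s ''D'' 0 i + (if i < j then \<omega> * det (rank1_update d P 1 (($) (v i))) else 0) \<and>
      snd (S j) ''N'' 0 i = snd s ''N'' 0 i + (if i < j then \<omega> * adj_trace d (rank1_update d P 1 (($) (v i))) else 0)"
    if "j \<le> m" for j
    using that
  proof (induction j)
    case (Suc j)
    then show ?case using step[of j] by (auto simp: less_Suc_eq)
  qed (simp add: S_def)
  from this[of m]
  show "snd (run add_scores s) ''D'' 0 i = snd s ''D'' 0 i + \<omega> * det (rank1_update d P 1 (($) (v i)))"
    "snd (run add_scores s) ''N'' 0 i = snd s ''N'' 0 i + \<omega> * adj_trace d (rank1_update d P 1 (($) (v i)))"
    using i by (simp_all add: add_scores_def S_def dm)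
qed

lemma run_compute_scores:
  assumes s: "holds_input s" and i: "i < m"
    and W: "\<And>j. j < Suc d \<Longrightarrow> snd s ''W'' j (k - 1 - fst s ''r'' 0) = umbral l (lagrange (Suc d) j)"
  shows "snd (run compute_scores s) ''D'' 0 i
      = mean_det d l (rank1_update d (design (fst s ''n'')) 1 (($) (v i))) B"
    and "snd (run compute_scores s) ''N'' 0 i
      = mean_adj_trace d l (rank1_update d (design (fst s ''n'')) 1 (($) (v i))) B"
proof -
  let ?body = "init_inverse ;; add_design ;; remove_units ;; trace_and_weight ;; add_scores"
  define s1 where "s1 = run clear_scores s"
  define S where "S j = for_loop ''j'' (run ?body) j s1" for j
  define P where "P j = pencil d (design (fst s ''n'')) (real j + 1) B" for j
  have dmk: "fst s ''d'' 0 = d" "fst s ''m'' 0 = m" "fst s ''k'' 0 = k" using s by (auto simp: holds_input_def)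
  have "snd (S j) ''D'' 0 i = (\<Sum>j<j. umbral l (lagrange (Suc d) j) * det (rank1_update d (P j) 1 (($) (v i)))) \<and>
      snd (S j) ''N'' 0 i = (\<Sum>j<j. umbral l (lagrange (Suc d) j) * adj_trace d (rank1_update d (P j) 1 (($) (v i))))"
    if "j \<le> Suc d" for j
    using that
  proof (induction j)
    case 0
    then show ?case using i by (simp add: S_def s1_def run_clear_scores dmk)
  next
    case (Suc j)
    define t where "t = run remove_units (run add_design (run init_inverse (S j)))"
    define t' where "t' = run trace_and_weight t"
    have Sj: "holds_input (S j)" using s by (rule holds_input_cong) (auto simp: S_def s1_def)
    have t: "holds_input t" using Sj by (rule holds_input_cong) (auto simp: t_def)
    have t': "holds_input t'" using t by (rule holds_input_cong) (auto simp: t'_def)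
    have "fst (S j) ''n'' = fst s ''n''" "fst (S j) ''j'' 0 = j" by (simp_all add: S_def s1_def)
    then have pair: "inverse_pair d (P j) (snd t ''Q'') (snd t ''p'' 0 0)"
      using run_inverse[OF Sj] by (simp add: t_def P_def)
    then have pair': "inverse_pair d (P j) (snd t' ''Q'') (snd t ''p'' 0 0)" by (simp add: t'_def)
    have dt: "fst t ''d'' 0 = d" using t by (simp add: holds_input_def)
    have "snd t ''W'' (fst t ''j'' 0) (fst t ''k'' 0 - 1 - fst t ''r'' 0) = umbral l (lagrange (Suc d) j)"
      using W[of j] Suc.prems by (simp add: t_def S_def s1_def dmk)
    then have w: "snd t' ''w'' 0 0 = umbral l (lagrange (Suc d) j) * snd t ''p'' 0 0"
      by (simp add: t'_def run_trace_and_weight)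
    have T: "snd t' ''T'' 0 0 = (\<Sum>a<d. snd t' ''Q'' a a)"
      by (simp add: t'_def run_trace_and_weight dt)
    have nz: "det (rank1_update d (P j) 1 (($) (v i))) \<noteq> 0" for i
      unfolding P_def by (intro pos_def_det_nonzero[of d] pos_def_rank1_update pencil_pos_def) auto
    have "snd t' ''D'' = snd (S j) ''D''" "snd t' ''N'' = snd (S j) ''N''"
      by (simp_all add: t'_def t_def)
    moreover have "S (Suc j) = nupdate (run add_scores t') ''j'' 0 (Suc j)"
      by (simp add: S_def t'_def t_def)
    ultimately show ?case
      using run_add_scores[OF t' pair' T w nz i] Suc by simp
  qed
  from this[of "Suc d"]
  show "snd (run compute_scores s) ''D'' 0 i
      = mean_det d l (rank1_update d (design (fst s ''n'')) 1 (($) (v i))) B"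
    "snd (run compute_scores s) ''N'' 0 i
      = mean_adj_trace d l (rank1_update d (design (fst s ''n'')) 1 (($) (v i))) B"
    unfolding mean_det_interpolation mean_adj_trace_interpolation pencil_rank1_update
    by (simp_all add: compute_scores_def S_def s1_def dmk P_def Suc_eq_plus1 del: sum.lessThan_Suc for_loop.simps)
qed

text \<open>The invariant of conditional expectations. Positivity is part of it since for r = k it
  says that the final design is nonsingular.\<close>

lemma rounding_loop_ratio:
  fixes s :: state
  defines "S \<equiv> \<lambda>r. for_loop ''r'' (run rounding_step) r s"
  assumes s: "holds_input s" and n: "\<And>i. fst s ''n'' i = 0"
    and W: "\<And>j l. j < Suc d \<Longrightarrow> l < k \<Longrightarrow> snd s ''W'' j l = umbral l (lagrange (Suc d) j)"
    and start: "0 < mean_det d k (0\<^sub>m d d) B" "mean_adj_trace d k (0\<^sub>m d d) B \<le> \<rho> * mean_det d k (0\<^sub>m d d) B"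
    and "r \<le> k"
  defines "A \<equiv> design (fst (S r) ''n'')"
  shows "0 < mean_det d (k - r) A B \<and> mean_adj_trace d (k - r) A B \<le> \<rho> * mean_det d (k - r) A B"
  using \<open>r \<le> k\<close> unfolding A_def
proof (induction r)
  case 0
  have "design (fst (S 0) ''n'') = 0\<^sub>m d d" by (intro eq_matI) (auto simp: S_def n)
  then show ?case using start by simp
next
  case (Suc r)
  define l where "l = k - Suc r"
  have l: "k - r = Suc l" "k - 1 - r = l" "l < k" using Suc.prems by (auto simp: l_def)
  have Sr: "holds_input (S r)" using s by (rule holds_input_cong) (auto simp: S_def)
  let ?A = "design (fst (S r) ''n'')" and ?t = "run compute_scores (S r)"
  define b where "b = fst (run select_best ?t) ''t'' 0"
  have W': "snd (S r) ''W'' j (k - 1 - fst (S r) ''r'' 0) = umbral l (lagrange (Suc d) j)" if "j < Suc d" for j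
    using W[OF that l(3)] l(2) by (simp add: S_def)
  note scores = run_compute_scores[OF Sr _ W']
  have mt: "fst (S r) ''m'' 0 = m" using Sr by (simp add: holds_input_def)
  have b: "b < m" using run_select_best(1)[of ?t] m_pos by (simp add: mt b_def)
  have ratio: "0 < mean_det d l (rank1_update d ?A 1 (($) (v b))) B"
    "mean_adj_trace d l (rank1_update d ?A 1 (($) (v b))) B \<le> \<rho> * mean_det d l (rank1_update d ?A 1 (($) (v b))) B"
  proof -
    have best: "0 < mean_det d l (rank1_update d ?A 1 (($) (v b))) B \<and>
      mean_adj_trace d l (rank1_update d ?A 1 (($) (v b))) B * mean_det d l (rank1_update d ?A 1 (($) (v i))) B
      \<le> mean_adj_trace d l (rank1_update d ?A 1 (($) (v i))) B * mean_det d l (rank1_update d ?A 1 (($) (v b))) B"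
      if "i < m" "0 < mean_det d l (rank1_update d ?A 1 (($) (v i))) B" for i
      using run_select_best(2)[of ?t i] m_pos b that by (simp add: mt scores flip: b_def)
    have pos: "0 < mean_det d (Suc l) ?A B" and le: "mean_adj_trace d (Suc l) ?A B \<le> \<rho> * mean_det d (Suc l) ?A B"
      using Suc l by auto
    note step = mean_ratio_step[OF prob_nonneg sum_prob _ pos le best]
    show "0 < mean_det d l (rank1_update d ?A 1 (($) (v b))) B"
      "mean_adj_trace d l (rank1_update d ?A 1 (($) (v b))) B \<le> \<rho> * mean_det d l (rank1_update d ?A 1 (($) (v b))) B"
      by (rule step; simp)+
  qed
  have "fst (S (Suc r)) ''n'' = (fst (S r) ''n'')(b := fst (S r) ''n'' b + 1)"
    using rounding_step_output(2)[of "S r"] by (simp add: S_def b_def)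
  then have "(\<lambda>i. real (fst (S (Suc r)) ''n'' i)) = (\<lambda>i. real (fst (S r) ''n'' i))(b := real (fst (S r) ''n'' b) + 1)"
    by auto
  then have "design (fst (S (Suc r)) ''n'') = rank1_update d ?A 1 (($) (v b))"
    using fractional_matrix_fun_upd[OF b, of d v "\<lambda>i. real (fst (S r) ''n'' i)"] by simp
  then show ?case using ratio by (simp add: l_def)
qed

text \<open>The inverse of B = X / k is k times that of X, which is the origin of the numerator
  k.\<close>

lemma start_ratio:
  assumes "trace_inverse (fractional_matrix d m v x) = ereal \<tau>"
  shows "0 < mean_det d k (0\<^sub>m d d) B"
    "mean_adj_trace d k (0\<^sub>m d d) B \<le> real k / (real k - real d + 1) * \<tau> * mean_det d k (0\<^sub>m d d) B"
proof -
  let ?X = "fractional_matrix d m v x"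
  obtain Q where Q: "mat_inverse ?X = Some Q" "Q \<in> carrier_mat d d" "?X * Q = 1\<^sub>m d"
    using det_nonzero_imp_inverse[OF fractional_matrix_carrier nonsingular] .
  have \<tau>: "\<tau> = (\<Sum>a<d. Q $$ (a, a))"
    using assms Q by (simp add: trace_inverse_def mat_trace_def)
  have B: "B = (1 / real k) \<cdot>\<^sub>m ?X"
    by (intro eq_matI) (auto simp: prob_def sum_distrib_left)
  have BR: "B * (real k \<cdot>\<^sub>m Q) = 1\<^sub>m d"
  proof -
    have "B * (real k \<cdot>\<^sub>m Q) = real k \<cdot>\<^sub>m ((1 / real k) \<cdot>\<^sub>m 1\<^sub>m d)"
      unfolding B using Q by (simp add: mult_smult_distrib[of _ d d] mult_smult_assoc_mat[of _ d d])
    also have "\<dots> = 1\<^sub>m d" using k_pos by (intro eq_matI) auto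
    finally show ?thesis .
  qed
  have "det B \<noteq> 0" unfolding B using nonsingular k_pos by (simp add: det_smult)
  then have "0 < det B" using det_fractional_matrix_mono(1)[of m prob d v] prob_nonneg by (simp add: less_le)
  then show "0 < mean_det d k (0\<^sub>m d d) B"
    using umbral_monom_pos[OF dk] by (simp add: mean_det_start)
  have "(\<Sum>a<d. (real k \<cdot>\<^sub>m Q) $$ (a, a)) = real k * \<tau>"
    using Q by (simp add: \<tau> sum_distrib_left)
  then show "mean_adj_trace d k (0\<^sub>m d d) B \<le> real k / (real k - real d + 1) * \<tau> * mean_det d k (0\<^sub>m d d) B"
    using mean_ratio_start[OF _ _ BR d dk] Q by simp
qed

lemma rounding_main_ratio:
  assumes s: "holds_input s" and n: "\<And>i. fst s ''n'' i = 0"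
    and \<tau>: "trace_inverse (fractional_matrix d m v x) = ereal \<tau>"
  shows "trace_inverse (design (fst (run rounding_main s) ''n'')) \<le> ereal (real k / (real k - real d + 1) * \<tau>)"
proof -
  define s1 where "s1 = run interpolation_weights s"
  define S where "S = for_loop ''r'' (run rounding_step) k s1"
  have k: "fst s ''k'' 0 = k" "fst s ''d'' 0 = d" using s by (auto simp: holds_input_def)
  have S: "run rounding_main s = S" by (simp add: rounding_main_def S_def s1_def k)
  let ?A = "design (fst S ''n'')" and ?\<rho> = "real k / (real k - real d + 1) * \<tau>"
  have "holds_input s1" using s by (rule holds_input_cong) (auto simp: s1_def)
  \<comment> \<open>With 0 draws left the mean values are the determinant and the adjugate trace of
    the output.\<close>
  then have "0 < mean_det d (k - k) ?A B \<and> mean_adj_trace d (k - k) ?A B \<le> ?\<rho> * mean_det d (k - k) ?A B"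
    unfolding S_def
    by (rule rounding_loop_ratio)
      (use n start_ratio[OF \<tau>] run_interpolation_weights[of _ s] in \<open>auto simp: s1_def k\<close>)
  then have "0 < det ?A" "adj_trace d ?A \<le> ?\<rho> * det ?A"
    by (simp_all add: mean_det_0 mean_adj_trace_0)
  then show ?thesis unfolding S by (subst trace_inverse_eq) (auto simp: pos_divide_le_eq)
qed

end

section \<open>Running time\<close>

lemma time_O_For_le:
  assumes "time_O ok p g" "\<And>s. ok s \<Longrightarrow> 1 \<le> g s" "\<And>s. ok s \<Longrightarrow> 1 \<le> nval n s"
    "\<And>s. ok s \<Longrightarrow> nval n s * g s \<le> c * h s"
  shows "time_O ok (PFor x n p) h"
  using time_O_For[OF assms(1-3)] assms(4) by (rule time_O_mono)

text \<open>\<open>d \<le> m\<close> lets the d^3 operations that remove the identity be charged to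
  m d^2; the program handles m < d apart.\<close>

definition large :: "state \<Rightarrow> bool" where
  "large s \<longleftrightarrow> 1 \<le> fst s ''d'' 0 \<and> fst s ''d'' 0 \<le> fst s ''k'' 0 \<and> fst s ''d'' 0 \<le> fst s ''m'' 0"

lemma large_bounds:
  assumes "large s"
  defines "d \<equiv> fst s ''d'' 0"
  shows "1 \<le> d" "1 \<le> fst s ''k'' 0" "1 \<le> fst s ''m'' 0" "d \<le> fst s ''m'' 0"
    "d \<le> d ^ 2" "1 \<le> d ^ 2" "d ^ 2 \<le> d ^ 3" "d \<le> d ^ 3" "1 \<le> d ^ 3" "d + 1 \<le> 2 * d"
proof -
  show d: "1 \<le> d" using assms by (simp add: large_def)
  then show "d \<le> d ^ 2" "1 \<le> d ^ 2" "d ^ 2 \<le> d ^ 3" "d \<le> d ^ 3" "1 \<le> d ^ 3" "d + 1 \<le> 2 * d"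
    by (auto intro: self_le_power power_increasing)
qed (use assms in \<open>auto simp: large_def\<close>)

abbreviation (input) "dd s \<equiv> fst s ''d'' 0"
abbreviation (input) "mm s \<equiv> fst s ''m'' 0"
abbreviation (input) "kk s \<equiv> fst s ''k'' 0"

lemma time_square_parts:
  "time_O large load_vec (\<lambda>s. dd s ^ 2)" "time_O large load_unit (\<lambda>s. dd s ^ 2)"
  "time_O large mat_vec (\<lambda>s. dd s ^ 2)" "time_O large update_inverse (\<lambda>s. dd s ^ 2)"
  "time_O large init_inverse (\<lambda>s. dd s ^ 2)" "time_O large inner_products (\<lambda>s. dd s ^ 2)"
  "time_O large trace_and_weight (\<lambda>s. dd s ^ 2)"
proof -
  have one: "1 \<le> dd s ^ 2" "1 \<le> dd s" "dd s * 1 \<le> 1 * dd s ^ 2" "dd s * dd s \<le> 1 * dd s ^ 2" "dd s * 1 \<le> 1 * dd s"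
    if "large s" for s
    using large_bounds[OF that] by (auto simp: power2_eq_square)
  have loop: "time_O large (PFor x (nvar ''d'') p) (\<lambda>s. dd s ^ 2)" if "time_O large p (\<lambda>_. 1)" for x p
    using that one by (intro time_O_For_le[of _ _ "\<lambda>_. 1" _ 1]) auto
  have loop1: "time_O large (PFor x (nvar ''d'') p) dd" if "time_O large p (\<lambda>_. 1)" for x p
    using that one by (intro time_O_For_le[of _ _ "\<lambda>_. 1" _ 1]) auto
  have loop2: "time_O large (PFor x (nvar ''d'') p) (\<lambda>s. dd s ^ 2)" if "time_O large p dd" for x p
    using that one by (intro time_O_For_le[of _ _ dd _ 1]) auto
  note rules = time_O_Seq time_O_atomic[of _ "\<lambda>_. 1"] time_O_atomic[of _ "\<lambda>s. dd s ^ 2"] time_O_atomic[of _ dd]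
  show "time_O large load_vec (\<lambda>s. dd s ^ 2)" "time_O large load_unit (\<lambda>s. dd s ^ 2)"
    "time_O large inner_products (\<lambda>s. dd s ^ 2)" "time_O large trace_and_weight (\<lambda>s. dd s ^ 2)"
    unfolding load_vec_def load_unit_def inner_products_def trace_and_weight_def
    by (intro rules loop; use one in simp)+
  show "time_O large mat_vec (\<lambda>s. dd s ^ 2)" "time_O large init_inverse (\<lambda>s. dd s ^ 2)"
    unfolding mat_vec_def init_inverse_def
    by (intro time_O_Seq time_O_atomic loop2 loop1; use one in simp)+
  show "time_O large update_inverse (\<lambda>s. dd s ^ 2)"
    unfolding update_inverse_def
    by (rule time_O_Seq loop time_O_atomic loop2[OF loop1]; use one in simp)+
qed

lemma time_rounding_step: "time_O large rounding_step (\<lambda>s. mm s * dd s ^ 3)"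
proof -
  have b: "1 \<le> dd s" "1 \<le> mm s" "1 \<le> dd s ^ 2" "1 \<le> mm s * dd s ^ 2" "1 \<le> mm s * dd s ^ 3"
    "dd s * dd s ^ 2 \<le> 1 * (mm s * dd s ^ 2)" "(dd s + 1) * (mm s * dd s ^ 2) \<le> 2 * (mm s * dd s ^ 3)"
    "mm s * 1 \<le> 1 * (mm s * dd s ^ 3)" "dd s ^ 2 \<le> 1 * (mm s * dd s ^ 2)"
    if "large s" for s
  proof -
    note l = large_bounds[OF that]
    show "1 \<le> dd s" "1 \<le> mm s" "1 \<le> dd s ^ 2" by (fact l)+
    show "1 \<le> mm s * dd s ^ 2" "1 \<le> mm s * dd s ^ 3" using l mult_le_mono[of 1 _ 1] by (metis mult_1)+
    show "dd s * dd s ^ 2 \<le> 1 * (mm s * dd s ^ 2)" using mult_le_mono1[OF l(4)] by simp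
    show "(dd s + 1) * (mm s * dd s ^ 2) \<le> 2 * (mm s * dd s ^ 3)"
      using mult_le_mono1[OF l(10), of "mm s * dd s ^ 2"] by (simp add: power3_eq_cube power2_eq_square mult_ac)
    show "mm s * 1 \<le> 1 * (mm s * dd s ^ 3)" using mult_le_mono2[OF l(9)] by simp
    show "dd s ^ 2 \<le> 1 * (mm s * dd s ^ 2)" using mult_le_mono1[OF l(3)] by simp
  qed
  note sq = time_square_parts
  have design: "time_O large add_design (\<lambda>s. mm s * dd s ^ 2)"
    unfolding add_design_def using b
    by (intro time_O_For_le[of _ _ "\<lambda>s. dd s ^ 2" _ 1] time_O_Seq sq time_O_atomic) auto
  have units: "time_O large remove_units (\<lambda>s. mm s * dd s ^ 2)"
    unfolding remove_units_def using b
    by (intro time_O_For_le[of _ _ "\<lambda>s. dd s ^ 2" _ 1] time_O_Seq sq time_O_atomic) auto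
  have scores: "time_O large add_scores (\<lambda>s. mm s * dd s ^ 2)"
    unfolding add_scores_def using b
    by (intro time_O_For_le[of _ _ "\<lambda>s. dd s ^ 2" _ 1] time_O_Seq sq time_O_atomic) auto
  have up: "time_O large p (\<lambda>s. mm s * dd s ^ 2)" if "time_O large p (\<lambda>s. dd s ^ 2)" for p
    using that b(9) by (rule time_O_mono)
  have body: "time_O large (init_inverse ;; add_design ;; remove_units ;; trace_and_weight ;; add_scores)
      (\<lambda>s. mm s * dd s ^ 2)"
    by (intro time_O_Seq design units scores up sq)
  have "time_O large compute_scores (\<lambda>s. mm s * dd s ^ 3)"
    unfolding compute_scores_def clear_scores_def
  proof (rule time_O_Seq)
    show "time_O large (PFor ''i'' (nvar ''m'')
       (PR ''D'' (NConst 0) (nvar ''i'') (RNat (NConst 0)) ;; PR ''N'' (NConst 0) (nvar ''i'') (RNat (NConst 0))))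
       (\<lambda>s. mm s * dd s ^ 3)"
      using b by (intro time_O_For_le[of _ _ "\<lambda>_. 1" _ 1] time_O_Seq time_O_atomic) auto
    show "time_O large (PFor ''j'' (NAdd (nvar ''d'') (NConst 1))
       (init_inverse ;; add_design ;; remove_units ;; trace_and_weight ;; add_scores)) (\<lambda>s. mm s * dd s ^ 3)"
      by (rule time_O_For_le[OF body, of _ 2]) (use b in auto)
  qed
  moreover have "time_O large select_best (\<lambda>s. mm s * dd s ^ 3)"
    unfolding select_best_def
    by (intro time_O_Seq time_O_atomic time_O_For_le[of _ _ "\<lambda>_. 1" _ 1] time_O_If) (use b in auto)
  ultimately show ?thesis
    unfolding rounding_step_def by (intro time_O_Seq time_O_atomic) (use b in auto)
qed

lemma time_rounding_main: "time_O large rounding_main (\<lambda>s. kk s * (mm s * dd s ^ 3))"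
proof -
  have b: "1 \<le> dd s" "1 \<le> kk s" "1 \<le> mm s * dd s ^ 3" "1 \<le> dd s * kk s"
    "(dd s + 1) * kk s \<le> 2 * (dd s * kk s)" "(dd s + 1) * (dd s * kk s) \<le> 2 * (kk s * (mm s * dd s ^ 3))"
    "kk s * 1 \<le> 1 * (dd s * kk s)"
    if "large s" for s
  proof -
    note l = large_bounds[OF that]
    show "1 \<le> dd s" "1 \<le> kk s" by (fact l)+
    show "1 \<le> mm s * dd s ^ 3" "1 \<le> dd s * kk s" using l mult_le_mono[of 1 _ 1] by (metis mult_1)+
    show "(dd s + 1) * kk s \<le> 2 * (dd s * kk s)" using mult_le_mono1[OF l(10), of "kk s"] by simp
    \<comment> \<open>The table of weights costs O(k d^2), below the cost of the main loop.\<close>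
    have "(dd s + 1) * (dd s * kk s) \<le> 2 * dd s * (dd s * kk s)" by (rule mult_le_mono1[OF l(10)])
    also have "\<dots> = 2 * (kk s * dd s ^ 2)" by (simp add: power2_eq_square)
    also have "\<dots> \<le> 2 * (kk s * (mm s * dd s ^ 3))"
      using mult_le_mono[OF l(3) l(7)] by simp
    finally show "(dd s + 1) * (dd s * kk s) \<le> 2 * (kk s * (mm s * dd s ^ 3))" .
    show "kk s * 1 \<le> 1 * (dd s * kk s)" using mult_le_mono1[OF l(1), of "kk s"] by simp
  qed
  have wf: "time_O large weight_factor kk"
    unfolding weight_factor_def Let_def
    by (intro time_O_For_le[of _ _ "\<lambda>_. 1" _ 1] time_O_atomic) (use b in auto)
  have "time_O large interpolation_weights (\<lambda>s. kk s * (mm s * dd s ^ 3))"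
    unfolding interpolation_weights_def
  proof (rule time_O_For_le[of _ _ "\<lambda>s. dd s * kk s" _ 2], rule time_O_Seq)
    show "time_O large (PFor ''l'' (nvar ''k'') (PR ''W'' (nvar ''j'') (nvar ''l'') (RNat (NConst 1)))) (\<lambda>s. dd s * kk s)"
      by (intro time_O_For_le[of _ _ "\<lambda>_. 1" _ 1] time_O_atomic) (use b in auto)
    show "time_O large (PFor ''i'' (NAdd (nvar ''d'') (NConst 1))
        (PIf (BAnd (BNot (NLess (nvar ''i'') (nvar ''j''))) (BNot (NLess (nvar ''j'') (nvar ''i''))))
          PSkip weight_factor)) (\<lambda>s. dd s * kk s)"
      by (intro time_O_For_le[of _ _ kk _ 2] time_O_If time_O_atomic wf) (use b in auto)
  qed (use b in auto)
  moreover have "time_O large (PFor ''r'' (nvar ''k'') rounding_step) (\<lambda>s. kk s * (mm s * dd s ^ 3))"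
    by (rule time_O_For_le[OF time_rounding_step, of _ 1]) (use b in auto)
  ultimately show ?thesis unfolding rounding_main_def by (rule time_O_Seq)
qed

lemma fixed_bounds_rounding_main: "fixed_bounds {''d'', ''m'', ''k''} rounding_main"
  by (simp add: load_vec_def load_unit_def mat_vec_def update_inverse_def init_inverse_def add_design_def
      remove_units_def inner_products_def trace_and_weight_def add_scores_def clear_scores_def rounding_main_def
      compute_scores_def select_best_def rounding_step_def weight_factor_def interpolation_weights_def Let_def)

section \<open>The matrix multiplication exponent is at least two\<close>

text \<open>The school method; it shows \<open>matmul_exponents\<close> to be nonempty, without
  which a lower bound on its elements says nothing about \<open>Inf\<close>.\<close>

definition matmul_prog :: prog where
  "matmul_prog = PFor ''i'' (nvar ''n'') (PFor ''j'' (nvar ''n'') (PFor ''l'' (nvar ''n'')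
     (PR ''C'' (nvar ''i'') (nvar ''j'') (RAdd (RGet ''C'' (nvar ''i'') (nvar ''j''))
       (RMul (RGet ''A'' (nvar ''i'') (nvar ''l'')) (RGet ''B'' (nvar ''l'') (nvar ''j'')))))))"

lemma run_matmul_prog:
  assumes "A \<in> carrier_mat n n" "B \<in> carrier_mat n n"
  shows "matmul_output n (run matmul_prog (matmul_input n A B)) = A * B"
proof -
  let ?p1 = "PR ''C'' (nvar ''i'') (nvar ''j'') (RAdd (RGet ''C'' (nvar ''i'') (nvar ''j''))
       (RMul (RGet ''A'' (nvar ''i'') (nvar ''l'')) (RGet ''B'' (nvar ''l'') (nvar ''j''))))"
  let ?inner = "PFor ''l'' (nvar ''n'') ?p1"
  let ?outer = "PFor ''j'' (nvar ''n'') ?inner"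
  let ?s = "matmul_input n A B"
  have 1: "snd (for_loop ''l'' (run ?p1) h t) ''C'' i j = snd t ''C'' i j
      + (if i = fst t ''i'' 0 \<and> j = fst t ''j'' 0 then \<Sum>l<h. snd t ''A'' i l * snd t ''B'' l j else 0)" for h t i j
    by (induction h) auto
  have 2: "snd (for_loop ''j'' (run ?inner) h t) ''C'' i j = snd t ''C'' i j
      + (if i = fst t ''i'' 0 \<and> j < h then \<Sum>l<fst t ''n'' 0. snd t ''A'' i l * snd t ''B'' l j else 0)" for h t i j
    by (induction h) (auto simp: 1 less_Suc_eq)
  have 3: "snd (for_loop ''i'' (run ?outer) h t) ''C'' i j = snd t ''C'' i j
      + (if i < h \<and> j < fst t ''n'' 0 then \<Sum>l<fst t ''n'' 0. snd t ''A'' i l * snd t ''B'' l j else 0)" for h t i j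
    by (induction h) (auto simp: 2 less_Suc_eq)
  have "snd (run matmul_prog ?s) ''C'' i j = (A * B) $$ (i, j)" if "i < n" "j < n" for i j
    using that assms by (simp add: matmul_prog_def 3 matmul_input_def scalar_prod_def atLeast0LessThan)
  then show ?thesis using assms by (intro eq_matI) (auto simp: matmul_output_def)
qed

lemma matmul_exponents_3: "3 \<in> matmul_exponents"
proof -
  let ?ok = "\<lambda>s :: state. 1 \<le> fst s ''n'' 0"
  have "time_O ?ok matmul_prog (\<lambda>s. fst s ''n'' 0 ^ 3)"
    unfolding matmul_prog_def
  proof (rule time_O_For_le[of _ _ "\<lambda>s. fst s ''n'' 0 ^ 2" _ 1], rule time_O_For_le[of _ _ "\<lambda>s. fst s ''n'' 0" _ 1],
      rule time_O_For_le[of _ _ "\<lambda>_. 1" _ 1], rule time_O_atomic)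
    fix s :: state assume "1 \<le> fst s ''n'' 0"
    then show "1 \<le> fst s ''n'' 0 ^ 2" by (rule one_le_power)
  qed (auto simp: power2_eq_square power3_eq_cube)
  then obtain C where C: "\<And>s. ?ok s \<Longrightarrow> time_bound matmul_prog s \<le> C * fst s ''n'' 0 ^ 3"
    unfolding time_O_def by blast
  have fb: "fixed_bounds {''n''} matmul_prog" by (simp add: matmul_prog_def)
  have "\<exists>t s. exec (compile matmul_prog) (matmul_input n A B) t s \<and> matmul_output n s = A * B \<and>
      real t \<le> real C * real n powr 3"
    if n: "1 \<le> n" and AB: "A \<in> carrier_mat n n" "B \<in> carrier_mat n n" for n A B
  proof -
    obtain t where t: "exec (compile matmul_prog) (matmul_input n A B) t (run matmul_prog (matmul_input n A B))"
      "t \<le> time_bound matmul_prog (matmul_input n A B)"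
      using exec_compile[OF fb, of "matmul_input n A B" "matmul_input n A B"] by auto
    have "t \<le> C * n ^ 3" using t(2) C[of "matmul_input n A B"] n by (simp add: matmul_input_def)
    then have "real t \<le> real C * real n ^ 3" by (metis of_nat_le_iff of_nat_mult of_nat_power)
    also have "real n ^ 3 = real n powr 3" using n powr_realpow[of "real n" 3] by simp
    finally show ?thesis using t(1) run_matmul_prog[OF AB] by blast
  qed
  then show ?thesis unfolding matmul_exponents_def by blast
qed

text \<open>A real assignment changes at most one cell and costs at least one step.\<close>

lemma card_changed_le_time:
  assumes "exec c s t s'"
  shows "finite {(i, j). snd s' a i j \<noteq> snd s a i j} \<and> card {(i, j). snd s' a i j \<noteq> snd s a i j} \<le> t"
  using assms
proof (induction rule: exec.induct)
  case (RSet b i j e s)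
  define M where "M = {(i', j'). snd (rupdate s b (nval i s) (nval j s) (rval e s)) a i' j' \<noteq> snd s a i' j'}"
  have "M \<subseteq> {(nval i s, nval j s)}" by (auto simp: M_def split: if_splits)
  then have "finite M \<and> card M \<le> 1"
    using card_mono[of "{(nval i s, nval j s)}" M] by (auto intro: finite_subset)
  then show ?case unfolding M_def by linarith
next
  case (Seq c s t s' c' t' s'')
  have "{(i, j). snd s'' a i j \<noteq> snd s a i j} \<subseteq> {(i, j). snd s' a i j \<noteq> snd s a i j} \<union> {(i, j). snd s'' a i j \<noteq> snd s' a i j}"
    by auto
  with Seq.IH show ?case
    by (meson add_mono card_Un_le card_mono finite_UnI finite_subset order_trans)
next
  case (WhileTrue b s c t s' t' s'')
  have sub: "{(i, j). snd s'' a i j \<noteq> snd s a i j} \<subseteq> {(i, j). snd s' a i j \<noteq> snd s a i j} \<union> {(i, j). snd s'' a i j \<noteq> snd s' a i j}"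
    by auto
  have "finite {(i, j). snd s'' a i j \<noteq> snd s a i j} \<and> card {(i, j). snd s'' a i j \<noteq> snd s a i j} \<le> t + t'"
    using WhileTrue.IH sub by (meson add_mono card_Un_le card_mono finite_UnI finite_subset order_trans)
  then show ?case by linarith
qed auto

text \<open>The square of the all-ones matrix has no zero entry while \<open>C\<close> starts at
  zero, so n^2 cells must be written.\<close>

lemma matmul_exponents_ge_2:
  assumes "w \<in> matmul_exponents"
  shows "2 \<le> w"
proof (rule ccontr)
  assume "\<not> 2 \<le> w"
  obtain P C where PC: "\<And>n A B. 1 \<le> n \<Longrightarrow> A \<in> carrier_mat n n \<Longrightarrow> B \<in> carrier_mat n n \<Longrightarrow>
     \<exists>t s. exec P (matmul_input n A B) t s \<and> matmul_output n s = A * B \<and> real t \<le> C * real n powr w"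
    using assms unfolding matmul_exponents_def by blast
  have le: "real n ^ 2 \<le> C * real n powr w" if n: "1 \<le> n" for n
  proof -
    let ?J = "mat n n (\<lambda>_. 1) :: real mat"
    obtain t s where ts: "exec P (matmul_input n ?J ?J) t s" "matmul_output n s = ?J * ?J" "real t \<le> C * real n powr w"
      using PC[OF n, of ?J ?J] by auto
    let ?ch = "{(i, j). snd s ''C'' i j \<noteq> snd (matmul_input n ?J ?J) ''C'' i j}"
    have "snd s ''C'' i j = real n" if "i < n" "j < n" for i j
      using arg_cong[OF ts(2), of "\<lambda>M. M $$ (i, j)"] that by (simp add: matmul_output_def scalar_prod_def)
    then have "{..<n} \<times> {..<n} \<subseteq> ?ch" using n by (auto simp: matmul_input_def)
    then have "card ({..<n} \<times> {..<n}) \<le> t"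
      using card_changed_le_time[OF ts(1), of "''C''"] by (meson card_mono order_trans)
    then have "real (n * n) \<le> real t" by (simp only: card_cartesian_product card_lessThan of_nat_le_iff)
    then show ?thesis using ts(3) by (simp add: power2_eq_square)
  qed
  define e where "e = 2 - w"
  have e: "0 < e" using \<open>\<not> 2 \<le> w\<close> by (simp add: e_def)
  have C: "1 \<le> C" using le[of 1] by simp
  \<comment> \<open>Chosen so that n^(2 - w) \<ge> C + 1, which contradicts n^2 \<le> C n^w.\<close>
  obtain n :: nat where n: "(C + 1) powr (1 / e) \<le> real n" using real_arch_simple by blast
  have "1 \<le> (C + 1) powr (1 / e)" using C e by (intro ge_one_powr_ge_zero) auto
  then have n1: "1 \<le> n" using n by linarith
  have "C + 1 = ((C + 1) powr (1 / e)) powr e" using C e by (simp add: powr_powr)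
  also have "\<dots> \<le> real n powr e" using n e by (intro powr_mono2) auto
  finally have "(C + 1) * real n powr w \<le> real n powr e * real n powr w" by (intro mult_right_mono) auto
  also have "\<dots> = real n ^ 2" using n1 by (simp add: e_def flip: powr_add)
  also have "\<dots> \<le> C * real n powr w" by (rule le[OF n1])
  finally have "real n powr w \<le> 0" by (simp add: distrib_right)
  then show False using n1 by simp
qed

lemma matmul_exponent_ge_2: "2 \<le> matmul_exponent"
  unfolding matmul_exponent_def using matmul_exponents_3 matmul_exponents_ge_2 by (intro cInf_greatest) auto

section \<open>The rounding theorem\<close>

lemma design_matrix_eq:
  assumes "set_mset S \<subseteq> {..<m}"
  shows "design_matrix d v S = fractional_matrix d m v (\<lambda>i. real (count S i))"
proof -
  have "(\<Sum>i\<in>#S. f i) = (\<Sum>i<m. real (count S i) * f i)" for f :: "nat \<Rightarrow> real"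
    using assms
  proof (induction S)
    case (add j S)
    have "(\<Sum>i<m. real (count (add_mset j S) i) * f i) = (\<Sum>i<m. real (count S i) * f i + (if i = j then f j else 0))"
      by (intro sum.cong) (auto simp: algebra_simps)
    then show ?case using add by (simp add: sum.distrib)
  qed simp
  then show ?thesis by (simp add: design_matrix_def fractional_matrix_def)
qed

text \<open>The multiplicities of a multiset of size k form a feasible point of the relaxation with
  the same matrix.\<close>

lemma relaxation_le_A_design_opt:
  assumes "relaxation_optimal d m k v x"
  shows "trace_inverse (fractional_matrix d m v x) \<le> A_design_opt d m k v"
  unfolding A_design_opt_def
proof (rule INF_greatest)
  fix S assume "S \<in> {S. size S = k \<and> set_mset S \<subseteq> {..<m}}"
  then have S: "size S = k" "set_mset S \<subseteq> {..<m}" by auto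
  have "(\<Sum>i<m. count S i) = size S"
    unfolding size_multiset_overloaded_eq using S(2)
    by (intro sum.mono_neutral_right) (auto simp: not_in_iff)
  then have "(\<Sum>i<m. real (count S i)) = real k" using S(1) by (metis of_nat_sum)
  then have "relaxation_feasible m k (\<lambda>i. real (count S i))"
    by (simp add: relaxation_feasible_def)
  then show "trace_inverse (fractional_matrix d m v x) \<le> trace_inverse (design_matrix d v S)"
    using assms unfolding relaxation_optimal_def design_matrix_eq[OF S(2)] by blast
qed

theorem theorem1p3:
  shows "\<exists>(P :: com) (C :: real).
    \<forall>(d :: nat) (m :: nat) (k :: nat) (v :: nat \<Rightarrow> real vec) (x :: nat \<Rightarrow> real).
      1 \<le> d \<and> d \<le> k \<and> (\<forall>i<m. v i \<in> carrier_vec d) \<and>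
      relaxation_optimal d m k v x \<and> (\<Sum>i<m. x i) = real k \<longrightarrow>
      (\<exists>t s. exec P (rounding_input d m k v x) t s \<and>
         real t \<le> C * real k * real m * real d powr (matmul_exponent + 1) \<and>
         set (rounding_output k s) \<subseteq> {..<m} \<and>
         trace_inverse (design_matrix d v (mset (rounding_output k s)))
           \<le> ereal (real k / (real k - real d + 1)) * trace_inverse (fractional_matrix d m v x) \<and>
         trace_inverse (design_matrix d v (mset (rounding_output k s)))
           \<le> ereal (real k / (real k - real d + 1)) * A_design_opt d m k v)"
proof -
  let ?b = "NLess (nvar ''m'') (nvar ''d'')"
  \<comment> \<open>For m < d the untouched output array consists of zeros, the valid index 0 taken
    k times.\<close>
  let ?P = "If ?b Skip (compile rounding_main)"
  obtain C where C: "\<And>s. large s \<Longrightarrow> time_bound rounding_main s \<le> C * (kk s * (mm s * dd s ^ 3))"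
    using time_rounding_main unfolding time_O_def by blast
  \<comment> \<open>The 7 pays for the test (6 steps) and \<open>Skip\<close> (1 step).\<close>
  have "\<exists>t s. exec ?P (rounding_input d m k v x) t s \<and>
         real t \<le> real (7 + C) * real k * real m * real d powr (matmul_exponent + 1) \<and>
         set (rounding_output k s) \<subseteq> {..<m} \<and>
         trace_inverse (design_matrix d v (mset (rounding_output k s)))
           \<le> ereal (real k / (real k - real d + 1)) * trace_inverse (fractional_matrix d m v x) \<and>
         trace_inverse (design_matrix d v (mset (rounding_output k s)))
           \<le> ereal (real k / (real k - real d + 1)) * A_design_opt d m k v"
    if d: "1 \<le> d" and dk: "d \<le> k" and opt: "relaxation_optimal d m k v x" and sum: "(\<Sum>i<m. x i) = real k"
    for d m k v x
  proof -
    let ?s = "rounding_input d m k v x" and ?X = "fractional_matrix d m v x"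
    let ?c = "real k / (real k - real d + 1)"
    have m: "1 \<le> m" using sum d dk by (cases m) auto
    have c: "0 < ?c" using d dk by (intro divide_pos_pos) auto
    have s: "fst ?s ''d'' 0 = d" "fst ?s ''m'' 0 = m" "fst ?s ''k'' 0 = k"
      "\<And>i. fst ?s ''n'' i = 0" "\<And>i. fst ?s ''s'' i = 0"
      by (simp_all add: rounding_input_def)
    have "\<exists>t s. exec ?P ?s t s \<and> t \<le> (7 + C) * (k * (m * d ^ 3)) \<and> set (rounding_output k s) \<subseteq> {..<m} \<and>
        (det ?X \<noteq> 0 \<longrightarrow> trace_inverse (design_matrix d v (mset (rounding_output k s))) \<le> ereal ?c * trace_inverse ?X)"
    proof (cases "m < d")
      case True
      have "exec ?P ?s (1 + bcost ?b + 1) ?s"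
        using True by (intro exec.IfTrue exec.Skip) (simp add: s)
      moreover have "1 + bcost ?b + 1 \<le> (7 + C) * (k * (m * d ^ 3))"
      proof -
        have "1 * (1 * 1) \<le> k * (m * d ^ 3)" using d dk m by (intro mult_le_mono) auto
        then have "7 * 1 \<le> (7 + C) * (k * (m * d ^ 3))" by (intro mult_le_mono) auto
        then show ?thesis by simp
      qed
      moreover have "set (rounding_output k ?s) \<subseteq> {..<m}" using m by (auto simp: rounding_output_def s)
      moreover have "det ?X = 0" by (rule det_fractional_matrix_few_vectors[OF True])
      ultimately show ?thesis by blast
    next
      case False
      let ?s' = "run rounding_main ?s"
      obtain t where t: "exec (compile rounding_main) ?s t ?s'" "t \<le> time_bound rounding_main ?s"
        using exec_compile[OF fixed_bounds_rounding_main, of ?s ?s] by auto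
      have ex: "exec ?P ?s (1 + bcost ?b + t) ?s'"
        using False t(1) by (intro exec.IfFalse) (auto simp: s)
      have "1 * (1 * 1) \<le> k * (m * d ^ 3)" using d dk m by (intro mult_le_mono) auto
      moreover have "t \<le> C * (k * (m * d ^ 3))"
        using t(2) C[of ?s] False d dk by (simp add: large_def s)
      ultimately have time: "1 + bcost ?b + t \<le> (7 + C) * (k * (m * d ^ 3))"
        by (simp add: distrib_right)
      define s1 where "s1 = run interpolation_weights ?s"
      have s1: "fst s1 ''m'' 0 = m" "\<And>i. fst s1 ''n'' i = 0" by (simp_all add: s1_def s)
      have s': "?s' = for_loop ''r'' (run rounding_step) k s1" by (simp add: rounding_main_def s1_def s)
      note out = rounding_loop_output[of s1 k, folded s', unfolded s1, folded rounding_output_def]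
      have range: "set (rounding_output k ?s') \<subseteq> {..<m}" using out(1) m by simp
      have "count (mset (rounding_output k ?s')) i = fst ?s' ''n'' i" for i using out(2) m by simp
      then have des: "design_matrix d v (mset (rounding_output k ?s')) = fractional_matrix d m v (\<lambda>i. real (fst ?s' ''n'' i))"
        using range by (subst design_matrix_eq[of _ m]) auto
      have "trace_inverse (design_matrix d v (mset (rounding_output k ?s'))) \<le> ereal ?c * trace_inverse ?X"
        if "det ?X \<noteq> 0"
      proof -
        interpret rounding_instance d m k v x
          using d dk opt sum that by unfold_locales (auto simp: relaxation_optimal_def relaxation_feasible_def)
        have "holds_input ?s" by (auto simp: holds_input_def rounding_input_def)
        moreover obtain \<tau> where "trace_inverse ?X = ereal \<tau>"
          using trace_inverse_eq[OF fractional_matrix_carrier nonsingular] by blast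
        ultimately show ?thesis using rounding_main_ratio[of ?s] s(4) by (simp add: des)
      qed
      then show ?thesis using ex time range by blast
    qed
    then obtain t s' where r: "exec ?P ?s t s'" "t \<le> (7 + C) * (k * (m * d ^ 3))" "set (rounding_output k s') \<subseteq> {..<m}"
      "det ?X \<noteq> 0 \<Longrightarrow> trace_inverse (design_matrix d v (mset (rounding_output k s'))) \<le> ereal ?c * trace_inverse ?X"
      by blast
    \<comment> \<open>Cubic time fits because the exponent of matrix multiplication is at least 2
      and d \<ge> 1.\<close>
    have "real d ^ 3 = real d powr 3" using d powr_realpow[of "real d" 3] by simp
    also have "\<dots> \<le> real d powr (matmul_exponent + 1)"
      using matmul_exponent_ge_2 d by (intro powr_mono) auto
    finally have pow: "real d ^ 3 \<le> real d powr (matmul_exponent + 1)" .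
    have "real t \<le> real ((7 + C) * (k * (m * d ^ 3)))" using r(2) by (simp only: of_nat_le_iff)
    also have "\<dots> = real (7 + C) * real k * real m * real d ^ 3"
      by (simp only: of_nat_mult of_nat_power mult.assoc)
    also have "\<dots> \<le> real (7 + C) * real k * real m * real d powr (matmul_exponent + 1)"
      using pow by (intro mult_left_mono) auto
    finally have time: "real t \<le> real (7 + C) * real k * real m * real d powr (matmul_exponent + 1)" .
    have bound: "trace_inverse (design_matrix d v (mset (rounding_output k s'))) \<le> ereal ?c * trace_inverse ?X"
    proof (cases "det ?X = 0")
      case True
      \<comment> \<open>For singular X the right-hand side is infinite, whatever was
        selected.\<close>
      have "ereal r * \<infinity> = \<infinity>" if "0 < r" for r using that by simp
      then show ?thesis using c trace_inverse_singular[OF fractional_matrix_carrier True] by (simp only: ereal_less_eq)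
    qed (rule r(4))
    also have "\<dots> \<le> ereal ?c * A_design_opt d m k v"
      using relaxation_le_A_design_opt[OF opt] c by (intro ereal_mult_left_mono) auto
    finally show ?thesis using r(1,3) time bound by blast
  qed
  then show ?thesis by blast
qed

end
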